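(* Let $\mathbb{k}$ be a field and let $M\in\mathrm{rep}_0(\mathbb{Z}^2)$. Then: 1. $\mathcal{N}^2(M)\ge\dim_{\mathbb{k}} M_i$ for every $i\in\mathbb{Z}^2$. 2. $\mathcal{N}^2(M)=0$ if and only if $M\cong 0$. 3. $\mathcal{N}^2(M)=1$ if and only if $M$ is (isomorphic to) a spread representation. 4. $\mathcal{N}^2(M)\ge\mathcal{N}^{\mathrm{dec}}(M)$, and $\mathcal{N}^2(M)=\mathcal{N}^{\mathrm{dec}}(M)$ if and only if $M$ is spread-decomposable.
   Context: $\mathrm{rep}_0(\mathbb{Z}^2)$ is the category of functors from the poset $\mathbb{Z}^2$ (product order) to finite dimensional $\mathbb{k}$-vector spaces with finite support, identified with finite dimensional bigraded $\mathbb{k}[\mathbf{x},\mathbf{y}]$-modules ($\mathbf{x}:M_i\to M_{i+(1,0)}$ and $\mathbf{y}:M_i\to M_{i+(0,1)}$ being structure maps). $\mathcal{N}^2(M)=\dim M-\dim\mathbf{x}M-\dim\mathbf{y}M+\dim\mathbf{x}\mathbf{y}M$ (total dimensions over $\mathbb{k}$). $\mathcal{N}^{\mathrm{dec}}(M)$ is the number of indecomposable summands of $M$, counted with multiplicity. A spread of a poset is a non-empty subset $I$ that is poset-connected (any two elements are joined by a sequence in $I$ whose consecutive elements are comparable) and poset-convex ($x\le y\le z$, $x,z\in I$ implies $y\in I$); the spread representation $\mathbb{k}_I$ is $\mathbb{k}$ on $I$, $0$ elsewhere, with identity structure maps within $I$. A representation is spread-decomposable if it is isomorphic to a direct sum of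 spread representations. *)

theory Defs
  imports "HOL.Vector_Spaces" "HOL-Library.Product_Order" "HOL-Library.Function_Algebras"
begin

text \<open>
  A representation \<open>M\<close> of a poset has vector spaces \<open>space_at M i\<close> and structure maps
  \<open>struct_map M i j\<close> for \<open>i \<le> j\<close>.  The spaces are subspaces of one ambient vector space, whose
  vectors form the type \<open>'v\<close> and whose scalar multiplication is passed separately as an argument
  \<open>s\<close>; nothing relates the positions of the subspaces for different \<open>i\<close>.  Values of
  \<open>struct_map M i j\<close> for \<open>\<not> i \<le> j\<close>, or outside of \<open>space_at M i\<close>, are irrelevant.
\<close>

record ('p, 'v) rep =
  space_at :: "'p \<Rightarrow> 'v set"
  struct_map :: "'p \<Rightarrow> 'p \<Rightarrow> 'v \<Rightarrow> 'v"

definition linear_between ::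
  "('k::field \<Rightarrow> 'v::ab_group_add \<Rightarrow> 'v) \<Rightarrow> ('k \<Rightarrow> 'w::ab_group_add \<Rightarrow> 'w)
     \<Rightarrow> 'v set \<Rightarrow> 'w set \<Rightarrow> ('v \<Rightarrow> 'w) \<Rightarrow> bool"
  where "linear_between s t U W f \<longleftrightarrow>
    f ` U \<subseteq> W \<and>
    (\<forall>u\<in>U. \<forall>v\<in>U. f (u + v) = f u + f v) \<and>
    (\<forall>c. \<forall>u\<in>U. f (s c u) = t c (f u))"

definition is_rep :: "('k::field \<Rightarrow> 'v::ab_group_add \<Rightarrow> 'v) \<Rightarrow> ('p::order, 'v) rep \<Rightarrow> bool"
  where "is_rep s M \<longleftrightarrow>
    vector_space s \<and>
    (\<forall>i. module.subspace s (space_at M i)) \<and>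
    (\<forall>i j. i \<le> j \<longrightarrow> linear_between s s (space_at M i) (space_at M j) (struct_map M i j)) \<and>
    (\<forall>i. \<forall>v\<in>space_at M i. struct_map M i i v = v) \<and>
    (\<forall>i j l. i \<le> j \<longrightarrow> j \<le> l \<longrightarrow>
       (\<forall>v\<in>space_at M i. struct_map M j l (struct_map M i j v) = struct_map M i l v))"

definition is_rep0 :: "('k::field \<Rightarrow> 'v::ab_group_add \<Rightarrow> 'v) \<Rightarrow> ('p::order, 'v) rep \<Rightarrow> bool"
  where "is_rep0 s M \<longleftrightarrow>
    is_rep s M \<and>
    (\<forall>i. \<exists>B. finite B \<and> space_at M i = module.span s B) \<and>
    finite {i. space_at M i \<noteq> {0}}"

definition rep_hom ::
  "('k::field \<Rightarrow> 'v::ab_group_add \<Rightarrow> 'v) \<Rightarrow> ('k \<Rightarrow> 'w::ab_group_add \<Rightarrow> 'w)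
     \<Rightarrow> ('p::order, 'v) rep \<Rightarrow> ('p, 'w) rep \<Rightarrow> ('p \<Rightarrow> 'v \<Rightarrow> 'w) \<Rightarrow> bool"
  where "rep_hom s t M N \<phi> \<longleftrightarrow>
    (\<forall>i. linear_between s t (space_at M i) (space_at N i) (\<phi> i)) \<and>
    (\<forall>i j. i \<le> j \<longrightarrow>
       (\<forall>v\<in>space_at M i. \<phi> j (struct_map M i j v) = struct_map N i j (\<phi> i v)))"

definition rep_iso ::
  "('k::field \<Rightarrow> 'v::ab_group_add \<Rightarrow> 'v) \<Rightarrow> ('k \<Rightarrow> 'w::ab_group_add \<Rightarrow> 'w)
     \<Rightarrow> ('p::order, 'v) rep \<Rightarrow> ('p, 'w) rep \<Rightarrow> bool"
  where "rep_iso s t M N \<longleftrightarrow>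
    (\<exists>\<phi> \<psi>. rep_hom s t M N \<phi> \<and> rep_hom t s N M \<psi> \<and>
      (\<forall>i. \<forall>v\<in>space_at M i. \<psi> i (\<phi> i v) = v) \<and>
      (\<forall>i. \<forall>w\<in>space_at N i. \<phi> i (\<psi> i w) = w))"

definition zero_rep :: "('p, 'v::zero) rep"
  where "zero_rep = \<lparr> space_at = (\<lambda>i. {0}), struct_map = (\<lambda>i j v. 0) \<rparr>"

text \<open>
  The external direct sum of a list of representations lives in the ambient space of functions
  \<open>nat \<Rightarrow> 'v\<close> with pointwise operations; coordinates beyond the length of the list are \<open>0\<close>.
\<close>

definition direct_sum :: "('p, 'v::zero) rep list \<Rightarrow> ('p, nat \<Rightarrow> 'v) rep"
  where "direct_sum Ns = \<lparr>
    space_at = (\<lambda>i. {f. (\<forall>k<length Ns. f k \<in> space_at (Ns ! k) i) \<and> (\<forall>k\<ge>length Ns. f k = 0)}),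
    struct_map = (\<lambda>i j f k. if k < length Ns then struct_map (Ns ! k) i j (f k) else 0) \<rparr>"

definition pointwise_scale :: "('k \<Rightarrow> 'v \<Rightarrow> 'v) \<Rightarrow> 'k \<Rightarrow> (nat \<Rightarrow> 'v) \<Rightarrow> (nat \<Rightarrow> 'v)"
  where "pointwise_scale s c f = (\<lambda>k. s c (f k))"

text \<open>
  Summands of \<open>M\<close> are isomorphic to subrepresentations of \<open>M\<close>, so that below it is no restriction
  to let them range over representations with the same ambient space as \<open>M\<close>.
\<close>

definition indecomposable :: "('k::field \<Rightarrow> 'v::ab_group_add \<Rightarrow> 'v) \<Rightarrow> ('p::order, 'v) rep \<Rightarrow> bool"
  where "indecomposable s M \<longleftrightarrow>
    is_rep0 s M \<and> \<not> rep_iso s s M zero_rep \<and>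
    (\<forall>A B. is_rep0 s A \<longrightarrow> is_rep0 s B \<longrightarrow>
       rep_iso s (pointwise_scale s) M (direct_sum [A, B]) \<longrightarrow>
       rep_iso s s A zero_rep \<or> rep_iso s s B zero_rep)"

text \<open>The number is unique by the Krull--Schmidt theorem.\<close>

definition N_dec :: "('k::field \<Rightarrow> 'v::ab_group_add \<Rightarrow> 'v) \<Rightarrow> ('p::order, 'v) rep \<Rightarrow> nat"
  where "N_dec s M =
    (THE n. \<exists>Ns. length Ns = n \<and> (\<forall>N\<in>set Ns. indecomposable s N) \<and>
       rep_iso s (pointwise_scale s) M (direct_sum Ns))"

definition total_dim :: "('k::field \<Rightarrow> 'v::ab_group_add \<Rightarrow> 'v) \<Rightarrow> ('p \<Rightarrow> 'v set) \<Rightarrow> nat"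
  where "total_dim s S = (\<Sum>i\<in>{i. S i \<noteq> {0}}. vector_space.dim s (S i))"

text \<open>Images of a graded subspace \<open>S\<close> of \<open>M\<close> under the actions of the two variables.\<close>

definition x_image :: "(int \<times> int, 'v) rep \<Rightarrow> (int \<times> int \<Rightarrow> 'v set) \<Rightarrow> int \<times> int \<Rightarrow> 'v set"
  where "x_image M S = (\<lambda>(a, b). struct_map M (a - 1, b) (a, b) ` S (a - 1, b))"

definition y_image :: "(int \<times> int, 'v) rep \<Rightarrow> (int \<times> int \<Rightarrow> 'v set) \<Rightarrow> int \<times> int \<Rightarrow> 'v set"
  where "y_image M S = (\<lambda>(a, b). struct_map M (a, b - 1) (a, b) ` S (a, b - 1))"

definition N_two :: "('k::field \<Rightarrow> 'v::ab_group_add \<Rightarrow> 'v) \<Rightarrow> (int \<times> int, 'v) rep \<Rightarrow> int"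
  where "N_two s M =
    int (total_dim s (space_at M))
    - int (total_dim s (x_image M (space_at M)))
    - int (total_dim s (y_image M (space_at M)))
    + int (total_dim s (x_image M (y_image M (space_at M))))"

definition poset_connected :: "'p::order set \<Rightarrow> bool"
  where "poset_connected I \<longleftrightarrow>
    (\<forall>x\<in>I. \<forall>y\<in>I. (x, y) \<in> {(a, b). a \<in> I \<and> b \<in> I \<and> (a \<le> b \<or> b \<le> a)}\<^sup>*)"

definition poset_convex :: "'p::order set \<Rightarrow> bool"
  where "poset_convex I \<longleftrightarrow> (\<forall>x\<in>I. \<forall>z\<in>I. \<forall>y. x \<le> y \<longrightarrow> y \<le> z \<longrightarrow> y \<in> I)"

definition spread :: "'p::order set \<Rightarrow> bool"
  where "spread I \<longleftrightarrow> I \<noteq> {} \<and> poset_connected I \<and> poset_convex I"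

text \<open>The ambient space is the field itself, with scalar multiplication \<open>(*)\<close>.\<close>

definition spread_rep :: "'p::order set \<Rightarrow> ('p, 'k::field) rep"
  where "spread_rep I = \<lparr>
    space_at = (\<lambda>i. if i \<in> I then UNIV else {0}),
    struct_map = (\<lambda>i j v. if i \<in> I \<and> j \<in> I then v else 0) \<rparr>"

definition iso_to_spread_rep :: "('k::field \<Rightarrow> 'v::ab_group_add \<Rightarrow> 'v) \<Rightarrow> ('p::order, 'v) rep \<Rightarrow> bool"
  where "iso_to_spread_rep s M \<longleftrightarrow> (\<exists>I. spread I \<and> rep_iso s (*) M (spread_rep I))"

definition spread_decomposable :: "('k::field \<Rightarrow> 'v::ab_group_add \<Rightarrow> 'v) \<Rightarrow> ('p::order, 'v) rep \<Rightarrow> bool"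
  where "spread_decomposable s M \<longleftrightarrow>
    (\<exists>Is. (\<forall>I\<in>set Is. spread I) \<and>
       rep_iso s (pointwise_scale (*)) M (direct_sum (map spread_rep Is)))"

end

theory Submission
  imports Defs "HOL-Library.Set_Algebras"
begin

text \<open>
  For a finitely supported chain of vector spaces (a row of \<open>M\<close>) the number \<open>dim A - dim xA\<close> counts
  the bars of \<open>A\<close>; write \<open>\<alpha> q\<close> for this count on row \<open>q\<close> of \<open>M\<close> and \<open>\<beta> q\<close> for the count on the
  \<open>y\<close>-image of row \<open>q\<close> in row \<open>q + 1\<close>.  Since this image is a quotient of row \<open>q\<close> and a subobject of
  row \<open>q + 1\<close>, rank-nullity gives \<open>\<beta> q \<le> \<alpha> q\<close> and \<open>\<beta> q \<le> \<alpha> (q + 1)\<close>, so for every row \<open>b\<close> the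
  alternating sum \<open>\<Sum> \<alpha> - \<Sum> \<beta>\<close>, which is the invariant, equals \<open>\<alpha> b\<close> plus nonnegative terms
  \<open>\<alpha> q - \<beta> q\<close> (below \<open>b\<close>) and \<open>\<alpha> (q + 1) - \<beta> q\<close> (from \<open>b\<close> on).  The same argument inside a row
  gives \<open>\<alpha> b \<ge> dim\<close>.  If the invariant is 1, all these terms vanish: rows are intervals whose left
  and right ends move to the left as \<open>q\<close> grows and all maps inside the support are isomorphisms, which
  forces a spread.  The last part follows by additivity, once the number of indecomposable summands is
  known to be unique; this is the Krull--Schmidt theorem, proved in the lattice of subrepresentations
  by Fitting's lemma and an exchange argument.
\<close>

section \<open>Direct decompositions in a lattice of subgroups\<close>

text \<open>Both inequalities between row counts come from counting bars in two ways: by left ends,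
  that is cokernels of \<open>x\<close>, which cannot grow under a quotient, and by right ends, that
  is kernels of \<open>x\<close>, which cannot grow under passage to a subobject. Neither count
  alone gives both inequalities. One telescoping identity then serves between rows, inside a row,
  and for computing the invariant of a spread.

  \<open>N_dec\<close> is a definite description, so it has a usable value only once existence and
  uniqueness of the number are known. Existence is an induction on the invariant itself, which is
  additive and positive on nonzero modules. For uniqueness, a subrepresentation is encoded as the
  set of all families of vectors chosen from its spaces. Subrepresentations thereby become subgroups
  of one abelian group, and the exchange argument runs on sums, intersections and a strictly
  monotone length. The maps it needs are composites of projections, and these are built from the
  lattice operations.

  The spread summands live over the field as ambient space, not in the ambient space of
  \<open>M\<close>. Several statements therefore carry two scalar multiplications \<open>s\<close>
  and \<open>t\<close>.\<close>

locale subgroup_lattice =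
  fixes L :: "'w::ab_group_add set set" and len :: "'w set \<Rightarrow> nat"
  assumes L_0: "X \<in> L \<Longrightarrow> 0 \<in> X"
    and L_diff: "X \<in> L \<Longrightarrow> x \<in> X \<Longrightarrow> y \<in> X \<Longrightarrow> x - y \<in> X"
    and zero_in_L: "{0} \<in> L"
    and Int_in_L: "X \<in> L \<Longrightarrow> Y \<in> L \<Longrightarrow> X \<inter> Y \<in> L"
    and plus_in_L: "X \<in> L \<Longrightarrow> Y \<in> L \<Longrightarrow> X + Y \<in> L"
    and len_strict_mono: "X \<in> L \<Longrightarrow> Y \<in> L \<Longrightarrow> X \<subset> Y \<Longrightarrow> len X < len Y"
begin

lemma L_minus: "X \<in> L \<Longrightarrow> x \<in> X \<Longrightarrow> - x \<in> X"
  using L_diff[of X 0 x] L_0 by simp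

lemma L_add: "X \<in> L \<Longrightarrow> x \<in> X \<Longrightarrow> y \<in> X \<Longrightarrow> x + y \<in> X"
  using L_diff[of X x "- y"] L_minus by simp

definition dsum :: "'w set \<Rightarrow> 'w set \<Rightarrow> 'w set \<Rightarrow> bool"
  where "dsum T A B \<longleftrightarrow> A \<in> L \<and> B \<in> L \<and> T = A + B \<and> A \<inter> B = {0}"

lemma dsumD:
  assumes "dsum T A B"
  shows "A \<in> L" "B \<in> L" "T = A + B" "A \<inter> B = {0}" "T \<in> L" "A \<subseteq> T" "B \<subseteq> T"
proof -
  show *: "A \<in> L" "B \<in> L" "T = A + B" "A \<inter> B = {0}"
    using assms by (auto simp: dsum_def)
  show "T \<in> L" using * plus_in_L by simp
  show "A \<subseteq> T" using * L_0[of B] by (force simp: set_plus_def)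
  show "B \<subseteq> T" using * L_0[of A] by (force simp: set_plus_def)
qed

lemma dsumI:
  assumes "A \<in> L" "B \<in> L" "A \<subseteq> T" "B \<subseteq> T" "T \<in> L"
    and "\<And>x. x \<in> T \<Longrightarrow> \<exists>a\<in>A. x - a \<in> B"
    and "\<And>x. x \<in> A \<Longrightarrow> x \<in> B \<Longrightarrow> x = 0"
  shows "dsum T A B"
proof -
  have "T \<subseteq> A + B"
  proof
    fix x assume "x \<in> T"
    then obtain a where "a \<in> A" "x - a \<in> B" using assms(6) by blast
    then have "a + (x - a) \<in> A + B" by blast
    then show "x \<in> A + B" by simp
  qed
  moreover have "A + B \<subseteq> T"
    using assms(3,4) L_add[OF assms(5)] by (auto simp: set_plus_def)
  ultimately show ?thesis
    using assms L_0 by (auto simp: dsum_def)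
qed

lemma dsum_sym: "dsum T A B \<Longrightarrow> dsum T B A"
  by (auto simp: dsum_def add.commute)

section \<open>Projections along a complement\<close>

definition proj :: "'w set \<Rightarrow> 'w set \<Rightarrow> 'w \<Rightarrow> 'w"
  where "proj A B x = (THE a. a \<in> A \<and> x - a \<in> B)"

lemma dsum_unique:
  assumes "dsum T A B" "a \<in> A" "x - a \<in> B" "a' \<in> A" "x - a' \<in> B"
  shows "a = a'"
proof -
  have "a - a' \<in> A" using assms L_diff dsumD by blast
  moreover have "(x - a') - (x - a) \<in> B" using assms L_diff dsumD by blast
  then have "a - a' \<in> B" by simp
  ultimately have "a - a' \<in> {0}" using dsumD(4)[OF assms(1)] by blast
  then show ?thesis by simp
qed

lemma proj_eqI:
  assumes "dsum T A B" "a \<in> A" "x - a \<in> B"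
  shows "proj A B x = a"
  unfolding proj_def
  by (rule the_equality) (use assms dsum_unique in blast)+

lemma proj_mem:
  assumes "dsum T A B" "x \<in> T"
  shows "proj A B x \<in> A" "x - proj A B x \<in> B"
proof -
  obtain a b where "a \<in> A" "b \<in> B" "x = a + b"
    using assms dsumD(3) by (force simp: set_plus_def)
  then have "a \<in> A" "x - a \<in> B" by auto
  with proj_eqI[OF assms(1) this] show "proj A B x \<in> A" "x - proj A B x \<in> B" by auto
qed

lemma proj_add:
  assumes "dsum T A B" "x \<in> T" "y \<in> T"
  shows "proj A B (x + y) = proj A B x + proj A B y"
proof (rule proj_eqI[OF assms(1)])
  show "proj A B x + proj A B y \<in> A"
    using proj_mem[OF assms(1)] assms L_add dsumD(1)[OF assms(1)] by blast
  have "(x - proj A B x) + (y - proj A B y) \<in> B"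
    using proj_mem[OF assms(1)] assms L_add dsumD(2)[OF assms(1)] by blast
  then show "x + y - (proj A B x + proj A B y) \<in> B" by (simp add: algebra_simps)
qed

lemma proj_complement:
  assumes "dsum T A B" "x \<in> T"
  shows "proj B A x = x - proj A B x"
  by (rule proj_eqI[OF dsum_sym[OF assms(1)]]) (use proj_mem[OF assms] in auto)

lemma proj_id: "dsum T A B \<Longrightarrow> x \<in> A \<Longrightarrow> proj A B x = x"
  using L_0[of B] dsumD(2) by (intro proj_eqI) auto

lemma proj_0: "dsum T A B \<Longrightarrow> x \<in> B \<Longrightarrow> proj A B x = 0"
  using L_0[of A] dsumD(1) by (intro proj_eqI) auto

lemma proj_eq_0: "dsum T A B \<Longrightarrow> x \<in> T \<Longrightarrow> proj A B x = 0 \<Longrightarrow> x \<in> B"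
  using proj_mem(2)[of T A B x] by simp

text \<open>Stand-in for a homomorphism of subrepresentations. Linearity and compatibility with
  structure maps are replaced by what the lattice can express: images and preimages of members are
  members. The notion is closed under composition, so kernels and images of powers of such a map
  stay in \<open>L\<close>.\<close>

definition L_map :: "'w set \<Rightarrow> 'w set \<Rightarrow> ('w \<Rightarrow> 'w) \<Rightarrow> bool"
  where "L_map A B f \<longleftrightarrow> A \<in> L \<and> (\<forall>x\<in>A. \<forall>y\<in>A. f (x + y) = f x + f y) \<and> f ` A \<subseteq> B \<and>
    (\<forall>X\<in>L. X \<subseteq> A \<longrightarrow> f ` X \<in> L) \<and> (\<forall>X\<in>L. {a\<in>A. f a \<in> X} \<in> L)"

lemma L_mapD:
  assumes "L_map A B f"
  shows "A \<in> L" "\<And>x y. x \<in> A \<Longrightarrow> y \<in> A \<Longrightarrow> f (x + y) = f x + f y" "\<And>x. x \<in> A \<Longrightarrow> f x \<in> B"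
    "\<And>X. X \<in> L \<Longrightarrow> X \<subseteq> A \<Longrightarrow> f ` X \<in> L" "\<And>X. X \<in> L \<Longrightarrow> {a\<in>A. f a \<in> X} \<in> L"
  using assms by (auto simp: L_map_def)

lemma L_map_0: "L_map A B f \<Longrightarrow> f 0 = 0"
  using L_mapD(2)[of A B f 0 0] L_0[of A] L_mapD(1)[of A B f] by simp

lemma L_map_diff:
  assumes "L_map A B f" "x \<in> A" "y \<in> A"
  shows "f (x - y) = f x - f y"
proof -
  have "x - y \<in> A" using assms L_diff L_mapD(1) by blast
  then have "f (x - y + y) = f (x - y) + f y" using L_mapD(2)[OF assms(1)] assms by blast
  then show ?thesis by simp
qed

lemma L_map_inj_on:
  assumes "L_map A B f" "\<And>x. x \<in> A \<Longrightarrow> f x = 0 \<Longrightarrow> x = 0"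
  shows "inj_on f A"
proof (rule inj_onI)
  fix x y assume "x \<in> A" "y \<in> A" "f x = f y"
  then have "x - y \<in> A" "f (x - y) = 0"
    using L_map_diff[OF assms(1)] L_diff L_mapD(1)[OF assms(1)] by auto
  then show "x = y" using assms(2)[of "x - y"] by simp
qed

lemma L_map_comp:
  assumes f: "L_map A B f" and g: "L_map B C g"
  shows "L_map A C (\<lambda>x. g (f x))"
proof -
  have "(\<lambda>x. g (f x)) ` X \<in> L" if "X \<in> L" "X \<subseteq> A" for X
  proof -
    have "f ` X \<in> L" "f ` X \<subseteq> B" using L_mapD[OF f] that by auto
    then have "g ` f ` X \<in> L" using L_mapD(4)[OF g] by blast
    then show ?thesis by (simp add: image_image)
  qed
  moreover have "{a\<in>A. g (f a) \<in> X} \<in> L" if "X \<in> L" for X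
  proof -
    have "{a\<in>A. g (f a) \<in> X} = {a\<in>A. f a \<in> {b\<in>B. g b \<in> X}}" using L_mapD(3)[OF f] by auto
    then show ?thesis using L_mapD(5)[OF f L_mapD(5)[OF g that]] by simp
  qed
  ultimately show ?thesis
    using L_mapD[OF f] L_mapD[OF g] by (auto simp: L_map_def)
qed

lemma L_map_restrict:
  assumes "L_map A B f" "A' \<in> L" "A' \<subseteq> A"
  shows "L_map A' B f"
proof -
  have "{a\<in>A'. f a \<in> X} = A' \<inter> {a\<in>A. f a \<in> X}" for X using assms by auto
  then have "\<forall>X\<in>L. {a\<in>A'. f a \<in> X} \<in> L" using assms Int_in_L L_mapD(5) by simp
  moreover have "\<forall>X\<in>L. X \<subseteq> A' \<longrightarrow> f ` X \<in> L"
    using L_mapD(4)[OF assms(1)] assms(3) by (meson subset_trans)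
  moreover have "f ` A' \<subseteq> B" using L_mapD(3)[OF assms(1)] assms(3) by auto
  moreover have "\<forall>x\<in>A'. \<forall>y\<in>A'. f (x + y) = f x + f y"
    using L_mapD(2)[OF assms(1)] assms(3) by (meson subsetD)
  ultimately show ?thesis using assms(2) by (simp add: L_map_def)
qed

text \<open>The image of \<open>X\<close> is \<open>(X + B) \<inter> A\<close> and the preimage of
  \<open>X\<close> is \<open>(X \<inter> A) + B\<close>. Closure under sums and intersections thus
  supplies every map used in the exchange argument.\<close>

lemma L_map_proj:
  assumes "dsum T A B"
  shows "L_map T A (proj A B)"
proof -
  note D = dsumD[OF assms]
  have "proj A B ` X = (X + B) \<inter> A" if "X \<in> L" "X \<subseteq> T" for X
  proof (intro set_eqI iffI)
    fix a assume "a \<in> proj A B ` X"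
    then obtain x where x: "x \<in> X" "a = proj A B x" by auto
    then have "x \<in> T" using that by auto
    from proj_mem[OF assms this] x have "a \<in> A" "x - a \<in> B" by auto
    then have "- (x - a) \<in> B" using L_minus D by blast
    then have "x + - (x - a) \<in> X + B" using x by blast
    then show "a \<in> (X + B) \<inter> A" using \<open>a \<in> A\<close> by simp
  next
    fix a assume "a \<in> (X + B) \<inter> A"
    then obtain x b where x: "x \<in> X" "b \<in> B" "a = x + b" "a \<in> A" by (auto simp: set_plus_def)
    have "x - a \<in> B" using x L_minus[of B b] D by simp
    then have "proj A B x = a" using proj_eqI[OF assms] x by blast
    then show "a \<in> proj A B ` X" using x(1) by (metis imageI)
  qed
  moreover have "{x\<in>T. proj A B x \<in> X} = (X \<inter> A) + B" if "X \<in> L" for X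
  proof (intro set_eqI iffI)
    fix x assume x: "x \<in> {x\<in>T. proj A B x \<in> X}"
    then have "proj A B x \<in> X \<inter> A" "x - proj A B x \<in> B" using proj_mem[OF assms] by auto
    then have "proj A B x + (x - proj A B x) \<in> (X \<inter> A) + B" by blast
    then show "x \<in> (X \<inter> A) + B" by simp
  next
    fix x assume "x \<in> (X \<inter> A) + B"
    then obtain a b where x: "a \<in> X" "a \<in> A" "b \<in> B" "x = a + b" by (auto simp: set_plus_def)
    then have "proj A B x = a" using proj_eqI[OF assms, of a x] by simp
    moreover have "x \<in> T" using x D by blast
    ultimately show "x \<in> {x\<in>T. proj A B x \<in> X}" using x by auto
  qed
  ultimately show ?thesis
    using D proj_add[OF assms] proj_mem[OF assms] Int_in_L plus_in_L
    by (auto simp: L_map_def)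
qed

section \<open>Indecomposable members and Fitting's lemma\<close>

definition L_indec :: "'w set \<Rightarrow> bool"
  where "L_indec A \<longleftrightarrow> A \<in> L \<and> A \<noteq> {0} \<and> (\<forall>X Y. dsum A X Y \<longrightarrow> X = {0} \<or> Y = {0})"

lemma L_map_funpow: "L_map A A f \<Longrightarrow> L_map A A (f ^^ n)"
proof (induction n)
  case 0
  have "{a \<in> A. a \<in> X} \<in> L" if "X \<in> L" for X
    using Int_in_L[OF that L_mapD(1)[OF 0]] by (simp add: Int_def conj_commute)
  then show ?case using L_mapD(1)[OF 0] by (auto simp: L_map_def)
next
  case (Suc n)
  then show ?case using L_map_comp[of A A "f ^^ n" A f] by (simp add: comp_def)
qed

lemma funpow_mem: "L_map A A f \<Longrightarrow> x \<in> A \<Longrightarrow> (f ^^ n) x \<in> A"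
  using L_map_funpow L_mapD(3) by blast

text \<open>Images of the powers of \<open>f\<close> decrease, kernels increase, and their lengths
  are bounded natural numbers, so both chains become stationary. At a stable exponent
  \<open>N\<close> the set \<open>A\<close> is the direct sum of image and kernel of
  \<open>f ^^ N\<close>, and indecomposability kills one of them.\<close>

lemma fitting:
  assumes f: "L_map A A f" and A: "L_indec A"
  shows "bij_betw f A A \<or> (\<exists>n. \<forall>x\<in>A. (f ^^ n) x = 0)"
proof -
  have AL: "A \<in> L" using A by (simp add: L_indec_def)
  define I where "I n = (f ^^ n) ` A" for n
  define K where "K n = {x\<in>A. (f ^^ n) x \<in> {0}}" for n
  have I_L: "I n \<in> L" and K_L: "K n \<in> L" for n
    using L_mapD(4,5)[OF L_map_funpow[OF f]] AL zero_in_L unfolding I_def K_def by blast+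
  have I_sub: "I (m + n) \<subseteq> I m" for m n
    using funpow_mem[OF f] by (auto simp: I_def funpow_add)
  have K_sub: "K m \<subseteq> K (n + m)" for m n
    using L_map_0[OF L_map_funpow[OF f]] by (auto simp: K_def funpow_add)
  have K_A: "len (K n) \<le> len A" for n
  proof -
    have "K n \<subseteq> A" by (auto simp: K_def)
    then show ?thesis using len_strict_mono[OF K_L AL, of n]
      by (metis less_imp_le order.refl psubsetI)
  qed
  obtain i where i: "\<And>n. len (I i) \<le> len (I n)"
    using exists_least_iff[of "\<lambda>l. \<exists>n. l = len (I n)"] by (metis not_le)
  obtain k where k: "\<And>n. len (K n) \<le> len (K k)"
    using ex_has_greatest_nat[of "\<lambda>_. True" 0 "\<lambda>n. len (K n)" "Suc (len A)"] K_A
    by (auto simp: less_Suc_eq_le)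
  \<comment> \<open>The maximum makes both chains stationary at \<open>N\<close>. The successor
    makes \<open>N\<close> positive, so that \<open>f\<close> is the first and the last factor of
    \<open>f ^^ N\<close>; injectivity and surjectivity then pass from \<open>f ^^ N\<close> to
    \<open>f\<close>.\<close>
  define N where "N = Suc (max i k)"
  have IN: "I (i + n) = I i" for n
    using I_sub[of i n] len_strict_mono[OF I_L I_L, of "i + n" i] i[of "i + n"] by force
  have KN: "K (n + k) = K k" for n
    using K_sub[of k n] len_strict_mono[OF K_L K_L, of k "n + k"] k[of "n + k"] by force
  have I2: "I (N + N) = I N"
    using IN[of "N - i"] IN[of "N + N - i"] by (simp add: N_def)
  have K2: "K (N + N) = K N"
    using KN[of "N - k"] KN[of "N + N - k"] by (simp add: N_def)
  have "dsum A (I N) (K N)"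
  proof (rule dsumI)
    show "I N \<in> L" "K N \<in> L" "A \<in> L" by (fact I_L K_L AL)+
    show "I N \<subseteq> A" "K N \<subseteq> A" using funpow_mem[OF f] by (auto simp: I_def K_def)
  next
    fix x assume "x \<in> A"
    \<comment> \<open>Stability of the images lets \<open>(f ^^ N) x\<close> be hit by an element
      that is already in \<open>I N\<close>; subtracting that element leaves a kernel
      vector.\<close>
    then have "(f ^^ N) x \<in> I (N + N)" unfolding I2 by (auto simp: I_def)
    then obtain y where y: "y \<in> A" "(f ^^ N) x = (f ^^ N) ((f ^^ N) y)"
      by (auto simp: I_def funpow_add)
    have "(f ^^ N) (x - (f ^^ N) y) = 0"
      using L_map_diff[OF L_map_funpow[OF f], of x "(f ^^ N) y" N] y \<open>x \<in> A\<close> funpow_mem[OF f]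
      by simp
    then have "x - (f ^^ N) y \<in> K N"
      using L_diff[OF AL \<open>x \<in> A\<close>] funpow_mem[OF f] y by (auto simp: K_def)
    then show "\<exists>a\<in>I N. x - a \<in> K N" using y by (auto simp: I_def)
  next
    fix x assume "x \<in> I N" "x \<in> K N"
    then obtain y where y: "y \<in> A" "x = (f ^^ N) y" "(f ^^ N) x = 0"
      by (auto simp: I_def K_def)
    then have "y \<in> K (N + N)" by (auto simp: K_def funpow_add)
    then show "x = 0" using y unfolding K2 by (auto simp: K_def)
  qed
  then consider "I N = {0}" | "K N = {0}" "A = I N"
    using A dsumD(3)[of A "I N" "K N"] unfolding L_indec_def by auto
  then show ?thesis
  proof cases
    case 1
    then show ?thesis by (auto simp: I_def)
  next
    case 2
    have "x = 0" if "x \<in> A" "f x = 0" for x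
    proof -
      have "(f ^^ N) x = 0"
        using that L_map_0[OF L_map_funpow[OF f]] by (simp add: N_def funpow_swap1)
      then show ?thesis using 2(1) that(1) by (auto simp: K_def)
    qed
    then have "inj_on f A" by (rule L_map_inj_on[OF f])
    moreover have "A \<subseteq> f ` A"
    proof
      fix x assume "x \<in> A"
      then have "x \<in> (f ^^ N) ` A" using 2(2) unfolding I_def by blast
      then obtain y where "y \<in> A" "x = f ((f ^^ max i k) y)" by (auto simp: N_def)
      then show "x \<in> f ` A" using funpow_mem[OF f] by blast
    qed
    ultimately show ?thesis using L_mapD(3)[OF f] by (auto simp: bij_betw_def)
  qed
qed

section \<open>Isomorphisms and transport of decompositions\<close>

definition L_iso :: "'w set \<Rightarrow> 'w set \<Rightarrow> ('w \<Rightarrow> 'w) \<Rightarrow> bool"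
  where "L_iso A B h \<longleftrightarrow> L_map A B h \<and> bij_betw h A B"

lemma L_isoD:
  assumes "L_iso A B h"
  shows "L_map A B h" "inj_on h A" "h ` A = B" "A \<in> L" "B \<in> L"
  using assms L_mapD(1,4)[of A B h] by (auto simp: L_iso_def bij_betw_def)

lemma L_iso_dsum:
  assumes h: "L_iso A B h" and d: "dsum B X Y"
  shows "dsum A {a\<in>A. h a \<in> X} {a\<in>A. h a \<in> Y}"
proof (rule dsumI)
  note D = dsumD[OF d] and H = L_isoD[OF h]
  show "{a\<in>A. h a \<in> X} \<in> L" "{a\<in>A. h a \<in> Y} \<in> L" using L_mapD(5)[OF H(1)] D by auto
  show "A \<in> L" by (fact H)
  fix a assume a: "a \<in> A"
  then have "h a \<in> B" using H by auto
  then obtain x where "x \<in> X" "h a - x \<in> Y" using proj_mem[OF d] by blast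
  then have "x \<in> h ` A" using D(6) H(3) by blast
  then obtain a' where "a' \<in> A" "h a' = x" by auto
  then have "h (a - a') \<in> Y" "a - a' \<in> A"
    using L_map_diff[OF H(1) a] \<open>h a - x \<in> Y\<close> a L_diff[OF H(4)] by auto
  then show "\<exists>a'\<in>{a \<in> A. h a \<in> X}. a - a' \<in> {a \<in> A. h a \<in> Y}"
    using \<open>a' \<in> A\<close> \<open>h a' = x\<close> \<open>x \<in> X\<close> by auto
next
  fix a assume "a \<in> {a\<in>A. h a \<in> X}" "a \<in> {a\<in>A. h a \<in> Y}"
  then have "a \<in> A" "h a = 0" using dsumD(4)[OF d] by auto
  then show "a = 0"
    using L_isoD(2)[OF h] L_map_0[OF L_isoD(1)[OF h]] L_0[OF L_isoD(4)[OF h]]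
    by (metis inj_onD)
qed auto

lemma L_iso_indec:
  assumes h: "L_iso A B h" and A: "L_indec A"
  shows "L_indec B"
proof -
  note H = L_isoD[OF h]
  have "B \<noteq> {0}"
  proof
    assume "B = {0}"
    then have "\<And>a. a \<in> A \<Longrightarrow> h a = h 0" using H(3) L_map_0[OF H(1)] by auto
    then have "a = 0" if "a \<in> A" for a using H(2) L_0[OF H(4)] that by (meson inj_onD)
    then have "A = {0}" using L_0[OF H(4)] by auto
    then show False using A by (simp add: L_indec_def)
  qed
  moreover have "X = {0} \<or> Y = {0}" if d: "dsum B X Y" for X Y
  proof -
    have *: "Z = {0}" if "{a\<in>A. h a \<in> Z} = {0}" "Z \<subseteq> B" "Z \<in> L" for Z
    proof -
      have "z = 0" if "z \<in> Z" for z
      proof -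
        obtain a where "a \<in> A" "h a = z" using H(3) \<open>Z \<subseteq> B\<close> \<open>z \<in> Z\<close> by blast
        then have "a \<in> {a\<in>A. h a \<in> Z}" using that by simp
        then have "a = 0" using \<open>{a\<in>A. h a \<in> Z} = {0}\<close> by simp
        then show ?thesis using \<open>h a = z\<close> L_map_0[OF H(1)] by simp
      qed
      then show ?thesis using L_0[OF \<open>Z \<in> L\<close>] by auto
    qed
    have "{a\<in>A. h a \<in> X} = {0} \<or> {a\<in>A. h a \<in> Y} = {0}"
      using A L_iso_dsum[OF h d] unfolding L_indec_def by blast
    then show ?thesis using * dsumD(1,2,6,7)[OF d] by blast
  qed
  ultimately show ?thesis using H by (auto simp: L_indec_def)
qed

text \<open>Independence of a list of summands is expressed by splitting off the head from a
  complement \<open>T'\<close> that is decomposed in turn. This recursive form lets the exchange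
  argument peel off one summand at a time.\<close>

fun idsum :: "'w set \<Rightarrow> 'w set list \<Rightarrow> bool" where
  "idsum T [] \<longleftrightarrow> T = {0}"
| "idsum T (A # As) \<longleftrightarrow> (\<exists>T'. dsum T A T' \<and> idsum T' As)"

lemma L_iso_inv:
  assumes h: "L_iso A B h"
  shows "L_iso B A (inv_into A h)"
proof -
  note H = L_isoD[OF h]
  let ?g = "inv_into A h"
  have gB: "?g b \<in> A" "h (?g b) = b" if "b \<in> B" for b
    using H(3) that by (auto simp: inv_into_into f_inv_into_f)
  have hg: "?g (h a) = a" if "a \<in> A" for a using H(2) that by simp
  have add: "?g (x + y) = ?g x + ?g y" if "x \<in> B" "y \<in> B" for x y
  proof -
    have "h (?g x + ?g y) = x + y" using gB that L_mapD(2)[OF H(1)] by simp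
    moreover have "?g x + ?g y \<in> A" using gB that L_add[OF H(4)] by simp
    ultimately show ?thesis using hg by metis
  qed
  have im: "?g ` X \<in> L" if "X \<in> L" "X \<subseteq> B" for X
  proof -
    have "?g ` X = {a\<in>A. h a \<in> X}" using gB hg that by (force simp: image_iff)
    then show ?thesis using L_mapD(5)[OF H(1)] that by simp
  qed
  have pre: "{b\<in>B. ?g b \<in> X} \<in> L" if "X \<in> L" for X
  proof -
    have "{b\<in>B. ?g b \<in> X} = h ` (X \<inter> A)" using gB hg H(3) by (force simp: image_iff)
    then show ?thesis using L_mapD(4)[OF H(1)] that Int_in_L H(4) by simp
  qed
  have "L_map B A ?g" using H(5) gB add im pre by (auto simp: L_map_def)
  then show ?thesis using h by (auto simp: L_iso_def bij_betw_inv_into)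
qed

lemma L_iso_restrict:
  assumes "L_iso A B h" "X \<in> L" "X \<subseteq> A"
  shows "L_iso X (h ` X) h"
proof -
  have "L_map X B h" using L_map_restrict[OF L_isoD(1)[OF assms(1)]] assms by blast
  then have "L_map X (h ` X) h" by (auto simp: L_map_def)
  moreover have "inj_on h X" using L_isoD(2)[OF assms(1)] assms(3) inj_on_subset by blast
  ultimately show ?thesis by (auto simp: L_iso_def bij_betw_def)
qed

lemma idsum_subset: "idsum T As \<Longrightarrow> T \<in> L \<and> (\<forall>A\<in>set As. A \<in> L \<and> A \<subseteq> T)"
proof (induction As arbitrary: T)
  case Nil
  then show ?case using zero_in_L by simp
next
  case (Cons A As)
  then obtain T' where "dsum T A T'" "idsum T' As" by auto
  then have "A \<in> L" "A \<subseteq> T" "T' \<subseteq> T" "T \<in> L" "\<forall>A\<in>set As. A \<in> L \<and> A \<subseteq> T'"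
    using Cons.IH[of T'] dsumD[of T A T'] by blast+
  then show ?case by auto
qed

lemma L_iso_idsum:
  assumes "L_iso T T' h" "idsum T As"
  shows "idsum T' (map ((`) h) As)"
  using assms
proof (induction As arbitrary: T T')
  case Nil
  then show ?case using L_isoD(3)[OF Nil.prems(1)] L_map_0[OF L_isoD(1)[OF Nil.prems(1)]] by auto
next
  case (Cons A As)
  then obtain U where U: "dsum T A U" "idsum U As" by auto
  note D = dsumD[OF U(1)]
  note i = L_iso_inv[OF Cons.prems(1)]
  have hid: "inv_into T h (h x) = x" if "x \<in> T" for x using L_isoD(2)[OF Cons.prems(1)] that by simp
  have "{a \<in> T'. inv_into T h a \<in> X} = h ` X" if "X \<subseteq> T" for X
    using L_isoD(3)[OF Cons.prems(1)] that hid by (force simp: image_iff)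
  then have "dsum T' (h ` A) (h ` U)"
    using L_iso_dsum[OF i U(1)] D by simp
  moreover have "idsum (h ` U) (map ((`) h) As)"
    using Cons.IH[OF L_iso_restrict[OF Cons.prems(1)] U(2)] D by blast
  ultimately show ?case by auto
qed

text \<open>Both complements are copies of the quotient of \<open>T\<close> by \<open>A\<close>;
  projecting along \<open>A\<close> identifies them.\<close>

lemma dsum_complements_iso:
  assumes D: "dsum T A D" and E: "dsum T A E"
  shows "L_iso D E (proj E A)"
proof -
  note E' = dsum_sym[OF E]
  have m: "L_map D E (proj E A)"
    using L_map_restrict[OF L_map_proj[OF E'] dsumD(2)[OF D]] dsumD(7)[OF D] by blast
  have "x = 0" if "x \<in> D" "proj E A x = 0" for x
  proof -
    have "x \<in> A" using proj_eq_0[OF E'] that dsumD(7)[OF D] by blast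
    then show ?thesis using that dsumD(4)[OF D] by blast
  qed
  then have inj: "inj_on (proj E A) D" using L_map_inj_on[OF m] by blast
  have "e \<in> proj E A ` D" if "e \<in> E" for e
  proof -
    have eT: "e \<in> T" using that dsumD(7)[OF E] by blast
    let ?d = "proj D A e"
    have d: "?d \<in> D" "e - ?d \<in> A" using proj_mem[OF dsum_sym[OF D] eT] by auto
    have "- (e - ?d) \<in> A" using L_minus[OF dsumD(1)[OF D] d(2)] .
    then have "?d - e \<in> A" by simp
    then have "proj E A ?d = e" using proj_eqI[OF E' that] by simp
    then show ?thesis using d by force
  qed
  then show ?thesis using m inj L_mapD(3)[OF m] by (auto simp: L_iso_def bij_betw_def)
qed

text \<open>On \<open>C\<close> the identity is the sum of \<open>f\<close> and \<open>g\<close>,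
  the endomorphisms that go through \<open>B\<close> and through \<open>T'\<close> and return by the
  projection to \<open>C\<close>. By Fitting's lemma one of them is bijective. If it is
  \<open>f\<close>, then \<open>C\<close> can take the place of \<open>B\<close>. If it is
  \<open>g\<close>, a copy \<open>D\<close> of \<open>C\<close> is a summand of \<open>T'\<close>,
  and the induction hypothesis exchanges \<open>D\<close> there.\<close>

lemma exchange:
  assumes "idsum T Bs" "\<forall>B\<in>set Bs. L_indec B" "dsum T C C'" "L_indec C"
  shows "\<exists>D Ds. dsum T C D \<and> idsum D Ds \<and> (\<forall>B\<in>set Ds. L_indec B) \<and> length Bs = Suc (length Ds)"
  using assms
proof (induction Bs arbitrary: T C C')
  case Nil
  then have "C \<subseteq> {0}" using dsumD(6) by fastforce
  then have "C = {0}" using L_0 Nil.prems(4) by (auto simp: L_indec_def)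
  then show ?case using Nil.prems(4) by (simp add: L_indec_def)
next
  case (Cons B Bs)
  then obtain T' where BT: "dsum T B T'" and T': "idsum T' Bs" by auto
  have Bs: "\<forall>B\<in>set Bs. L_indec B" and B: "L_indec B" using Cons.prems by auto
  note CC = Cons.prems(3) and C = Cons.prems(4)
  note dB = dsumD[OF BT] and dC = dsumD[OF CC]
  define \<pi> where "\<pi> = proj C C'"
  define \<rho> where "\<rho> = proj B T'"
  define \<rho>' where "\<rho>' = proj T' B"
  have \<rho>: "L_map C B \<rho>" and \<rho>': "L_map C T' \<rho>'"
    using L_map_restrict[OF L_map_proj[OF BT] dC(1,6)]
      L_map_restrict[OF L_map_proj[OF dsum_sym[OF BT]] dC(1,6)] by (auto simp: \<rho>_def \<rho>'_def)
  have \<pi>: "L_map T C \<pi>" using L_map_proj[OF CC] by (simp add: \<pi>_def)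
  have \<pi>B: "L_map B C \<pi>" "L_map T' C \<pi>"
    using L_map_restrict[OF \<pi>] dB by auto
  define f where "f = (\<lambda>x. \<pi> (\<rho> x))"
  define g where "g = (\<lambda>x. \<pi> (\<rho>' x))"
  have f: "L_map C C f" and g: "L_map C C g"
    using L_map_comp[OF \<rho> \<pi>B(1)] L_map_comp[OF \<rho>' \<pi>B(2)] by (auto simp: f_def g_def)
  have \<rho>\<rho>': "\<rho>' x = x - \<rho> x" if "x \<in> C" for x
    using proj_complement[OF BT] that dC(6) by (auto simp: \<rho>_def \<rho>'_def)
  have fg: "g x = x - f x" if x: "x \<in> C" for x
  proof -
    have "\<rho> x \<in> T" using L_mapD(3)[OF \<rho> x] dB by auto
    then have "\<pi> (x - \<rho> x) = \<pi> x - f x" using L_map_diff[OF \<pi>] x dC(6) by (auto simp: f_def)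
    then show ?thesis using \<rho>\<rho>'[OF x] proj_id[OF CC x] by (simp add: g_def \<pi>_def)
  qed
  have "bij_betw f C C \<or> bij_betw g C C"
  proof (rule ccontr)
    assume "\<not> ?thesis"
    then obtain m n where mn: "\<And>x. x \<in> C \<Longrightarrow> (f ^^ m) x = 0" "\<And>x. x \<in> C \<Longrightarrow> (g ^^ n) x = 0"
      using fitting[OF f C] fitting[OF g C] by blast
    \<comment> \<open>Where \<open>g\<close> vanishes \<open>f\<close> is the identity, which
      nilpotency of \<open>f\<close> allows only at 0. So \<open>g\<close> is injective, and it
      cannot be nilpotent on the nonzero \<open>C\<close>.\<close>
    have g_inj: "x = 0" if "x \<in> C" "g x = 0" for x
    proof -
      have "f x = x" using fg that by simp
      then have "(f ^^ m) x = x" by (induction m) auto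
      then show ?thesis using mn that by simp
    qed
    have "x = 0" if "x \<in> C" "(g ^^ k) x = 0" for x k
      using that
    proof (induction k)
      case (Suc k)
      then have "(g ^^ k) x = 0" using g_inj[OF funpow_mem[OF g]] by simp
      then show ?case using Suc by simp
    qed simp
    then have "C \<subseteq> {0}" using mn by blast
    then show False using C L_0[OF dC(1)] by (auto simp: L_indec_def)
  qed
  then show ?case
  proof
    assume bf: "bij_betw f C C"
    have f0: "x = 0" if "x \<in> C" "f x = 0" for x
      using bf that L_map_0[OF f] L_0[OF dC(1)] by (metis bij_betw_def inj_onD)
    \<comment> \<open>Invertibility of \<open>\<pi>\<close> after \<open>\<rho>\<close> makes
      \<open>\<rho>\<close>
      C\<open>a retract of\<close>B\<open>, with the kernel of\<close>\<pi>\<open>on\<close>B\<open>as complement. As\<close>B\<open>is indecomposable,\<close>\<rho>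
      \<open>C\<close> is all of \<open>B\<close>.\<close>
    have "dsum B (\<rho> ` C) (B \<inter> C')"
    proof (rule dsumI)
      show "\<rho> ` C \<in> L" using L_mapD(4)[OF \<rho>] dC by blast
      show "B \<inter> C' \<in> L" "B \<in> L" using dB dC Int_in_L by auto
      show "\<rho> ` C \<subseteq> B" using L_mapD(3)[OF \<rho>] by auto
      fix b assume b: "b \<in> B"
      then have "\<pi> b \<in> C" using L_mapD(3)[OF \<pi>B(1)] by auto
      then obtain c where c: "c \<in> C" "f c = \<pi> b" using bf by (metis bij_betw_def imageE)
      have "\<rho> c \<in> B" using L_mapD(3)[OF \<rho> c(1)] .
      have "\<pi> (b - \<rho> c) = 0" using L_map_diff[OF \<pi>B(1) b \<open>\<rho> c \<in> B\<close>] c by (simp add: f_def)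
      moreover have "b - \<rho> c \<in> B" using L_diff dB b \<open>\<rho> c \<in> B\<close> by blast
      ultimately have "b - \<rho> c \<in> B \<inter> C'" using proj_eq_0[OF CC] dB by (auto simp: \<pi>_def)
      then show "\<exists>a\<in>\<rho> ` C. b - a \<in> B \<inter> C'" using c by blast
    next
      fix x assume "x \<in> \<rho> ` C" "x \<in> B \<inter> C'"
      then obtain c where c: "c \<in> C" "x = \<rho> c" "\<rho> c \<in> C'" by auto
      then have "f c = 0" using proj_0[OF CC] by (simp add: f_def \<pi>_def)
      then have "c = 0" using f0 c by simp
      then show "x = 0" using c L_map_0[OF \<rho>] by simp
    qed auto
    moreover have "\<rho> ` C \<noteq> {0}"
    proof
      assume "\<rho> ` C = {0}"
      then have "f c = 0" if "c \<in> C" for c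
        using that L_map_0[OF \<pi>] unfolding f_def by (metis imageI singletonD)
      then have "C \<subseteq> {0}" using f0 by blast
      then show False using C L_0[OF dC(1)] by (auto simp: L_indec_def)
    qed
    ultimately have "B \<inter> C' = {0}" and "B = \<rho> ` C + B \<inter> C'"
      using B dsumD(3)[of B "\<rho> ` C" "B \<inter> C'"] unfolding L_indec_def by blast+
    then have "\<rho> ` C = B" by simp
    have "dsum T C T'"
    proof (rule dsumI)
      fix t assume t: "t \<in> T"
      then have "\<rho> t \<in> B" using proj_mem[OF BT] by (simp add: \<rho>_def)
      then obtain c where c: "c \<in> C" "\<rho> t = \<rho> c" using \<open>\<rho> ` C = B\<close> by auto
      then have cT: "c \<in> T" using dC by auto
      have "\<rho> (t - c) = 0"
        using L_map_diff[OF L_map_proj[OF BT] t cT] c by (simp add: \<rho>_def)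
      then have "t - c \<in> T'" using proj_eq_0[OF BT] L_diff[OF dC(5) t cT] by (simp add: \<rho>_def)
      then show "\<exists>a\<in>C. t - a \<in> T'" using c by auto
    next
      fix x assume "x \<in> C" "x \<in> T'"
      then have "\<rho> x = 0" using proj_0[OF BT] by (simp add: \<rho>_def)
      then show "x = 0" using f0[OF \<open>x \<in> C\<close>] L_map_0[OF \<pi>] by (simp add: f_def)
    qed (use dB dC in auto)
    then show ?thesis using T' Bs by auto
  next
    assume bg: "bij_betw g C C"
    have g0: "x = 0" if "x \<in> C" "g x = 0" for x
      using bg that L_map_0[OF g] L_0[OF dC(1)] by (metis bij_betw_def inj_onD)
    have \<rho>0: "x = 0" if "x \<in> C" "\<rho>' x = 0" for x
      using g0[OF that(1)] that L_map_0[OF \<pi>] by (simp add: g_def)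
    define D where "D = \<rho>' ` C"
    have DL: "D \<in> L" using L_mapD(4)[OF \<rho>'] dC by (auto simp: D_def)
    have DT': "D \<subseteq> T'" using L_mapD(3)[OF \<rho>'] by (auto simp: D_def)
    have "L_map C D \<rho>'" using \<rho>' by (auto simp: L_map_def D_def)
    then have iso: "L_iso C D \<rho>'"
      using L_map_inj_on[OF \<rho>' \<rho>0] by (auto simp: L_iso_def bij_betw_def D_def)
    have D: "L_indec D" using L_iso_indec[OF iso C] .
    \<comment> \<open>The same retract argument with \<open>\<rho>'\<close>. Here \<open>T'\<close>
      may be decomposable, so the outcome is only a complement of \<open>D\<close>, which is what
      the induction hypothesis asks for.\<close>
    have "dsum T' D (T' \<inter> C')"
    proof (rule dsumI)
      show "D \<in> L" "D \<subseteq> T'" by fact+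
      show "T' \<inter> C' \<in> L" "T' \<in> L" using dB dC Int_in_L by auto
      fix b assume b: "b \<in> T'"
      then have "\<pi> b \<in> C" using L_mapD(3)[OF \<pi>B(2)] by auto
      then obtain c where c: "c \<in> C" "g c = \<pi> b" using bg by (metis bij_betw_def imageE)
      have c': "\<rho>' c \<in> T'" using L_mapD(3)[OF \<rho>' c(1)] .
      have "\<pi> (b - \<rho>' c) = 0" using L_map_diff[OF \<pi>B(2) b c'] c by (simp add: g_def)
      moreover have "b - \<rho>' c \<in> T'" using L_diff dB b c' by blast
      ultimately have "b - \<rho>' c \<in> T' \<inter> C'" using proj_eq_0[OF CC] dB by (auto simp: \<pi>_def)
      then show "\<exists>a\<in>D. b - a \<in> T' \<inter> C'" using c unfolding D_def by blast
    next
      fix x assume "x \<in> D" "x \<in> T' \<inter> C'"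
      then obtain c where c: "c \<in> C" "x = \<rho>' c" "\<rho>' c \<in> C'" by (auto simp: D_def)
      then have "g c = 0" using proj_0[OF CC] by (simp add: g_def \<pi>_def)
      then have "c = 0" using g0 c by simp
      then show "x = 0" using c L_map_0[OF \<rho>'] by simp
    qed auto
    from Cons.IH[OF T' Bs this D] obtain E Es
      where E: "dsum T' D E" "idsum E Es" "\<forall>B\<in>set Es. L_indec B" "length Bs = Suc (length Es)"
      by blast
    note dE = dsumD[OF E(1)]
    have BE: "dsum (B + E) B E"
      using dB dE by (auto simp: dsum_def)
    note dBE = dsumD[OF BE]
    \<comment> \<open>Elements of \<open>C\<close> differ from their images in \<open>D\<close> by
      elements of \<open>B\<close>, so \<open>C\<close> may replace \<open>D\<close> as soon as
      \<open>B\<close> is in the complement.\<close>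
    have "dsum T C (B + E)"
    proof (rule dsumI)
      have "B \<subseteq> T" "E \<subseteq> T" using dB dE by auto
      then show "B + E \<subseteq> T" using L_add[OF dC(5)] by (blast elim: set_plus_elim)
      fix t assume t: "t \<in> T"
      then have "\<rho>' t \<in> T'" using proj_mem[OF dsum_sym[OF BT]] by (simp add: \<rho>'_def)
      then obtain d where d: "d \<in> D" "\<rho>' t - d \<in> E" using proj_mem[OF E(1)] by blast
      then obtain c where c: "c \<in> C" "d = \<rho>' c" by (auto simp: D_def)
      then have cT: "c \<in> T" using dC by auto
      then have tc: "t - c \<in> T" using L_diff[OF dC(5) t] by simp
      have "\<rho>' (t - c) \<in> E"
        using L_map_diff[OF L_map_proj[OF dsum_sym[OF BT]] t cT] c d by (simp add: \<rho>'_def)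
      moreover have "t - c - \<rho>' (t - c) \<in> B"
        using proj_mem[OF dsum_sym[OF BT] tc] by (simp add: \<rho>'_def)
      ultimately have "(t - c - \<rho>' (t - c)) + \<rho>' (t - c) \<in> B + E" by blast
      then show "\<exists>a\<in>C. t - a \<in> B + E" using c by auto
    next
      fix x assume x: "x \<in> C" "x \<in> B + E"
      then obtain b e where be: "b \<in> B" "e \<in> E" "x = b + e" by (auto simp: set_plus_def)
      then have "\<rho>' x = e" using proj_eqI[OF dsum_sym[OF BT], of e x] dE by (auto simp: \<rho>'_def)
      then have "e \<in> D \<inter> E" using imageI[OF x(1), of \<rho>'] be(2) by (simp add: D_def)
      then have "\<rho>' x = 0" using dE(4) \<open>\<rho>' x = e\<close> by auto
      then show "x = 0" using \<rho>0 x by simp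
    qed (use dB dC dBE in auto)
    moreover have "idsum (B + E) (B # Es)" using BE E(2) by auto
    moreover have "\<forall>B\<in>set (B # Es). L_indec B" using E(3) B by simp
    moreover have "length (B # Bs) = Suc (length (B # Es))" using E(4) by simp
    ultimately show ?thesis by blast
  qed
qed

text \<open>Exchanging the head \<open>A\<close> into the second decomposition leaves two
  complements of the same \<open>A\<close>. They are isomorphic, so the remaining decompositions can
  be compared inside one of them by induction.\<close>

theorem krull_schmidt_length:
  assumes "idsum T As" "\<forall>A\<in>set As. L_indec A" "idsum T Bs" "\<forall>B\<in>set Bs. L_indec B"
  shows "length As = length Bs"
  using assms
proof (induction As arbitrary: T Bs)
  case Nil
  have "Bs = []"
  proof (cases Bs)
    case (Cons B Bs')
    then have "B \<subseteq> {0}" using Nil.prems(1,3) idsum_subset[of T Bs] by simp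
    then have "B = {0}" using Nil Cons L_0 by (auto simp: L_indec_def)
    then show ?thesis using Nil Cons by (auto simp: L_indec_def)
  qed
  then show ?case by simp
next
  case (Cons A As)
  then obtain T' where T': "dsum T A T'" "idsum T' As" by auto
  obtain D Ds where D: "dsum T A D" "idsum D Ds" "\<forall>B\<in>set Ds. L_indec B" "length Bs = Suc (length Ds)"
    using exchange[OF Cons.prems(3,4) T'(1)] Cons.prems by auto
  let ?h = "proj T' A"
  have iso: "L_iso D T' ?h" using dsum_complements_iso[OF D(1) T'(1)] .
  have "L_indec (?h ` X)" if "X \<in> set Ds" for X
    using L_iso_indec[OF L_iso_restrict[OF iso]] that D idsum_subset by blast
  then have "length As = length (map ((`) ?h) Ds)"
    using Cons.IH[OF T'(2) _ L_iso_idsum[OF iso D(2)]] Cons.prems by simp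
  then show ?case using D by simp
qed

end

section \<open>Finite-dimensional subspaces\<close>

text \<open>\<open>dim\<close> is the cardinality of a basis, hence 0 when the basis is infinite,
  and so does not detect finiteness. The ambient space may be infinite-dimensional, so finiteness is
  attached to each subspace.\<close>

definition fin_dim_space :: "('k::field \<Rightarrow> 'v::ab_group_add \<Rightarrow> 'v) \<Rightarrow> 'v set \<Rightarrow> bool"
  where "fin_dim_space s U \<longleftrightarrow> (\<exists>B. finite B \<and> U = module.span s B)"

context vector_space
begin

lemma fin_dim_space_subspace: "fin_dim_space scale U \<Longrightarrow> subspace U"
  by (auto simp: fin_dim_space_def)

lemma fin_dim_space_independent:
  assumes "fin_dim_space scale U" "independent C" "C \<subseteq> U"
  shows "finite C"
  using assms independent_span_bound by (metis fin_dim_space_def)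

lemma fin_dim_space_basis_extend:
  assumes "fin_dim_space scale U" "independent C" "C \<subseteq> U"
  obtains D where "C \<subseteq> D" "D \<subseteq> U" "independent D" "span D = U" "finite D" "card D = dim U"
proof -
  obtain D where D: "C \<subseteq> D" "D \<subseteq> U" "independent D" "U \<subseteq> span D"
    using maximal_independent_subset_extend assms by metis
  then have "span D = U" using span_subspace fin_dim_space_subspace assms(1) by blast
  then show thesis
    using that D basis_card_eq_dim fin_dim_space_independent[OF assms(1)] by metis
qed

lemma fin_dim_space_subset:
  assumes "fin_dim_space scale V" "subspace U" "U \<subseteq> V"
  shows "fin_dim_space scale U"
proof -
  obtain D where D: "D \<subseteq> U" "independent D" "U \<subseteq> span D"
    using basis_exists by metis
  then have "span D = U" using span_subspace assms(2) by blast
  moreover have "finite D" using fin_dim_space_independent[OF assms(1)] D assms by blast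
  ultimately show ?thesis unfolding fin_dim_space_def by metis
qed

lemma fin_dim_space_dim_mono:
  assumes "fin_dim_space scale V" "subspace U" "U \<subseteq> V"
  shows "dim U \<le> dim V"
proof -
  obtain D where D: "D \<subseteq> U" "independent D" "U \<subseteq> span D" "card D = dim U"
    using basis_exists by metis
  obtain E where "D \<subseteq> E" "finite E" "card E = dim V"
    using fin_dim_space_basis_extend[OF assms(1) D(2)] D assms by (metis subset_trans)
  then show ?thesis using D card_mono by metis
qed

lemma fin_dim_space_dim_strict_mono:
  assumes "fin_dim_space scale V" "subspace U" "U \<subset> V"
  shows "dim U < dim V"
proof -
  obtain D where D: "D \<subseteq> U" "independent D" "U \<subseteq> span D" "card D = dim U"
    using basis_exists by metis
  have "D \<subseteq> V" using D assms by blast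
  from fin_dim_space_basis_extend[OF assms(1) D(2) this]
  obtain E where E: "D \<subseteq> E" "finite E" "card E = dim V" "span E = V" by metis
  have "span D = U" using span_subspace D assms(2) by blast
  then have "D \<noteq> E" using E assms by auto
  then show ?thesis using D E psubset_card_mono by (metis psubsetI)
qed

lemma dim_zero_space [simp]: "dim {0} = 0"
  using dim_unique[of "{}" "{0}" 0] independent_empty by simp

lemma fin_dim_space_zero: "fin_dim_space scale {0}"
  unfolding fin_dim_space_def by (rule exI[of _ "{}"]) simp

lemma fin_dim_space_dim_eq_0_iff:
  assumes "fin_dim_space scale V"
  shows "dim V = 0 \<longleftrightarrow> V = {0}"
proof
  assume "dim V = 0"
  show "V = {0}"
  proof (rule ccontr)
    assume "V \<noteq> {0}"
    then have "{0} \<subset> V" using subspace_0[OF fin_dim_space_subspace[OF assms]] by auto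
    then show False
      using fin_dim_space_dim_strict_mono[OF assms subspace_single_0] \<open>dim V = 0\<close> by simp
  qed
qed simp

lemma fin_dim_space_eq:
  assumes "fin_dim_space scale V" "subspace U" "U \<subseteq> V" "dim V \<le> dim U"
  shows "U = V"
  using fin_dim_space_dim_strict_mono[OF assms(1,2)] assms(3,4) by fastforce

lemma dim_one_space:
  assumes "fin_dim_space scale V" "dim V = 1" "v \<in> V" "v \<noteq> 0" "w \<in> V"
  shows "\<exists>c. w = c *s v"
proof -
  have "subspace V" using assms(1) by (rule fin_dim_space_subspace)
  moreover have "dim (span {v}) = 1" using assms(4) by (subst dim_span_eq_card_independent) auto
  moreover have "span {v} \<subseteq> V" using span_minimal assms(3) \<open>subspace V\<close> by blast
  ultimately have "span {v} = V" using fin_dim_space_eq[OF assms(1) subspace_span] assms(2) by simp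
  then show ?thesis using assms(5) by (auto simp: span_singleton)
qed

end

section \<open>Maps that are linear on a subspace, and rank-nullity\<close>

context vector_space_pair
begin

lemma linear_between_0:
  assumes "linear_between s1 s2 U W f" "vs1.subspace U"
  shows "f 0 = 0"
proof -
  have "f (0 + 0) = f 0 + f 0"
    using assms vs1.subspace_0 unfolding linear_between_def by blast
  then show ?thesis by simp
qed

lemma linear_between_diff:
  assumes "linear_between s1 s2 U W f" "vs1.subspace U" "x \<in> U" "y \<in> U"
  shows "f (x - y) = f x - f y"
proof -
  have "f ((x - y) + y) = f (x - y) + f y"
    using assms vs1.subspace_diff unfolding linear_between_def by blast
  then show ?thesis by (simp add: algebra_simps)
qed

lemma linear_between_inj_on:
  assumes "linear_between s1 s2 U W f" "vs1.subspace U" "\<And>u. u \<in> U \<Longrightarrow> f u = 0 \<Longrightarrow> u = 0"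
  shows "inj_on f U"
proof (rule inj_onI)
  fix x y assume "x \<in> U" "y \<in> U" "f x = f y"
  then have "f (x - y) = 0" using linear_between_diff[OF assms(1,2)] by simp
  then show "x = y" using assms(3)[of "x - y"] vs1.subspace_diff assms(2) \<open>x \<in> U\<close> \<open>y \<in> U\<close> by simp
qed

lemma linear_between_subset:
  "linear_between s1 s2 U W f \<Longrightarrow> V \<subseteq> U \<Longrightarrow> linear_between s1 s2 V W f"
  unfolding linear_between_def by blast

lemma linear_between_subspace_image:
  assumes "linear_between s1 s2 U W f" "vs1.subspace U"
  shows "vs2.subspace (f ` U)"
proof (rule vs2.subspaceI)
  show "0 \<in> f ` U" using linear_between_0[OF assms] vs1.subspace_0[OF assms(2)] by force
next
  fix x y assume "x \<in> f ` U" "y \<in> f ` U"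
  then obtain u v where "u \<in> U" "v \<in> U" "x = f u" "y = f v" by auto
  then have "x + y = f (u + v)" "u + v \<in> U"
    using assms vs1.subspace_add by (auto simp: linear_between_def)
  then show "x + y \<in> f ` U" by blast
next
  fix c x assume "x \<in> f ` U"
  then obtain u where "u \<in> U" "x = f u" by auto
  then have "s2 c x = f (s1 c u)" "s1 c u \<in> U"
    using assms vs1.subspace_scale by (auto simp: linear_between_def)
  then show "s2 c x \<in> f ` U" by blast
qed

lemma linear_between_subspace_vimage:
  assumes "linear_between s1 s2 U W f" "vs1.subspace U" "vs2.subspace V"
  shows "vs1.subspace {u\<in>U. f u \<in> V}"
  using assms vs1.subspace_0 vs1.subspace_add vs1.subspace_scale
    vs2.subspace_0 vs2.subspace_add vs2.subspace_scale linear_between_0[OF assms(1,2)]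
  unfolding linear_between_def by (intro vs1.subspaceI) auto

text \<open>Structure maps are unconstrained outside their domain. Replacing such a map by a
  globally linear one that agrees on \<open>U\<close> gives access to the theory of linear
  maps.\<close>

lemma linear_between_extend:
  assumes "linear_between s1 s2 U W f" "D \<subseteq> U" "vs1.independent D" "vs1.span D = U"
  obtains g where "Vector_Spaces.linear s1 s2 g" "\<And>u. u \<in> U \<Longrightarrow> g u = f u"
proof -
  obtain g where g: "Vector_Spaces.linear s1 s2 g" "\<And>x. x \<in> D \<Longrightarrow> g x = f x"
    using linear_independent_extend[OF assms(3), of f] by auto
  have U: "vs1.subspace U" using assms(4) vs1.subspace_span by blast
  have "vs1.subspace {x\<in>U. g x = f x}"
    using assms(1) vs1.subspace_0[OF U] vs1.subspace_add[OF U] vs1.subspace_scale[OF U]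
      linear_0[OF g(1)] linear_add[OF g(1)] linear_scale[OF g(1)] linear_between_0[OF assms(1) U]
    by (intro vs1.subspaceI) (auto simp: linear_between_def)
  moreover have "D \<subseteq> {x\<in>U. g x = f x}" using g assms(2) by auto
  ultimately have "U \<subseteq> {x\<in>U. g x = f x}" using vs1.span_minimal assms(4) by metis
  then show thesis using that g assms by blast
qed

text \<open>A basis \<open>A\<close> of the kernel is extended to a basis \<open>D\<close> of
  \<open>U\<close>; the images of \<open>D - A\<close> then form a basis of the image.\<close>

lemma rank_nullity:
  assumes U: "fin_dim_space s1 U" and f: "linear_between s1 s2 U W f"
  shows "vs1.dim U = vs2.dim (f ` U) + vs1.dim {u\<in>U. f u = 0}"
    and "fin_dim_space s2 (f ` U)"
proof -
  have subU: "vs1.subspace U" using vs1.fin_dim_space_subspace U by blast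
  define K where "K = {u\<in>U. f u = 0}"
  have subK: "vs1.subspace K"
    using linear_between_subspace_vimage[OF f subU vs2.subspace_single_0] by (simp add: K_def)
  have KU: "K \<subseteq> U" by (auto simp: K_def)
  have "fin_dim_space s1 K" using vs1.fin_dim_space_subset U subK KU by blast
  from vs1.fin_dim_space_basis_extend[OF this vs1.independent_empty]
  obtain A where A: "A \<subseteq> K" "vs1.independent A" "vs1.span A = K" "card A = vs1.dim K" by auto
  have "A \<subseteq> U" using A KU by blast
  from vs1.fin_dim_space_basis_extend[OF U A(2) this]
  obtain D where D: "A \<subseteq> D" "D \<subseteq> U" "vs1.independent D" "vs1.span D = U" "finite D"
    "card D = vs1.dim U" by metis
  obtain g where g: "Vector_Spaces.linear s1 s2 g" "\<And>u. u \<in> U \<Longrightarrow> g u = f u"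
    using linear_between_extend[OF f D(2,3,4)] by metis
  let ?E = "D - A"
  have indE: "vs1.independent ?E" using D(3) vs1.independent_mono by blast
  have spanE: "vs1.span ?E \<subseteq> U" using vs1.span_mono[of ?E D] D by auto
  \<comment> \<open>Such an \<open>x\<close> also lies in the kernel, the span of \<open>A\<close>.
    Its coordinates with respect to \<open>D\<close> are supported in both \<open>A\<close> and
    \<open>D - A\<close>, hence vanish.\<close>
  have 0: "x = 0" if x: "x \<in> vs1.span ?E" "g x = 0" for x
  proof -
    have "x \<in> U" using x spanE by blast
    then have "x \<in> vs1.span A" using A(3) g x by (auto simp: K_def)
    have "vs1.representation D x b = 0" for b
    proof (rule ccontr)
      assume n: "vs1.representation D x b \<noteq> 0"
      have "vs1.representation D x = vs1.representation A x"
        "vs1.representation D x = vs1.representation ?E x"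
        using vs1.representation_extend D \<open>x \<in> vs1.span A\<close> x by blast+
      then have "b \<in> A" "b \<in> ?E" using n vs1.representation_ne_zero by metis+
      then show False by blast
    qed
    moreover have "(\<Sum>b\<in>D. s1 (vs1.representation D x b) b) = x"
      using vs1.sum_representation_eq[of D x D] D \<open>x \<in> U\<close> by auto
    ultimately show ?thesis by simp
  qed
  have inj: "inj_on g (vs1.span ?E)"
    using linear_inj_on_iff_eq_0[OF g(1), of "vs1.span ?E"] 0 by auto
  have indgE: "vs2.independent (g ` ?E)"
    using linear_independent_injective_image[OF g(1) indE inj] .
  have "card (g ` ?E) = card ?E"
    using card_image inj vs1.span_superset inj_on_subset by metis
  moreover have "vs2.span (g ` ?E) = f ` U"
  proof -
    have "f ` U = g ` U" using g by force
    also have "\<dots> = vs2.span (g ` D)" using linear_span_image[OF g(1)] D by metis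
    also have "\<dots> = vs2.span (g ` ?E)"
    proof (rule vs2.span_eq[THEN iffD2], intro conjI)
      have "g a = 0" if "a \<in> A" for a using that A g by (auto simp: K_def)
      then show "g ` D \<subseteq> vs2.span (g ` ?E)"
        using vs2.span_zero vs2.span_base[of _ "g ` ?E"] by (metis DiffI imageI image_subsetI)
      show "g ` ?E \<subseteq> vs2.span (g ` D)" using vs2.span_base[of _ "g ` D"] by auto
    qed
    finally show ?thesis by simp
  qed
  ultimately have "vs2.dim (f ` U) = card ?E"
    using vs2.dim_span_eq_card_independent[OF indgE] by metis
  moreover have "card D = card ?E + card A"
    using D by (metis card_Diff_subset card_mono finite_subset le_add_diff_inverse2)
  ultimately show "vs1.dim U = vs2.dim (f ` U) + vs1.dim {u\<in>U. f u = 0}"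
    using A D by (simp add: K_def)
  show "fin_dim_space s2 (f ` U)"
    unfolding fin_dim_space_def using \<open>vs2.span (g ` ?E) = f ` U\<close> D by (metis finite_Diff finite_imageI)
qed

lemma dim_image_inj:
  assumes U: "fin_dim_space s1 U" and f: "linear_between s1 s2 U W f" and "inj_on f U"
  shows "vs2.dim (f ` U) = vs1.dim U"
proof -
  have sub: "vs1.subspace U" using vs1.fin_dim_space_subspace U by blast
  have "{u\<in>U. f u = 0} = {0}"
    using linear_between_0[OF f sub] vs1.subspace_0[OF sub] inj_onD[OF assms(3), of _ 0] by auto
  then show ?thesis using rank_nullity(1)[OF U f] by simp
qed

end

section \<open>Representations, isomorphisms and ranks\<close>

lemma is_repD:
  assumes "is_rep s M"
  shows "vector_space s" "module.subspace s (space_at M i)"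
    "i \<le> j \<Longrightarrow> linear_between s s (space_at M i) (space_at M j) (struct_map M i j)"
    "v \<in> space_at M i \<Longrightarrow> struct_map M i i v = v"
    "i \<le> j \<Longrightarrow> j \<le> l \<Longrightarrow> v \<in> space_at M i \<Longrightarrow>
      struct_map M j l (struct_map M i j v) = struct_map M i l v"
    "0 \<in> space_at M i"
    "i \<le> j \<Longrightarrow> v \<in> space_at M i \<Longrightarrow> struct_map M i j v \<in> space_at M j"
    "i \<le> j \<Longrightarrow> struct_map M i j 0 = 0"
proof -
  have vs: "vector_space s" and sub: "\<And>i. module.subspace s (space_at M i)"
    and lin: "\<And>i j. i \<le> j \<Longrightarrow> linear_between s s (space_at M i) (space_at M j) (struct_map M i j)"
    using assms by (auto simp: is_rep_def)
  show "vector_space s" "module.subspace s (space_at M i)"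
    "i \<le> j \<Longrightarrow> linear_between s s (space_at M i) (space_at M j) (struct_map M i j)"
    "v \<in> space_at M i \<Longrightarrow> struct_map M i i v = v"
    "i \<le> j \<Longrightarrow> j \<le> l \<Longrightarrow> v \<in> space_at M i \<Longrightarrow>
      struct_map M j l (struct_map M i j v) = struct_map M i l v"
    using assms by (auto simp: is_rep_def)
  interpret vector_space s by (fact vs)
  interpret vector_space_pair s s ..
  show "0 \<in> space_at M i" using subspace_0 sub by blast
  show "i \<le> j \<Longrightarrow> v \<in> space_at M i \<Longrightarrow> struct_map M i j v \<in> space_at M j"
    using lin unfolding linear_between_def by blast
  show "i \<le> j \<Longrightarrow> struct_map M i j 0 = 0"
    using linear_between_0 lin sub by blast
qed

lemma is_rep0_iff:
  "is_rep0 s M \<longleftrightarrow> is_rep s M \<and> (\<forall>i. fin_dim_space s (space_at M i)) \<and>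
    finite {i. space_at M i \<noteq> {0}}"
  by (simp add: is_rep0_def fin_dim_space_def)

lemma is_rep0D:
  assumes "is_rep0 s M"
  shows "is_rep s M" "fin_dim_space s (space_at M i)" "finite {i. space_at M i \<noteq> {0}}"
  using assms by (auto simp: is_rep0_iff)

lemma rep_homD:
  assumes "rep_hom s t M N \<phi>"
  shows "linear_between s t (space_at M i) (space_at N i) (\<phi> i)"
    "i \<le> j \<Longrightarrow> v \<in> space_at M i \<Longrightarrow> \<phi> j (struct_map M i j v) = struct_map N i j (\<phi> i v)"
    "v \<in> space_at M i \<Longrightarrow> \<phi> i v \<in> space_at N i"
  using assms unfolding rep_hom_def linear_between_def by blast+

lemma is_rep_pair: "is_rep s M \<Longrightarrow> is_rep t N \<Longrightarrow> vector_space_pair s t"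
  by (simp add: is_rep_def vector_space_pair_def)

lemma rep_isoE:
  assumes "rep_iso s t M N"
  obtains \<phi> where "rep_hom s t M N \<phi>" "\<And>i. bij_betw (\<phi> i) (space_at M i) (space_at N i)"
proof -
  obtain \<phi> \<psi> where *: "rep_hom s t M N \<phi>" "rep_hom t s N M \<psi>"
    "\<And>i v. v \<in> space_at M i \<Longrightarrow> \<psi> i (\<phi> i v) = v" "\<And>i w. w \<in> space_at N i \<Longrightarrow> \<phi> i (\<psi> i w) = w"
    using assms by (auto simp: rep_iso_def)
  have "bij_betw (\<phi> i) (space_at M i) (space_at N i)" for i
    by (rule bij_betw_byWitness[where f' = "\<psi> i"])
      (use * rep_homD(3) in \<open>blast+\<close>)
  then show thesis using that *(1) by blast
qed

lemma rep_isoI: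
  assumes M: "is_rep s M" and \<phi>: "rep_hom s t M N \<phi>"
    and bij: "\<And>i. bij_betw (\<phi> i) (space_at M i) (space_at N i)"
  shows "rep_iso s t M N"
proof -
  let ?g = "\<lambda>i. inv_into (space_at M i) (\<phi> i)"
  have g: "?g i w \<in> space_at M i" "\<phi> i (?g i w) = w" if "w \<in> space_at N i" for i w
    using bij[of i] that by (auto simp: bij_betw_def inv_into_into f_inv_into_f)
  have f: "?g i (\<phi> i v) = v" if "v \<in> space_at M i" for i v
    using bij[of i] that by (simp add: bij_betw_def)
  interpret vector_space s using is_repD(1)[OF M] .
  have "rep_hom t s N M ?g"
    unfolding rep_hom_def linear_between_def
  proof (intro conjI allI ballI impI)
    fix i u v assume uv: "u \<in> space_at N i" "v \<in> space_at N i"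
    have "?g i u + ?g i v \<in> space_at M i" using g uv is_repD(2)[OF M] subspace_add by blast
    moreover have "\<phi> i (?g i u + ?g i v) = u + v"
      using g uv rep_homD(1)[OF \<phi>, of i] by (simp add: linear_between_def)
    ultimately show "?g i (u + v) = ?g i u + ?g i v" using f by metis
  next
    fix i c u assume u: "u \<in> space_at N i"
    have "s c (?g i u) \<in> space_at M i" using g u is_repD(2)[OF M] subspace_scale by blast
    moreover have "\<phi> i (s c (?g i u)) = t c u"
      using g u rep_homD(1)[OF \<phi>, of i] by (simp add: linear_between_def)
    ultimately show "?g i (t c u) = s c (?g i u)" using f by metis
  next
    fix i j u assume ij: "i \<le> j" and u: "u \<in> space_at N i"
    have "struct_map M i j (?g i u) \<in> space_at M j" using g[OF u] is_repD(7)[OF M ij] by blast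
    moreover have "\<phi> j (struct_map M i j (?g i u)) = struct_map N i j u"
      using rep_homD(2)[OF \<phi> ij] g[OF u] by simp
    ultimately show "?g j (struct_map N i j u) = struct_map M i j (?g i u)" using f by metis
  qed (use g in auto)
  then show ?thesis using \<phi> f g unfolding rep_iso_def by (intro exI[of _ \<phi>] exI[of _ ?g]) auto
qed

lemma rep_iso_sym: "rep_iso s t M N \<Longrightarrow> rep_iso t s N M"
  unfolding rep_iso_def by blast

lemma rep_hom_trans:
  assumes "rep_hom s t M N \<phi>" "rep_hom t u N K \<psi>"
  shows "rep_hom s u M K (\<lambda>i v. \<psi> i (\<phi> i v))"
proof -
  note 1 = rep_homD[OF assms(1)] and 2 = rep_homD[OF assms(2)]
  have "linear_between s u (space_at M i) (space_at K i) (\<lambda>v. \<psi> i (\<phi> i v))" for i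
    using 1(1,3)[where i = i] 2(1,3)[where i = i] by (simp add: linear_between_def image_subset_iff)
  moreover have "\<psi> j (\<phi> j (struct_map M i j v)) = struct_map K i j (\<psi> i (\<phi> i v))"
    if "i \<le> j" "v \<in> space_at M i" for i j v
    using 1(2)[OF that] 2(2)[OF that(1) 1(3)[OF that(2)]] by simp
  ultimately show ?thesis by (simp add: rep_hom_def)
qed

lemma rep_iso_trans:
  assumes M: "rep_iso s t M N" and N: "rep_iso t u N K"
  shows "rep_iso s u M K"
proof -
  obtain \<phi> \<psi> where 1: "rep_hom s t M N \<phi>" "rep_hom t s N M \<psi>"
    "\<And>i v. v \<in> space_at M i \<Longrightarrow> \<psi> i (\<phi> i v) = v" "\<And>i w. w \<in> space_at N i \<Longrightarrow> \<phi> i (\<psi> i w) = w"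
    using M unfolding rep_iso_def by blast
  obtain \<phi>' \<psi>' where 2: "rep_hom t u N K \<phi>'" "rep_hom u t K N \<psi>'"
    "\<And>i v. v \<in> space_at N i \<Longrightarrow> \<psi>' i (\<phi>' i v) = v" "\<And>i w. w \<in> space_at K i \<Longrightarrow> \<phi>' i (\<psi>' i w) = w"
    using N unfolding rep_iso_def by blast
  show ?thesis
    unfolding rep_iso_def
    using rep_hom_trans[OF 1(1) 2(1)] rep_hom_trans[OF 2(2) 1(2)]
      1(3,4) 2(3,4) rep_homD(3)[OF 1(1)] rep_homD(3)[OF 2(2)]
    by (intro exI[of _ "\<lambda>i v. \<phi>' i (\<phi> i v)"] exI[of _ "\<lambda>i v. \<psi> i (\<psi>' i v)"]) simp
qed

lemma rep_iso_zero_iff: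
  assumes M: "is_rep s M"
  shows "rep_iso s s M zero_rep \<longleftrightarrow> (\<forall>i. space_at M i = {0})"
proof
  assume "rep_iso s s M zero_rep"
  then obtain \<phi> \<psi> where \<phi>: "rep_hom s s M zero_rep \<phi>"
    "\<And>i v. v \<in> space_at M i \<Longrightarrow> \<psi> i (\<phi> i v) = v"
    unfolding rep_iso_def by blast
  have "x = 0" if x: "x \<in> space_at M i" for x i
    using \<phi>(2)[OF x] \<phi>(2)[OF is_repD(6)[OF M, of i]] rep_homD(3)[OF \<phi>(1) x]
      rep_homD(3)[OF \<phi>(1) is_repD(6)[OF M, of i]]
    by (simp add: zero_rep_def)
  then show "\<forall>i. space_at M i = {0}" using is_repD(6)[OF M] by blast
next
  assume *: "\<forall>i. space_at M i = {0}"
  interpret vector_space s using is_repD(1)[OF M] .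
  show "rep_iso s s M zero_rep"
    by (rule rep_isoI[OF M, where \<phi> = "\<lambda>i v. v"])
      (use * is_repD(8)[OF M] in \<open>auto simp: rep_hom_def linear_between_def zero_rep_def bij_betw_def\<close>)
qed

text \<open>The invariant and all its estimates are expressed through these ranks, which are
  preserved by isomorphism and additive on direct sums.\<close>

definition rk :: "('k::field \<Rightarrow> 'v::ab_group_add \<Rightarrow> 'v) \<Rightarrow> ('p::order, 'v) rep \<Rightarrow> 'p \<Rightarrow> 'p \<Rightarrow> nat"
  where "rk s M i j = vector_space.dim s (struct_map M i j ` space_at M i)"

lemma rk_refl: "is_rep s M \<Longrightarrow> rk s M i i = vector_space.dim s (space_at M i)"
  using is_repD(4)[of s M] by (simp add: rk_def)

lemma rep_iso_fin_dim:
  assumes "is_rep s M" "is_rep t N" "rep_iso s t M N" "fin_dim_space s (space_at M i)"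
  shows "fin_dim_space t (space_at N i)"
proof -
  interpret vector_space_pair s t
    using is_rep_pair[OF assms(1,2)] .
  obtain \<phi> where \<phi>: "rep_hom s t M N \<phi>" "\<And>i. bij_betw (\<phi> i) (space_at M i) (space_at N i)"
    using rep_isoE[OF assms(3)] by blast
  show ?thesis
    using rank_nullity(2)[OF assms(4) rep_homD(1)[OF \<phi>(1)]] \<phi>(2)[of i] by (simp add: bij_betw_def)
qed

lemma rep_iso_space_zero:
  assumes "is_rep s M" "is_rep t N" "rep_iso s t M N"
  shows "space_at M i = {0} \<longleftrightarrow> space_at N i = {0}"
proof -
  interpret vector_space_pair s t
    using is_rep_pair[OF assms(1,2)] .
  obtain \<phi> where \<phi>: "rep_hom s t M N \<phi>" "\<And>i. bij_betw (\<phi> i) (space_at M i) (space_at N i)"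
    using rep_isoE[OF assms(3)] by blast
  have 0: "\<phi> i 0 = 0" using linear_between_0[OF rep_homD(1)[OF \<phi>(1)] is_repD(2)[OF assms(1)]] .
  have im: "\<phi> i ` space_at M i = space_at N i" and inj: "inj_on (\<phi> i) (space_at M i)"
    using \<phi>(2)[of i] by (auto simp: bij_betw_def)
  show ?thesis
  proof
    assume "space_at M i = {0}"
    then show "space_at N i = {0}" using im 0 by simp
  next
    assume N: "space_at N i = {0}"
    have "v = 0" if "v \<in> space_at M i" for v
    proof -
      have "\<phi> i v = \<phi> i 0" using im that N 0 by (metis imageI singletonD)
      then show ?thesis using inj_onD[OF inj] that is_repD(6)[OF assms(1)] by blast
    qed
    then show "space_at M i = {0}" using is_repD(6)[OF assms(1)] by blast
  qed
qed

lemma rep_iso_is_rep0: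
  assumes "is_rep0 s M" "is_rep t N" "rep_iso s t M N"
  shows "is_rep0 t N"
  using assms rep_iso_fin_dim[of s M t N] rep_iso_space_zero[of s M t N]
  by (simp add: is_rep0_iff)

lemma rep_iso_rk:
  assumes M: "is_rep0 s M" and N: "is_rep t N" and iso: "rep_iso s t M N" and ij: "i \<le> j"
  shows "rk s M i j = rk t N i j"
proof -
  note M' = is_rep0D(1)[OF M]
  interpret vector_space_pair s t
    using is_rep_pair[OF M' N] .
  interpret p: vector_space_pair s s ..
  obtain \<phi> where \<phi>: "rep_hom s t M N \<phi>" "\<And>i. bij_betw (\<phi> i) (space_at M i) (space_at N i)"
    using rep_isoE[OF iso] by blast
  let ?S = "struct_map M i j ` space_at M i"
  have S: "fin_dim_space s ?S" "?S \<subseteq> space_at M j"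
    using p.rank_nullity(2)[OF is_rep0D(2)[OF M] is_repD(3)[OF M' ij]] is_repD(7)[OF M' ij] by auto
  have "struct_map N i j ` space_at N i = \<phi> j ` ?S"
    using \<phi>(2)[of i] rep_homD(2)[OF \<phi>(1) ij] by (force simp: bij_betw_def image_iff)
  moreover have "inj_on (\<phi> j) ?S" using \<phi>(2)[of j] S inj_on_subset by (metis bij_betw_def)
  ultimately show ?thesis
    using dim_image_inj[OF S(1) linear_between_subset[OF rep_homD(1)[OF \<phi>(1)] S(2)]]
    by (simp add: rk_def)
qed

section \<open>External direct sums\<close>

definition power_space :: "nat \<Rightarrow> (nat \<Rightarrow> 'v::zero set) \<Rightarrow> (nat \<Rightarrow> 'v) set"
  where "power_space n U = {f. (\<forall>k<n. f k \<in> U k) \<and> (\<forall>k\<ge>n. f k = 0)}"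

lemma vector_space_pointwise_scale:
  assumes "vector_space s"
  shows "vector_space (pointwise_scale s)"
proof -
  interpret vector_space s by fact
  show ?thesis
    by standard (auto simp: pointwise_scale_def fun_eq_iff scale_right_distrib scale_left_distrib)
qed

text \<open>Generators of the kernel together with lifts of generators of the image span
  \<open>U\<close>. This provides finiteness of a product before rank-nullity can be applied to
  it.\<close>

lemma (in vector_space_pair) fin_dim_space_extension:
  assumes U: "vs1.subspace U" and f: "linear_between s1 s2 U W f"
    and im: "fin_dim_space s2 (f ` U)" and ker: "fin_dim_space s1 {u\<in>U. f u = 0}"
  shows "fin_dim_space s1 U"
proof -
  obtain C where C: "finite C" "f ` U = vs2.span C" using im by (auto simp: fin_dim_space_def)
  obtain A where A: "finite A" "{u\<in>U. f u = 0} = vs1.span A"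
    using ker by (auto simp: fin_dim_space_def)
  have "\<forall>c\<in>C. \<exists>u\<in>U. f u = c" using C vs2.span_base by (metis imageE)
  then obtain h where h: "\<And>c. c \<in> C \<Longrightarrow> h c \<in> U \<and> f (h c) = c" by metis
  let ?S = "vs1.span (A \<union> h ` C)"
  have AU: "A \<subseteq> U" using A vs1.span_superset by blast
  then have SU: "?S \<subseteq> U" using h vs1.span_minimal U by (metis Un_subset_iff image_subsetI)
  have "C \<subseteq> f ` ?S"
  proof
    fix c assume "c \<in> C"
    then have "h c \<in> ?S" "f (h c) = c" using h vs1.span_base by auto
    then show "c \<in> f ` ?S" by (metis imageI)
  qed
  moreover have "vs2.subspace (f ` ?S)"
    using linear_between_subspace_image[OF linear_between_subset[OF f SU]] by blast
  ultimately have "f ` U \<subseteq> f ` ?S" using C vs2.span_minimal by blast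
  have "U \<subseteq> ?S"
  proof
    fix u assume "u \<in> U"
    then obtain v where v: "v \<in> ?S" "f u = f v" using \<open>f ` U \<subseteq> f ` ?S\<close> by blast
    then have "v \<in> U" using SU by auto
    then have "u - v \<in> vs1.span A"
      unfolding A(2)[symmetric]
      using linear_between_diff[OF f U \<open>u \<in> U\<close>] v \<open>u \<in> U\<close> vs1.subspace_diff[OF U] by simp
    then have "u - v \<in> ?S" using vs1.span_mono[of A "A \<union> h ` C"] by blast
    then have "u - v + v \<in> ?S" using v vs1.span_add by blast
    then show "u \<in> ?S" by simp
  qed
  then have "U = ?S" using SU by blast
  then show ?thesis unfolding fin_dim_space_def using A C by (metis finite_UnI finite_imageI)
qed

lemma power_space_subspace:
  assumes vs: "vector_space s" and U: "\<And>k. k < n \<Longrightarrow> module.subspace s (U k)"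
  shows "module.subspace (pointwise_scale s) (power_space n U)"
proof -
  interpret vector_space s by (fact vs)
  interpret P: vector_space "pointwise_scale s" using vector_space_pointwise_scale[OF vs] .
  show ?thesis
    using U subspace_0 subspace_add subspace_scale
    by (intro P.subspaceI) (auto simp: power_space_def pointwise_scale_def)
qed

text \<open>Evaluation at the last coordinate has the last factor as image and the shorter product
  as kernel.\<close>

lemma power_space_dim:
  assumes vs: "vector_space s" and U: "\<And>k. k < n \<Longrightarrow> fin_dim_space s (U k)"
  shows "fin_dim_space (pointwise_scale s) (power_space n U) \<and>
    vector_space.dim (pointwise_scale s) (power_space n U) = (\<Sum>k<n. vector_space.dim s (U k))"
proof -
  interpret vector_space s by (fact vs)
  interpret P: vector_space "pointwise_scale s" using vector_space_pointwise_scale[OF vs] .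
  interpret vector_space_pair "pointwise_scale s" s ..
  show ?thesis using U
  proof (induction n)
    case 0
    have "power_space 0 U = {0}" by (auto simp: power_space_def)
    then show ?case using P.fin_dim_space_zero by simp
  next
    case (Suc n)
    let ?e = "\<lambda>f::nat \<Rightarrow> 'b. f n"
    have sub: "P.subspace (power_space (Suc n) U)"
      using power_space_subspace[OF vs] Suc.prems fin_dim_space_subspace by blast
    have sub_U: "subspace (U k)" if "k < Suc n" for k
      using Suc.prems fin_dim_space_subspace that by blast
    have lin: "linear_between (pointwise_scale s) s (power_space (Suc n) U) (U n) ?e"
      by (auto simp: linear_between_def power_space_def pointwise_scale_def)
    have ker: "{f\<in>power_space (Suc n) U. ?e f = 0} = power_space n U"
    proof (intro set_eqI iffI)
      fix f assume f: "f \<in> {f\<in>power_space (Suc n) U. f n = 0}"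
      then have "f k = 0" if "k \<ge> n" for k
        using that by (cases "k = n") (auto simp: power_space_def)
      then show "f \<in> power_space n U" using f by (auto simp: power_space_def)
    qed (use subspace_0[OF sub_U] in \<open>auto simp: power_space_def less_Suc_eq\<close>)
    have im: "?e ` power_space (Suc n) U = U n"
    proof
      show "U n \<subseteq> ?e ` power_space (Suc n) U"
      proof
        fix u assume "u \<in> U n"
        then have "(\<lambda>k. if k = n then u else 0) \<in> power_space (Suc n) U"
          using subspace_0[OF sub_U] by (auto simp: power_space_def)
        from imageI[OF this, of ?e] show "u \<in> ?e ` power_space (Suc n) U" by simp
      qed
    qed (auto simp: power_space_def)
    have IH: "fin_dim_space (pointwise_scale s) (power_space n U)"
      "P.dim (power_space n U) = (\<Sum>k<n. dim (U k))"
      using Suc by auto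
    have fd: "fin_dim_space (pointwise_scale s) (power_space (Suc n) U)"
      using fin_dim_space_extension[OF sub lin] ker im IH Suc.prems by simp
    then show ?case using rank_nullity(1)[OF fd lin] ker im IH by simp
  qed
qed

lemma direct_sum_space:
  "space_at (direct_sum Ns) i = power_space (length Ns) (\<lambda>k. space_at (Ns ! k) i)"
  by (auto simp: direct_sum_def power_space_def)

lemma direct_sum_map:
  "struct_map (direct_sum Ns) i j f = (\<lambda>k. if k < length Ns then struct_map (Ns ! k) i j (f k) else 0)"
  by (auto simp: direct_sum_def)

lemma direct_sum_image:
  "struct_map (direct_sum Ns) i j ` space_at (direct_sum Ns) i
    = power_space (length Ns) (\<lambda>k. struct_map (Ns ! k) i j ` space_at (Ns ! k) i)"
  (is "?L = ?R")
proof
  show "?L \<subseteq> ?R" by (auto simp: direct_sum_space direct_sum_map power_space_def)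
  show "?R \<subseteq> ?L"
  proof
    fix f assume f: "f \<in> ?R"
    then have "\<forall>k<length Ns. \<exists>v\<in>space_at (Ns ! k) i. f k = struct_map (Ns ! k) i j v"
      by (auto simp: power_space_def)
    then obtain g where g: "\<And>k. k < length Ns \<Longrightarrow>
      g k \<in> space_at (Ns ! k) i \<and> f k = struct_map (Ns ! k) i j (g k)" by metis
    let ?g = "\<lambda>k. if k < length Ns then g k else 0"
    have "?g \<in> space_at (direct_sum Ns) i" using g by (auto simp: direct_sum_space power_space_def)
    moreover have "f = struct_map (direct_sum Ns) i j ?g"
      using g f by (auto simp: direct_sum_map power_space_def fun_eq_iff)
    ultimately show "f \<in> ?L" by blast
  qed
qed

lemma direct_sum_is_rep:
  assumes vs: "vector_space s" and Ns: "\<And>N. N \<in> set Ns \<Longrightarrow> is_rep s N"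
  shows "is_rep (pointwise_scale s) (direct_sum Ns)"
proof -
  have N: "is_rep s (Ns ! k)" if "k < length Ns" for k using Ns that by simp
  note D = is_repD[OF N]
  have s0: "s c 0 = 0" for c
  proof -
    interpret vector_space s by (fact vs)
    show ?thesis by simp
  qed
  have "module.subspace (pointwise_scale s) (space_at (direct_sum Ns) i)" for i
    unfolding direct_sum_space by (rule power_space_subspace[OF vs]) (use D in blast)
  moreover have "linear_between (pointwise_scale s) (pointwise_scale s)
    (space_at (direct_sum Ns) i) (space_at (direct_sum Ns) j) (struct_map (direct_sum Ns) i j)"
    if "i \<le> j" for i j
    using D(3,7)[OF _ that] s0
    by (auto simp: linear_between_def direct_sum_space direct_sum_map power_space_def
        pointwise_scale_def fun_eq_iff)
  moreover have "struct_map (direct_sum Ns) i i v = v" if "v \<in> space_at (direct_sum Ns) i" for i v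
    using D(4) that by (auto simp: direct_sum_space direct_sum_map power_space_def fun_eq_iff)
  moreover have "struct_map (direct_sum Ns) j l (struct_map (direct_sum Ns) i j v)
      = struct_map (direct_sum Ns) i l v"
    if "i \<le> j" "j \<le> l" "v \<in> space_at (direct_sum Ns) i" for i j l v
    using D(5) that by (auto simp: direct_sum_space direct_sum_map power_space_def fun_eq_iff)
  ultimately show ?thesis
    using vector_space_pointwise_scale[OF vs] by (simp add: is_rep_def)
qed

lemma rk_direct_sum:
  assumes vs: "vector_space s" and Ns: "\<And>N. N \<in> set Ns \<Longrightarrow> is_rep0 s N" and ij: "i \<le> j"
  shows "rk (pointwise_scale s) (direct_sum Ns) i j = (\<Sum>k<length Ns. rk s (Ns ! k) i j)"
proof -
  interpret vector_space s by (fact vs)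
  interpret vector_space_pair s s ..
  have N: "is_rep0 s (Ns ! k)" if "k < length Ns" for k using Ns that by simp
  have "fin_dim_space s (struct_map (Ns ! k) i j ` space_at (Ns ! k) i)" if "k < length Ns" for k
    using rank_nullity(2)[OF is_rep0D(2)[OF N[OF that]] is_repD(3)[OF is_rep0D(1)[OF N[OF that]] ij]] .
  then show ?thesis
    using power_space_dim[OF vs] by (simp add: rk_def direct_sum_image)
qed

text \<open>Spreads in a decomposition are not assumed finite; their finiteness is inherited from
  \<open>M\<close>. A coordinate is an image of a finite-dimensional space and also embeds into the
  sum, which bounds dimension and support.\<close>

lemma direct_sum_summand_is_rep0:
  assumes M: "is_rep0 s M" and Ns: "\<And>N. N \<in> set Ns \<Longrightarrow> is_rep t N" and t: "vector_space t"
    and iso: "rep_iso s (pointwise_scale t) M (direct_sum Ns)" and N: "N \<in> set Ns"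
  shows "is_rep0 t N" "{i. space_at N i \<noteq> {0}} \<subseteq> {i. space_at M i \<noteq> {0}}"
proof -
  obtain k where k: "k < length Ns" "N = Ns ! k" using N by (metis in_set_conv_nth)
  have S: "is_rep (pointwise_scale t) (direct_sum Ns)" using direct_sum_is_rep[OF t Ns] .
  have S0: "is_rep0 (pointwise_scale t) (direct_sum Ns)" using rep_iso_is_rep0[OF M S iso] .
  interpret vector_space_pair "pointwise_scale t" t
    using t vector_space_pointwise_scale[OF t] by (simp add: vector_space_pair_def)
  have emb: "(\<lambda>l. if l = k then u else 0) \<in> space_at (direct_sum Ns) i" if "u \<in> space_at N i" for u i
    using that k is_repD(6)[OF Ns] by (auto simp: direct_sum_space power_space_def)
  have fd: "fin_dim_space t (space_at N i)" for i
  proof -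
    have lin: "linear_between (pointwise_scale t) t (space_at (direct_sum Ns) i) (space_at N i) (\<lambda>f. f k)"
      using k by (auto simp: linear_between_def direct_sum_space power_space_def pointwise_scale_def)
    have "(\<lambda>f. f k) ` space_at (direct_sum Ns) i = space_at N i"
    proof
      show "space_at N i \<subseteq> (\<lambda>f. f k) ` space_at (direct_sum Ns) i"
      proof
        fix u assume "u \<in> space_at N i"
        from imageI[OF emb[OF this], of "\<lambda>f. f k"]
        show "u \<in> (\<lambda>f. f k) ` space_at (direct_sum Ns) i" by simp
      qed
    qed (use k in \<open>auto simp: direct_sum_space power_space_def\<close>)
    then show ?thesis using rank_nullity(2)[OF is_rep0D(2)[OF S0] lin] by simp
  qed
  show supp: "{i. space_at N i \<noteq> {0}} \<subseteq> {i. space_at M i \<noteq> {0}}"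
  proof
    fix i assume "i \<in> {i. space_at N i \<noteq> {0}}"
    then obtain u where u: "u \<in> space_at N i" "u \<noteq> 0" using is_repD(6)[OF Ns[OF N]] by blast
    have "(\<lambda>l. if l = k then u else 0) \<noteq> 0" using u(2) by (auto simp: fun_eq_iff)
    then have "space_at (direct_sum Ns) i \<noteq> {0}" using emb[OF u(1)] by blast
    then show "i \<in> {i. space_at M i \<noteq> {0}}"
      using rep_iso_space_zero[OF is_rep0D(1)[OF M] S iso] by simp
  qed
  show "is_rep0 t N"
    using fd Ns[OF N] finite_subset[OF supp is_rep0D(3)[OF M]] by (simp add: is_rep0_iff)
qed

section \<open>Subrepresentations and internal direct sums\<close>

lemma total_dim_eq_sum:
  assumes "vector_space s" "finite F" "\<And>i. i \<notin> F \<Longrightarrow> S i = {0}"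
  shows "total_dim s S = (\<Sum>i\<in>F. vector_space.dim s (S i))"
proof -
  interpret vector_space s by fact
  show ?thesis
    unfolding total_dim_def by (rule sum.mono_neutral_left) (use assms in auto)
qed

text \<open>The share of one degree: an alternating sum of ranks into \<open>(a, b)\<close> over the
  unit square with upper right corner \<open>(a, b)\<close>. Images are graded by their target, so
  every term ends at the same index.\<close>

definition N_at :: "('k::field \<Rightarrow> 'v::ab_group_add \<Rightarrow> 'v) \<Rightarrow> (int \<times> int, 'v) rep \<Rightarrow> int \<times> int \<Rightarrow> int"
  where "N_at s M = (\<lambda>(a, b). int (rk s M (a, b) (a, b)) - int (rk s M (a - 1, b) (a, b))
    - int (rk s M (a, b - 1) (a, b)) + int (rk s M (a - 1, b - 1) (a, b)))"

text \<open>The four total dimensions are sums over four different supports; a common finite set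
  \<open>F\<close> merges them degree by degree. Leaving \<open>F\<close> free lets all summands of
  \<open>M\<close> be summed over the support of \<open>M\<close>, and lets the support be enclosed
  in a square.\<close>

lemma N_two_eq_sum:
  assumes M: "is_rep0 s M" and F: "finite F" "{i. space_at M i \<noteq> {0}} \<subseteq> F"
  shows "N_two s M = (\<Sum>i\<in>F. N_at s M i)"
proof -
  note R = is_repD[OF is_rep0D(1)[OF M]]
  have im0: "struct_map M i j ` space_at M i = {0}" if "j \<notin> F" "i \<le> j" for i j
  proof -
    have "space_at M j = {0}" using that F by auto
    then show ?thesis using R(6)[of i] R(7)[OF that(2)] R(8)[OF that(2)] by force
  qed
  have "space_at M i = {0}" if "i \<notin> F" for i using that F by auto
  then have 1: "total_dim s (space_at M) = (\<Sum>i\<in>F. vector_space.dim s (space_at M i))"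
    by (rule total_dim_eq_sum[OF R(1) F(1)])
  have "x_image M (space_at M) i = {0}" if "i \<notin> F" for i
    using im0[OF that] by (cases i) (auto simp: x_image_def)
  then have 2: "total_dim s (x_image M (space_at M)) = (\<Sum>i\<in>F. vector_space.dim s (x_image M (space_at M) i))"
    by (rule total_dim_eq_sum[OF R(1) F(1)])
  have "y_image M (space_at M) i = {0}" if "i \<notin> F" for i
    using im0[OF that] by (cases i) (auto simp: y_image_def)
  then have 3: "total_dim s (y_image M (space_at M)) = (\<Sum>i\<in>F. vector_space.dim s (y_image M (space_at M) i))"
    by (rule total_dim_eq_sum[OF R(1) F(1)])
  have xy: "x_image M (y_image M (space_at M)) (a, b)
      = struct_map M (a - 1, b - 1) (a, b) ` space_at M (a - 1, b - 1)" for a b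
    using R(5)[of "(a - 1, b - 1)" "(a - 1, b)" "(a, b)"]
    by (auto simp: x_image_def y_image_def image_image image_iff)
  have "x_image M (y_image M (space_at M)) i = {0}" if "i \<notin> F" for i
    using im0[OF that] xy by (cases i) auto
  then have 4: "total_dim s (x_image M (y_image M (space_at M)))
      = (\<Sum>i\<in>F. vector_space.dim s (x_image M (y_image M (space_at M)) i))"
    by (rule total_dim_eq_sum[OF R(1) F(1)])
  show ?thesis
    unfolding N_two_def 1 2 3 4 of_nat_sum sum_subtractf[symmetric] sum.distrib[symmetric]
  proof (rule sum.cong[OF refl])
    fix i
    show "int (vector_space.dim s (space_at M i)) - int (vector_space.dim s (x_image M (space_at M) i))
        - int (vector_space.dim s (y_image M (space_at M) i))
        + int (vector_space.dim s (x_image M (y_image M (space_at M)) i)) = N_at s M i"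
      unfolding rk_refl[OF is_rep0D(1)[OF M], symmetric]
      by (cases i) (simp add: N_at_def xy, simp add: rk_def x_image_def y_image_def)
  qed
qed

lemma N_two_rep_iso:
  assumes M: "is_rep0 s M" and N: "is_rep t N" and iso: "rep_iso s t M N"
  shows "N_two s M = N_two t N"
proof -
  have N0: "is_rep0 t N" using rep_iso_is_rep0[OF M N iso] .
  let ?F = "{i. space_at M i \<noteq> {0}}"
  have F: "{i. space_at N i \<noteq> {0}} = ?F"
    using rep_iso_space_zero[OF is_rep0D(1)[OF M] N iso] by simp
  have "N_at s M i = N_at t N i" for i
    using rep_iso_rk[OF M N iso] by (cases i) (simp add: N_at_def)
  then show ?thesis
    using N_two_eq_sum[OF M is_rep0D(3)[OF M] order.refl]
      N_two_eq_sum[OF N0 is_rep0D(3)[OF M]] F by simp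
qed

lemma N_two_direct_sum:
  assumes M: "is_rep0 s M" and Ns: "\<And>N. N \<in> set Ns \<Longrightarrow> is_rep t N" and t: "vector_space t"
    and iso: "rep_iso s (pointwise_scale t) M (direct_sum Ns)"
  shows "N_two s M = (\<Sum>k<length Ns. N_two t (Ns ! k))"
proof -
  let ?F = "{i. space_at M i \<noteq> {0}}"
  note N0 = direct_sum_summand_is_rep0[OF M Ns t iso]
  have S: "is_rep (pointwise_scale t) (direct_sum Ns)" using direct_sum_is_rep[OF t Ns] .
  have "rk s M i j = (\<Sum>k<length Ns. rk t (Ns ! k) i j)" if "i \<le> j" for i j
    using rep_iso_rk[OF M S iso that] rk_direct_sum[OF t N0(1) that] by simp
  then have "N_at s M i = (\<Sum>k<length Ns. N_at t (Ns ! k) i)" for i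
    by (cases i) (simp add: N_at_def sum_subtractf sum.distrib)
  then have "N_two s M = (\<Sum>i\<in>?F. \<Sum>k<length Ns. N_at t (Ns ! k) i)"
    using N_two_eq_sum[OF M is_rep0D(3)[OF M] order.refl] by simp
  also have "\<dots> = (\<Sum>k<length Ns. \<Sum>i\<in>?F. N_at t (Ns ! k) i)" by (rule sum.swap)
  also have "\<dots> = (\<Sum>k<length Ns. N_two t (Ns ! k))"
    by (rule sum.cong[OF refl])
      (rule N_two_eq_sum[OF N0(1) is_rep0D(3)[OF M] N0(2), symmetric]; simp)
  finally show ?thesis .
qed

section \<open>Subrepresentations as subgroups\<close>

abbreviation sub_rep :: "('p, 'v) rep \<Rightarrow> ('p \<Rightarrow> 'v set) \<Rightarrow> ('p, 'v) rep"
  where "sub_rep M U \<equiv> M\<lparr>space_at := U\<rparr>"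

definition subrep :: "('k::field \<Rightarrow> 'v::ab_group_add \<Rightarrow> 'v) \<Rightarrow> ('p::order, 'v) rep \<Rightarrow> ('p \<Rightarrow> 'v set) \<Rightarrow> bool"
  where "subrep s M U \<longleftrightarrow> (\<forall>i. module.subspace s (U i) \<and> U i \<subseteq> space_at M i) \<and>
    (\<forall>i j. i \<le> j \<longrightarrow> (\<forall>v\<in>U i. struct_map M i j v \<in> U j))"

lemma subrepD:
  assumes "subrep s M U"
  shows "module.subspace s (U i)" "U i \<subseteq> space_at M i"
    "i \<le> j \<Longrightarrow> v \<in> U i \<Longrightarrow> struct_map M i j v \<in> U j"
  using assms by (auto simp: subrep_def)

lemma sub_rep_is_rep:
  assumes M: "is_rep s M" and U: "subrep s M U"
  shows "is_rep s (sub_rep M U)"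
proof -
  have "linear_between s s (U i) (U j) (struct_map M i j)" if "i \<le> j" for i j
    using is_repD(3)[OF M that] subrepD[OF U, of i] subrepD(3)[OF U that]
    unfolding linear_between_def by blast
  then show ?thesis
    using is_repD(1,4,5)[OF M] subrepD(1,2)[OF U] unfolding is_rep_def
    by (simp add: subset_eq)
qed

lemma sub_rep_is_rep0:
  assumes M: "is_rep0 s M" and U: "subrep s M U"
  shows "is_rep0 s (sub_rep M U)"
proof -
  note R = is_rep0D[OF M]
  interpret vector_space s using is_repD(1)[OF R(1)] .
  have "fin_dim_space s (U i)" for i
    using fin_dim_space_subset[OF R(2)] subrepD(1,2)[OF U] by blast
  moreover have "U i = {0}" if "space_at M i = {0}" for i
    using subrepD(2)[OF U, of i] subspace_0[OF subrepD(1)[OF U]] that by blast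
  then have "{i. U i \<noteq> {0}} \<subseteq> {i. space_at M i \<noteq> {0}}" by blast
  then have "finite {i. U i \<noteq> {0}}" using R(3) finite_subset by blast
  ultimately show ?thesis using sub_rep_is_rep[OF R(1) U] by (simp add: is_rep0_iff)
qed

text \<open>Turns a family of subspaces into a single subset of the group of functions. Evaluation
  at an index recovers the family whenever all its members contain 0.\<close>

definition sections :: "('p \<Rightarrow> 'v set) \<Rightarrow> ('p \<Rightarrow> 'v) set"
  where "sections U = {f. \<forall>i. f i \<in> U i}"

definition subrep_lattice :: "('k::field \<Rightarrow> 'v::ab_group_add \<Rightarrow> 'v) \<Rightarrow> ('p::order, 'v) rep \<Rightarrow> ('p \<Rightarrow> 'v) set set"
  where "subrep_lattice s M = {sections U | U. subrep s M U}"

definition subrep_len :: "('k::field \<Rightarrow> 'v::ab_group_add \<Rightarrow> 'v) \<Rightarrow> ('p::order, 'v) rep \<Rightarrow> ('p \<Rightarrow> 'v) set \<Rightarrow> nat"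
  where "subrep_len s M X =
    (\<Sum>i\<in>{i. space_at M i \<noteq> {0}}. vector_space.dim s ((\<lambda>f. f i) ` X))"

lemma sections_eval:
  fixes U :: "'p \<Rightarrow> 'v::zero set"
  assumes "\<And>i. 0 \<in> U i"
  shows "(\<lambda>f. f i) ` sections U = U i"
proof
  show "U i \<subseteq> (\<lambda>f. f i) ` sections U"
  proof
    fix u assume u: "u \<in> U i"
    have "(\<lambda>_. 0)(i := u) \<in> sections U" using u assms by (auto simp: sections_def)
    from imageI[OF this, of "\<lambda>f. f i"] show "u \<in> (\<lambda>f. f i) ` sections U" by simp
  qed
qed (auto simp: sections_def)

lemma sections_subset_iff:
  fixes U V :: "'p \<Rightarrow> 'v::zero set"
  assumes "\<And>i. 0 \<in> U i"
  shows "sections U \<subseteq> sections V \<longleftrightarrow> (\<forall>i. U i \<subseteq> V i)"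
proof
  assume "sections U \<subseteq> sections V"
  then have "(\<lambda>f. f i) ` sections U \<subseteq> V i" for i by (auto simp: sections_def)
  then show "\<forall>i. U i \<subseteq> V i" using sections_eval[of U] assms by simp
qed (auto simp: sections_def)

lemma sections_Int: "sections U \<inter> sections V = sections (\<lambda>i. U i \<inter> V i)"
  by (auto simp: sections_def)

lemma sections_plus:
  fixes U V :: "'p \<Rightarrow> 'v::ab_group_add set"
  shows "sections U + sections V = sections (\<lambda>i. U i + V i)"
proof
  show "sections (\<lambda>i. U i + V i) \<subseteq> sections U + sections V"
  proof
    fix f assume "f \<in> sections (\<lambda>i. U i + V i)"
    then have "\<forall>i. \<exists>u\<in>U i. \<exists>v\<in>V i. f i = u + v" by (auto simp: sections_def set_plus_def)
    then obtain u v where uv: "\<And>i. u i \<in> U i" "\<And>i. v i \<in> V i" "\<And>i. f i = u i + v i" by metis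
    then have "f = u + v" by (simp add: fun_eq_iff)
    then show "f \<in> sections U + sections V" using uv by (auto simp: sections_def)
  qed
qed (fastforce simp: sections_def elim!: set_plus_elim)

lemma sections_zero: "sections (\<lambda>_. {0}) = {0 :: 'p \<Rightarrow> 'v::zero}"
  by (auto simp: sections_def fun_eq_iff)

lemma subrep_plus:
  assumes M: "is_rep s M" and U: "subrep s M U" and V: "subrep s M V"
  shows "subrep s M (\<lambda>i. U i + V i)"
proof -
  interpret vector_space s using is_repD(1)[OF M] .
  have "U i + V i = {x + y |x y. x \<in> U i \<and> y \<in> V i}" for i by (auto simp: set_plus_def)
  then have "subspace (U i + V i)" for i
    using subspace_sums subrepD(1)[OF U] subrepD(1)[OF V] by simp
  moreover have "U i + V i \<subseteq> space_at M i" for i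
    using subrepD(2)[OF U] subrepD(2)[OF V] subspace_add[OF is_repD(2)[OF M]]
    by (blast elim: set_plus_elim)
  moreover have "struct_map M i j w \<in> U j + V j" if ij: "i \<le> j" and w: "w \<in> U i + V i" for i j w
  proof -
    obtain u v where uv: "u \<in> U i" "v \<in> V i" "w = u + v" using w by (blast elim: set_plus_elim)
    then have "u \<in> space_at M i" "v \<in> space_at M i" using subrepD(2)[OF U] subrepD(2)[OF V] by auto
    then have "struct_map M i j w = struct_map M i j u + struct_map M i j v"
      using is_repD(3)[OF M ij] uv by (simp add: linear_between_def)
    then show ?thesis using subrepD(3)[OF U ij] subrepD(3)[OF V ij] uv by auto
  qed
  ultimately show ?thesis by (simp add: subrep_def)
qed

text \<open>Length is the sum of dimensions over the support of \<open>M\<close>. A strictly larger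
  subrepresentation is strictly larger at some index, and that index lies in the support, so the sum
  grows.\<close>

lemma subrep_subgroup_lattice:
  assumes M0: "is_rep0 s M"
  shows "subgroup_lattice (subrep_lattice s M) (subrep_len s M)"
proof -
  note M = is_rep0D(1)[OF M0]
  interpret vector_space s using is_repD(1)[OF M] .
  have zero: "0 \<in> U i" if "subrep s M U" for U i using subspace_0 subrepD(1)[OF that] by blast
  show ?thesis
  proof
    fix X assume "X \<in> subrep_lattice s M"
    then show "0 \<in> X" using zero by (auto simp: subrep_lattice_def sections_def)
  next
    fix X x y assume "X \<in> subrep_lattice s M" "x \<in> X" "y \<in> X"
    then obtain U where "subrep s M U" "X = sections U" "\<And>i. x i \<in> U i" "\<And>i. y i \<in> U i"
      by (auto simp: subrep_lattice_def sections_def)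
    then show "x - y \<in> X"
      using subspace_diff[OF subrepD(1)[OF \<open>subrep s M U\<close>]] by (simp add: sections_def)
  next
    have "subrep s M (\<lambda>_. {0})"
      using is_repD(6,8)[OF M] by (simp add: subrep_def)
    then show "{0} \<in> subrep_lattice s M" using sections_zero unfolding subrep_lattice_def by blast
  next
    fix X Y assume "X \<in> subrep_lattice s M" "Y \<in> subrep_lattice s M"
    then obtain U V where UV: "X = sections U" "Y = sections V" "subrep s M U" "subrep s M V"
      by (auto simp: subrep_lattice_def)
    have "subrep s M (\<lambda>i. U i \<inter> V i)"
      using UV(3,4) subspace_inter by (auto simp: subrep_def)
    then show "X \<inter> Y \<in> subrep_lattice s M"
      using UV sections_Int unfolding subrep_lattice_def by blast
    show "X + Y \<in> subrep_lattice s M"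
      using UV sections_plus subrep_plus[OF M] unfolding subrep_lattice_def by blast
    assume XY: "X \<subset> Y"
    have sub: "U i \<subseteq> V i" for i
      using XY sections_subset_iff[of U V] zero[OF UV(3)] UV by auto
    obtain i where i: "\<not> V i \<subseteq> U i"
      using XY sections_subset_iff[of V U] zero[OF UV(4)] UV by auto
    have fd: "fin_dim_space s (V i)" for i
      using fin_dim_space_subset[OF is_rep0D(2)[OF M0]] subrepD(1,2)[OF UV(4)] by blast
    have "space_at M i \<noteq> {0}" using i subrepD(2)[OF UV(4), of i] zero[OF UV(3), of i] by auto
    moreover have "dim (U i) < dim (V i)"
      using fin_dim_space_dim_strict_mono[OF fd subrepD(1)[OF UV(3)]] i sub by blast
    ultimately have "(\<Sum>i\<in>{i. space_at M i \<noteq> {0}}. dim (U i)) < (\<Sum>i\<in>{i. space_at M i \<noteq> {0}}. dim (V i))"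
      using fin_dim_space_dim_mono[OF fd subrepD(1)[OF UV(3)] sub] is_rep0D(3)[OF M0]
      by (intro sum_strict_mono_ex1) blast+
    then show "subrep_len s M X < subrep_len s M Y"
      using sections_eval[of U, OF zero[OF UV(3)]] sections_eval[of V, OF zero[OF UV(4)]] UV(1,2)
      by (simp add: subrep_len_def)
  qed
qed

text \<open>Passage from internal to external sums: \<open>indecomposable\<close> speaks of the
  latter, the lattice of the former.\<close>

lemma dsum_direct_sum_iso:
  assumes M: "is_rep s M" and A: "subrep s M A" and B: "subrep s M B"
    and T: "\<And>i. T i = A i + B i" and AB: "\<And>i. A i \<inter> B i = {0}"
  shows "rep_iso s (pointwise_scale s) (sub_rep M T) (direct_sum [sub_rep M A, sub_rep M B])"
proof -
  interpret vector_space s using is_repD(1)[OF M] .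
  let ?S = "direct_sum [sub_rep M A, sub_rep M B]"
  have S: "is_rep (pointwise_scale s) ?S"
    using sub_rep_is_rep[OF M] A B by (intro direct_sum_is_rep[OF is_repD(1)[OF M]]) auto
  have sp: "f \<in> space_at ?S i \<longleftrightarrow> f 0 \<in> A i \<and> f 1 \<in> B i \<and> (\<forall>k\<ge>2. f k = 0)" for f i
    by (auto simp: direct_sum_space power_space_def less_Suc_eq numeral_2_eq_2)
  have st: "struct_map ?S i j f k = (if k < 2 then struct_map M i j (f k) else 0)" for i j f k
    by (auto simp: direct_sum_map less_Suc_eq numeral_2_eq_2)
  let ?h = "\<lambda>i f. f 0 + f (1::nat)"
  have lin: "linear_between (pointwise_scale s) s (space_at ?S i) (T i) (?h i)" for i
    unfolding linear_between_def
  proof (intro conjI ballI allI)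
    show "?h i ` space_at ?S i \<subseteq> T i"
      unfolding T by (rule image_subsetI) (use sp in \<open>blast intro: set_plus_intro\<close>)
  qed (simp_all add: pointwise_scale_def scale_right_distrib ac_simps)
  have "rep_hom (pointwise_scale s) s ?S (sub_rep M T) ?h"
    unfolding rep_hom_def
  proof (intro conjI allI impI ballI)
    fix i j f assume ij: "i \<le> j" and f: "f \<in> space_at ?S i"
    then have "f 0 \<in> space_at M i" "f 1 \<in> space_at M i"
      using subrepD(2)[OF A] subrepD(2)[OF B] sp by auto
    then show "struct_map ?S i j f 0 + struct_map ?S i j f 1 = struct_map (sub_rep M T) i j (f 0 + f 1)"
      using is_repD(3)[OF M ij] by (simp add: st linear_between_def)
  qed (use lin in simp)
  moreover have "bij_betw (?h i) (space_at ?S i) (space_at (sub_rep M T) i)" for i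
  proof -
    interpret vector_space_pair "pointwise_scale s" s
      using is_rep_pair[OF S M] .
    have "f = 0" if f: "f \<in> space_at ?S i" "f 0 + f 1 = 0" for f
    proof -
      have "f 0 = - f 1" using f by (simp add: eq_neg_iff_add_eq_0)
      then have "f 0 \<in> A i \<inter> B i"
        using f(1) subspace_neg[OF subrepD(1)[OF B]] by (simp add: sp)
      then have "f 0 = 0" using AB by blast
      then have "f 1 = 0" using f by simp
      have "f k = 0" for k
      proof -
        consider "k = 0" | "k = 1" | "k \<ge> 2" by linarith
        then show ?thesis by cases (use \<open>f 0 = 0\<close> \<open>f 1 = 0\<close> f(1) in \<open>auto simp: sp\<close>)
      qed
      then show ?thesis by (simp add: fun_eq_iff)
    qed
    then have "inj_on (?h i) (space_at ?S i)"
      using linear_between_inj_on[OF lin is_repD(2)[OF S]] by blast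
    moreover have "T i \<subseteq> ?h i ` space_at ?S i"
    proof
      fix x assume "x \<in> T i"
      then obtain a b where ab: "a \<in> A i" "b \<in> B i" "x = a + b"
        using T by (auto elim: set_plus_elim)
      let ?f = "\<lambda>k. if k = 0 then a else if k = 1 then b else 0"
      have "?f \<in> space_at ?S i" using ab by (simp add: sp)
      from imageI[OF this, of "?h i"] show "x \<in> ?h i ` space_at ?S i" using ab by simp
    qed
    ultimately show ?thesis using lin[of i] by (auto simp: bij_betw_def linear_between_def)
  qed
  ultimately show ?thesis by (intro rep_iso_sym[OF rep_isoI[OF S]])
qed

text \<open>A splitting of the group of sections can be evaluated at every index and so is a
  splitting of representations, to which indecomposability applies.\<close>

lemma indecomposable_L_indec:
  assumes M0: "is_rep0 s M" and U: "subrep s M U" and ind: "indecomposable s (sub_rep M U)"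
  shows "subgroup_lattice.L_indec (subrep_lattice s M) (sections U)"
proof -
  note M = is_rep0D(1)[OF M0]
  interpret vector_space s using is_repD(1)[OF M] .
  interpret L: subgroup_lattice "subrep_lattice s M" "subrep_len s M"
    by (rule subrep_subgroup_lattice[OF M0])
  have zero: "0 \<in> V i" if "subrep s M V" for V i using subspace_0 subrepD(1)[OF that] by blast
  have iso0: "sections V = {0}" if V: "subrep s M V" "rep_iso s s (sub_rep M V) zero_rep" for V
  proof -
    have "V = (\<lambda>_. {0})"
      using rep_iso_zero_iff[OF sub_rep_is_rep[OF M V(1)]] V(2) by auto
    then show ?thesis using sections_zero by simp
  qed
  show ?thesis unfolding L.L_indec_def
  proof (intro conjI allI impI)
    show "sections U \<in> subrep_lattice s M" using U by (auto simp: subrep_lattice_def)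
    show "sections U \<noteq> {0}"
    proof
      assume "sections U = {0}"
      then have "U i = {0}" for i using sections_eval[of U i] zero[OF U] by simp
      then have "rep_iso s s (sub_rep M U) zero_rep"
        using rep_iso_zero_iff[OF sub_rep_is_rep[OF M U]] by simp
      then show False using ind by (simp add: indecomposable_def)
    qed
    fix X Y assume d: "L.dsum (sections U) X Y"
    obtain A B where AB: "X = sections A" "Y = sections B" "subrep s M A" "subrep s M B"
      using L.dsumD(1,2)[OF d] by (auto simp: subrep_lattice_def)
    have "0 \<in> A i + B i" for i using zero[OF AB(3), of i] zero[OF AB(4), of i] set_plus_intro[of 0 _ 0] by fastforce
    then have 1: "U i = A i + B i" for i
      using L.dsumD(3)[OF d] AB(1,2) sections_plus[of A B] sections_eval[of U i] zero[OF U]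
        sections_eval[of "\<lambda>i. A i + B i" i] by simp
    have 2: "A i \<inter> B i = {0}" for i
      using L.dsumD(4)[OF d] AB(1,2) sections_Int[of A B] zero[OF AB(3)] zero[OF AB(4)]
        sections_eval[of "\<lambda>i. A i \<inter> B i" i] by simp
    have "rep_iso s s (sub_rep M A) zero_rep \<or> rep_iso s s (sub_rep M B) zero_rep"
      using ind dsum_direct_sum_iso[OF M AB(3,4) 1 2] sub_rep_is_rep0[OF M0] AB(3,4)
      unfolding indecomposable_def by blast
    then show "X = {0} \<or> Y = {0}" using iso0 AB by blast
  qed
qed

text \<open>The summands are pulled back along the isomorphism into \<open>M\<close>. The given
  summands may have another ambient space, as spread representations do; after the pullback all
  decompositions live in one lattice.\<close>

lemma direct_sum_internal:
  assumes M0: "is_rep0 s M" and t: "vector_space t" and Ns: "\<And>N. N \<in> set Ns \<Longrightarrow> is_rep t N"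
    and iso: "rep_iso s (pointwise_scale t) M (direct_sum Ns)"
  obtains Us where "length Us = length Ns"
    "\<And>k. k < length Ns \<Longrightarrow> subrep s M (Us ! k) \<and> rep_iso s t (sub_rep M (Us ! k)) (Ns ! k)"
    "subgroup_lattice.idsum (subrep_lattice s M) (sections (space_at M)) (map sections Us)"
proof -
  note M = is_rep0D(1)[OF M0]
  let ?n = "length Ns"
  let ?S = "direct_sum Ns"
  have S: "is_rep (pointwise_scale t) ?S" using direct_sum_is_rep[OF t Ns] .
  interpret t: vector_space t by (fact t)
  interpret vector_space s using is_repD(1)[OF M] .
  interpret vector_space_pair s "pointwise_scale t" using is_rep_pair[OF M S] .
  interpret L: subgroup_lattice "subrep_lattice s M" "subrep_len s M"
    by (rule subrep_subgroup_lattice[OF M0])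
  have N: "is_rep t (Ns ! k)" if "k < ?n" for k using Ns that by simp
  obtain \<phi> where hom: "rep_hom s (pointwise_scale t) M ?S \<phi>"
    and bij: "\<And>i. bij_betw (\<phi> i) (space_at M i) (space_at ?S i)"
    using rep_isoE[OF iso] by blast
  note H = rep_homD[OF hom]
  have surj: "\<exists>v\<in>space_at M i. \<phi> i v = f" if "f \<in> space_at ?S i" for i f
    using bij[of i] that by (metis bij_betw_def imageE)
  have \<phi>_add: "\<phi> i (u + v) = \<phi> i u + \<phi> i v" if "u \<in> space_at M i" "v \<in> space_at M i" for i u v
    using H(1)[of i] that by (simp add: linear_between_def)
  have \<phi>_scale: "\<phi> i (s c u) k = t c (\<phi> i u k)" if "u \<in> space_at M i" for i c u k
    using H(1)[of i] that by (simp add: linear_between_def pointwise_scale_def)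
  have \<phi>_diff: "\<phi> i (u - v) = \<phi> i u - \<phi> i v" if "u \<in> space_at M i" "v \<in> space_at M i" for i u v
    using linear_between_diff[OF H(1) is_repD(2)[OF M]] that by blast
  have \<phi>_0: "\<phi> i 0 = 0" for i
    using linear_between_0[OF H(1) is_repD(2)[OF M]] .
  have \<phi>_eq_0: "v = 0" if "v \<in> space_at M i" "\<phi> i v = 0" for i v
    using bij[of i] that \<phi>_0 is_repD(6)[OF M, of i] unfolding bij_betw_def by (metis inj_onD)
  have \<phi>_space: "\<phi> i v k \<in> space_at (Ns ! k) i" if "v \<in> space_at M i" "k < ?n" for i v k
    using H(3)[OF that(1)] that by (simp add: direct_sum_space power_space_def)
  have \<phi>_out: "\<phi> i v k = 0" if "v \<in> space_at M i" "\<not> k < ?n" for i v k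
    using H(3)[OF that(1)] that by (simp add: direct_sum_space power_space_def)
  have \<phi>_map: "\<phi> j (struct_map M i j v) k = struct_map (Ns ! k) i j (\<phi> i v k)"
    if "i \<le> j" "v \<in> space_at M i" "k < ?n" for i j v k
    using H(2)[OF that(1,2)] that by (simp add: direct_sum_map)
  \<comment> \<open>The vectors with coordinates supported in \<open>K\<close>. Arbitrary sets
    \<open>K\<close> are allowed because the complements in \<open>idsum\<close> are the tails
    \<open>{m..<?n}\<close>.\<close>
  define V where "V K i = {v\<in>space_at M i. \<forall>k. k \<notin> K \<longrightarrow> \<phi> i v k = 0}" for K i
  have V_sub: "subrep s M (V K)" for K
  proof -
    have "subspace (V K i)" for i
      using subspace_0[OF is_repD(2)[OF M]] subspace_add[OF is_repD(2)[OF M]]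
        subspace_scale[OF is_repD(2)[OF M]] \<phi>_add \<phi>_scale \<phi>_0
      by (intro subspaceI) (auto simp: V_def)
    moreover have "struct_map M i j v \<in> V K j" if ij: "i \<le> j" and v: "v \<in> V K i" for i j v
    proof -
      have vM: "v \<in> space_at M i" using v by (simp add: V_def)
      then have jM: "struct_map M i j v \<in> space_at M j" using is_repD(7)[OF M ij] by blast
      moreover have "\<phi> j (struct_map M i j v) k = 0" if "k \<notin> K" for k
        using v that \<phi>_map[OF ij vM, of k] is_repD(8)[OF N ij, of k] \<phi>_out[OF jM, of k]
        by (cases "k < ?n") (auto simp: V_def)
      ultimately show ?thesis by (simp add: V_def)
    qed
    ultimately show ?thesis by (auto simp: subrep_def V_def)
  qed
  have V_L: "sections (V K) \<in> subrep_lattice s M" for K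
    using V_sub by (auto simp: subrep_lattice_def)
  have restrict: "\<exists>a\<in>V K i. v - a \<in> V K' i" if "K \<inter> K' = {}" "v \<in> V (K \<union> K') i" for K K' v i
  proof -
    have v: "v \<in> space_at M i" using that by (simp add: V_def)
    let ?f = "\<lambda>k. if k \<in> K then \<phi> i v k else 0"
    have "?f \<in> space_at ?S i"
      using \<phi>_space[OF v] \<phi>_out[OF v] is_repD(6)[OF N] by (auto simp: direct_sum_space power_space_def)
    then obtain a where a: "a \<in> space_at M i" "\<phi> i a = ?f" using surj by blast
    have "v - a \<in> space_at M i" using subspace_diff[OF is_repD(2)[OF M]] v a by blast
    then have "v - a \<in> V K' i" "a \<in> V K i"
      using a \<phi>_diff[OF v a(1)] that by (auto simp: V_def)
    then show ?thesis by blast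
  qed
  have V_dsum: "L.dsum (sections (V (K \<union> K'))) (sections (V K)) (sections (V K'))"
    if KK: "K \<inter> K' = {}" for K K'
  proof (rule L.dsumI)
    fix f assume "f \<in> sections (V (K \<union> K'))"
    then have "\<forall>i. \<exists>a\<in>V K i. f i - a \<in> V K' i" using restrict[OF KK] by (simp add: sections_def)
    then obtain a where "\<And>i. a i \<in> V K i \<and> f i - a i \<in> V K' i" by metis
    then show "\<exists>a\<in>sections (V K). f - a \<in> sections (V K')"
      by (intro bexI[of _ a]) (auto simp: sections_def)
  next
    fix f assume f: "f \<in> sections (V K)" "f \<in> sections (V K')"
    have "f i = 0" for i
    proof (rule \<phi>_eq_0)
      show "f i \<in> space_at M i" using f by (auto simp: sections_def V_def)
      show "\<phi> i (f i) = 0"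
      proof
        fix k
        have "k \<notin> K \<or> k \<notin> K'" using KK by blast
        then show "\<phi> i (f i) k = 0 k" using f by (auto simp: sections_def V_def)
      qed
    qed
    then show "f = 0" by (simp add: fun_eq_iff)
  qed (use V_L[of K] V_L[of K'] V_L[of "K \<union> K'"] in \<open>auto simp: sections_def V_def\<close>)
  have tails: "L.idsum (sections (V {m..<?n})) (map (\<lambda>k. sections (V {k})) [m..<?n])" if "m \<le> ?n" for m
    using that
  proof (induction m rule: inc_induct)
    case base
    have "V {} i = {0}" for i
      using \<phi>_eq_0 \<phi>_0 is_repD(6)[OF M] by (auto simp: V_def fun_eq_iff)
    then have "V {} = (\<lambda>_. {0})" by (simp add: fun_eq_iff)
    then show ?case using sections_zero by simp
  next
    case (step m)
    have "{m} \<union> {Suc m..<?n} = {m..<?n}" "{m} \<inter> {Suc m..<?n} = {}" using step by auto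
    then have "L.dsum (sections (V {m..<?n})) (sections (V {m})) (sections (V {Suc m..<?n}))"
      using V_dsum[of "{m}" "{Suc m..<?n}"] by simp
    moreover have "[m..<?n] = m # [Suc m..<?n]" using step by (simp add: upt_conv_Cons)
    ultimately show ?case using step.IH by auto
  qed
  have V_iso: "rep_iso s t (sub_rep M (V {k})) (Ns ! k)" if k: "k < ?n" for k
  proof (rule rep_isoI)
    show "is_rep s (sub_rep M (V {k}))" using sub_rep_is_rep[OF M V_sub] .
    show "rep_hom s t (sub_rep M (V {k})) (Ns ! k) (\<lambda>i v. \<phi> i v k)"
      using \<phi>_add \<phi>_scale \<phi>_space \<phi>_map k by (auto simp: rep_hom_def linear_between_def V_def)
    fix i
    have "inj_on (\<lambda>v. \<phi> i v k) (V {k} i)"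
    proof (rule inj_onI)
      fix u v assume uv: "u \<in> V {k} i" "v \<in> V {k} i" "\<phi> i u k = \<phi> i v k"
      then have "\<phi> i u l = \<phi> i v l" for l by (cases "l = k") (auto simp: V_def)
      then have "\<phi> i u = \<phi> i v" by (simp add: fun_eq_iff)
      then show "u = v" using uv bij[of i] by (auto simp: V_def bij_betw_def dest: inj_onD)
    qed
    moreover have "(\<lambda>v. \<phi> i v k) ` V {k} i = space_at (Ns ! k) i"
    proof
      show "space_at (Ns ! k) i \<subseteq> (\<lambda>v. \<phi> i v k) ` V {k} i"
      proof
        fix w assume "w \<in> space_at (Ns ! k) i"
        then have "(\<lambda>l. if l = k then w else 0) \<in> space_at ?S i"
          using k is_repD(6)[OF N] by (auto simp: direct_sum_space power_space_def)
        then obtain v where v: "v \<in> space_at M i" "\<phi> i v = (\<lambda>l. if l = k then w else 0)"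
          using surj by blast
        then have "v \<in> V {k} i" by (simp add: V_def)
        from imageI[OF this, of "\<lambda>v. \<phi> i v k"] show "w \<in> (\<lambda>v. \<phi> i v k) ` V {k} i" using v by simp
      qed
    qed (use \<phi>_space k in \<open>auto simp: V_def\<close>)
    ultimately show "bij_betw (\<lambda>v. \<phi> i v k) (space_at (sub_rep M (V {k})) i) (space_at (Ns ! k) i)"
      by (simp add: bij_betw_def)
  qed
  have "V {0..<?n} i = space_at M i" for i using \<phi>_out by (auto simp: V_def)
  then have V_all: "V {0..<?n} = space_at M" by (simp add: fun_eq_iff)
  show thesis
  proof (rule that[of "map (\<lambda>k. V {k}) [0..<?n]"])
    show "L.idsum (sections (space_at M)) (map sections (map (\<lambda>k. V {k}) [0..<?n]))"
      using tails[of 0] V_all by (simp add: comp_def)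
  qed (use V_sub V_iso in auto)
qed

section \<open>Bigraded modules by rows\<close>

text \<open>Each \<open>\<beta>\<close> below \<open>b\<close> is paired with the
  \<open>\<alpha>\<close> before it and each \<open>\<beta>\<close> from \<open>b\<close> on with
  the \<open>\<alpha>\<close> after it; only \<open>\<alpha> b\<close> stays unpaired. The last
  \<open>\<beta>\<close> would have no partner, whence \<open>\<beta> hi = 0\<close>.\<close>

lemma zigzag_identity:
  fixes \<alpha> \<beta> :: "int \<Rightarrow> int"
  assumes b: "lo \<le> b" "b \<le> hi" and \<beta>: "\<beta> hi = 0"
  shows "(\<Sum>q\<in>{lo..hi}. \<alpha> q - \<beta> q)
    = \<alpha> b + (\<Sum>q\<in>{lo..<b}. \<alpha> q - \<beta> q) + (\<Sum>q\<in>{b..<hi}. \<alpha> (q + 1) - \<beta> q)"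
proof -
  have 1: "{lo..hi} = {lo..<b} \<union> {b..hi}" "{lo..<b} \<inter> {b..hi} = {}" using b by auto
  have "(\<Sum>q\<in>{b..hi}. \<alpha> q) = \<alpha> b + (\<Sum>q\<in>{b+1..hi}. \<alpha> q)"
  proof -
    have "{b..hi} = insert b {b+1..hi}" using b by auto
    then show ?thesis by simp
  qed
  also have "(\<Sum>q\<in>{b+1..hi}. \<alpha> q) = (\<Sum>q\<in>{b..<hi}. \<alpha> (q + 1))"
    by (rule sum.reindex_bij_witness[where i = "\<lambda>q. q + 1" and j = "\<lambda>q. q - 1"]) auto
  finally have "(\<Sum>q\<in>{b..hi}. \<alpha> q) = \<alpha> b + (\<Sum>q\<in>{b..<hi}. \<alpha> (q + 1))" .
  moreover have "(\<Sum>q\<in>{b..hi}. \<beta> q) = (\<Sum>q\<in>{b..<hi}. \<beta> q)"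
  proof -
    have "{b..hi} = insert hi {b..<hi}" using b by auto
    then show ?thesis using \<beta> by simp
  qed
  ultimately show ?thesis
    unfolding 1(1) by (subst sum.union_disjoint) (auto simp: sum_subtractf 1(2)[simplified])
qed

lemma zigzag_le:
  fixes \<alpha> \<beta> :: "int \<Rightarrow> int"
  assumes b: "lo \<le> b" "b \<le> hi" and \<beta>: "\<beta> hi = 0"
    and le: "\<And>q. \<beta> q \<le> \<alpha> q" "\<And>q. \<beta> q \<le> \<alpha> (q + 1)"
  shows "\<alpha> b \<le> (\<Sum>q\<in>{lo..hi}. \<alpha> q - \<beta> q)"
proof -
  have "0 \<le> (\<Sum>q\<in>{lo..<b}. \<alpha> q - \<beta> q)" "0 \<le> (\<Sum>q\<in>{b..<hi}. \<alpha> (q + 1) - \<beta> q)"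
    using le by (auto intro!: sum_nonneg)
  then show ?thesis using zigzag_identity[of lo b hi \<beta> \<alpha>] b \<beta> by simp
qed

lemma zigzag_eq:
  fixes \<alpha> \<beta> :: "int \<Rightarrow> int"
  assumes b: "lo \<le> b" "b \<le> hi" and \<beta>: "\<beta> hi = 0"
    and le: "\<And>q. \<beta> q \<le> \<alpha> q" "\<And>q. \<beta> q \<le> \<alpha> (q + 1)"
    and eq: "\<alpha> b = (\<Sum>q\<in>{lo..hi}. \<alpha> q - \<beta> q)"
    and q: "lo \<le> q" "q < b"
  shows "\<beta> q = \<alpha> q"
proof -
  have 0: "0 \<le> (\<Sum>q\<in>{lo..<b}. \<alpha> q - \<beta> q)" "0 \<le> (\<Sum>q\<in>{b..<hi}. \<alpha> (q + 1) - \<beta> q)"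
    using le by (auto intro!: sum_nonneg)
  then have "(\<Sum>q\<in>{lo..<b}. \<alpha> q - \<beta> q) = 0"
    using zigzag_identity[of lo b hi \<beta> \<alpha>] b \<beta> eq by simp
  then have "\<forall>q\<in>{lo..<b}. \<alpha> q - \<beta> q = 0"
    using le(1) by (subst (asm) sum_nonneg_eq_0_iff) auto
  then show ?thesis using q by auto
qed

text \<open>Total 1 bounds every \<open>\<alpha>\<close> in range by 1. Choosing \<open>p'\<close>
  as the unpaired index forces \<open>\<beta> q = \<alpha> q\<close> below \<open>p'\<close>, and
  then the value 1 propagates upwards from \<open>p\<close>, since
  \<open>\<beta> q \<le> \<alpha> (q + 1) \<le> 1\<close>. It is applied to rows and to positions in
  a row.\<close>

lemma zigzag_one_interval:
  fixes \<alpha> \<beta> :: "int \<Rightarrow> int"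
  assumes \<beta>: "\<beta> hi = 0"
    and le: "\<And>q. \<beta> q \<le> \<alpha> q" "\<And>q. \<beta> q \<le> \<alpha> (q + 1)"
    and S: "(\<Sum>q\<in>{lo..hi}. \<alpha> q - \<beta> q) = 1"
    and ends: "lo \<le> p" "p' \<le> hi" "0 < \<alpha> p" "0 < \<alpha> p'" and q: "p \<le> q" "q \<le> p'"
  shows "\<alpha> q = 1 \<and> (q < p' \<longrightarrow> \<beta> q = 1)"
proof -
  have le1: "\<alpha> q \<le> 1" if "lo \<le> q" "q \<le> hi" for q
    using zigzag_le[of lo q hi \<beta> \<alpha>] that \<beta> le S by simp
  have p': "\<alpha> p' = 1" using le1[of p'] ends q by simp
  have "\<beta> q = \<alpha> q" if "lo \<le> q" "q < p'" for q
    using zigzag_eq[of lo p' hi \<beta> \<alpha> q] that \<beta> le S ends p' by simp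
  note \<beta>_eq = this
  have "p \<le> p'" using q by simp
  have "q \<le> p' \<longrightarrow> \<alpha> q = 1"
    using q(1)
  proof (induction q rule: int_ge_induct)
    case base
    then show ?case using le1[of p] ends \<open>p \<le> p'\<close> by simp
  next
    case (step q)
    show ?case
    proof
      assume "q + 1 \<le> p'"
      then have "\<beta> q = 1" using step \<beta>_eq[of q] ends by simp
      then show "\<alpha> (q + 1) = 1" using le(2)[of q] le1[of "q + 1"] ends step \<open>q + 1 \<le> p'\<close> by simp
    qed
  qed
  then show ?thesis using q ends \<beta>_eq[of q] by simp
qed

text \<open>Points minus adjacent pairs is the Euler characteristic of a path. With any point of
  \<open>E\<close> left unpaired, convexity makes all other terms of the zigzag identity
  vanish.\<close>

lemma interval_euler:
  fixes E :: "int set"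
  assumes E: "\<And>p p' q. p \<in> E \<Longrightarrow> p' \<in> E \<Longrightarrow> p \<le> q \<Longrightarrow> q \<le> p' \<Longrightarrow> q \<in> E"
    and sub: "E \<subseteq> {lo..<hi}"
  shows "(\<Sum>p\<in>{lo..hi}. (if p \<in> E then 1 else 0) - (if p \<in> E \<and> p + 1 \<in> E then 1 else 0))
    = (if E = {} then 0 else 1 :: int)"
proof (cases "E = {}")
  case False
  then obtain c where c: "c \<in> E" by blast
  let ?\<alpha> = "\<lambda>p. if p \<in> E then 1 else 0 :: int"
  let ?\<beta> = "\<lambda>p. if p \<in> E \<and> p + 1 \<in> E then 1 else 0 :: int"
  have "(\<Sum>q\<in>{lo..<c}. ?\<alpha> q - ?\<beta> q) = 0"
  proof (rule sum.neutral, rule ballI)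
    fix q assume "q \<in> {lo..<c}"
    then have "q \<in> E \<Longrightarrow> q + 1 \<in> E" using E[of q c "q + 1"] c by simp
    then show "?\<alpha> q - ?\<beta> q = 0" by simp
  qed
  moreover have "(\<Sum>q\<in>{c..<hi}. ?\<alpha> (q + 1) - ?\<beta> q) = 0"
  proof (rule sum.neutral, rule ballI)
    fix q assume "q \<in> {c..<hi}"
    then have "q + 1 \<in> E \<Longrightarrow> q \<in> E" using E[of c "q + 1" q] c by simp
    then show "?\<alpha> (q + 1) - ?\<beta> q = 0" by simp
  qed
  moreover have "lo \<le> c" "c \<le> hi" "?\<beta> hi = 0" using c sub by auto
  ultimately show ?thesis
    using zigzag_identity[of lo c hi ?\<beta> ?\<alpha>] c by auto
qed simp

text \<open>Serves to switch between counting right ends and counting left ends, and to move the row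
  count of an image from its target row to its source row.\<close>

lemma sum_int_shift:
  fixes f :: "int \<Rightarrow> int"
  assumes "f (lo - 1) = 0" "f hi = 0"
  shows "(\<Sum>p\<in>{lo..hi}. f (p - 1)) = (\<Sum>p\<in>{lo..hi}. f p)"
proof (cases "lo \<le> hi")
  case True
  have "(\<Sum>p\<in>{lo..hi}. f (p - 1)) = (\<Sum>p\<in>{lo-1..hi-1}. f p)"
    by (rule sum.reindex_bij_witness[where i = "\<lambda>q. q + 1" and j = "\<lambda>q. q - 1"]) auto
  also have "{lo-1..hi-1} = insert (lo - 1) {lo..hi-1}" using True by auto
  also have "(\<Sum>p\<in>insert (lo - 1) {lo..hi-1}. f p) = (\<Sum>p\<in>{lo..hi-1}. f p)" using assms by simp
  also have "\<dots> = (\<Sum>p\<in>insert hi {lo..hi-1}. f p)" using assms by simp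
  also have "insert hi {lo..hi-1} = {lo..hi}" using True by auto
  finally show ?thesis .
qed simp

text \<open>The third inequality is Sylvester's: the kernel of \<open>struct_map M j l\<close> on
  the image from \<open>i\<close> is contained in the whole kernel. Both comparisons of neighbouring
  rows are instances.\<close>

lemma rk_le:
  assumes M0: "is_rep0 s M" and ij: "i \<le> j" and jl: "j \<le> l"
  shows "rk s M i l \<le> rk s M i j" "rk s M i l \<le> rk s M j l"
    "rk s M i j + rk s M j l \<le> rk s M j j + rk s M i l"
proof -
  note M = is_rep0D(1)[OF M0]
  interpret vector_space s using is_repD(1)[OF M] .
  interpret vector_space_pair s s ..
  note R = is_repD[OF M]
  note fdM = is_rep0D(2)[OF M0]
  let ?f = "struct_map M j l"
  let ?V = "struct_map M i j ` space_at M i"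
  have lin: "linear_between s s (space_at M j) (space_at M l) ?f" by (rule R(3)[OF jl])
  have V: "fin_dim_space s ?V" "subspace ?V" "?V \<subseteq> space_at M j"
    using rank_nullity(2)[OF fdM R(3)[OF ij]] linear_between_subspace_image[OF R(3)[OF ij] R(2)]
      R(7)[OF ij] by auto
  have linV: "linear_between s s ?V (space_at M l) ?f"
    using linear_between_subset[OF lin V(3)] .
  have im: "struct_map M i l ` space_at M i = ?f ` ?V"
    using R(5)[OF ij jl] by (force simp: image_iff)
  have fdf: "fin_dim_space s (?f ` space_at M j)" using rank_nullity(2)[OF fdM lin] .
  show "rk s M i l \<le> rk s M i j"
    using rank_nullity(1)[OF V(1) linV] by (simp add: rk_def im)
  show "rk s M i l \<le> rk s M j l"
    unfolding rk_def im
    using fin_dim_space_dim_mono[OF fdf linear_between_subspace_image[OF linV V(2)]] V(3) by blast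
  have ker: "{v\<in>space_at M j. ?f v = 0} \<subseteq> space_at M j" "subspace {v\<in>space_at M j. ?f v = 0}"
      "subspace {v\<in>?V. ?f v = 0}"
    using linear_between_subspace_vimage[OF lin R(2) subspace_single_0]
      linear_between_subspace_vimage[OF linV V(2) subspace_single_0] by auto
  have "dim {v\<in>?V. ?f v = 0} \<le> dim {v\<in>space_at M j. ?f v = 0}"
    using fin_dim_space_dim_mono[OF fin_dim_space_subset[OF fdM ker(2,1)] ker(3)] V(3) by blast
  then show "rk s M i j + rk s M j l \<le> rk s M j j + rk s M i l"
    using rank_nullity(1)[OF V(1) linV] rank_nullity(1)[OF fdM lin]
    by (simp add: rk_refl[OF M]) (simp add: rk_def im)
qed

section \<open>Ranks and row counts of a fixed module\<close>

locale bigraded =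
  fixes s :: "'k::field \<Rightarrow> 'v::ab_group_add \<Rightarrow> 'v" and M :: "(int \<times> int, 'v) rep"
  assumes M0: "is_rep0 s M"
begin

lemma M: "is_rep s M" using is_rep0D(1)[OF M0] .

sublocale vector_space s using is_repD(1)[OF M] .

sublocale vector_space_pair s s ..

lemmas R = is_repD[OF M]
lemmas fdM = is_rep0D(2)[OF M0]

text \<open>Integers, so that differences are not truncated. For the \<open>y\<close>-image of row
  \<open>q\<close> the numbers \<open>e\<close> and \<open>t\<close> are the dimension and the
  horizontal rank, as \<open>d\<close> and \<open>r\<close> are for row \<open>q\<close>
  itself.\<close>

definition "d p q = int (rk s M (p, q) (p, q))"
definition "r p q = int (rk s M (p, q) (p + 1, q))"
definition "e p q = int (rk s M (p, q) (p, q + 1))"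
definition "t p q = int (rk s M (p, q) (p + 1, q + 1))"

lemmas rank_defs = d_def r_def e_def t_def

lemma rank_nonneg: "0 \<le> d p q" "0 \<le> r p q" "0 \<le> e p q" "0 \<le> t p q"
  by (auto simp: rank_defs)

lemma rank_le: "r p q \<le> d p q" "r p q \<le> d (p + 1) q" "e p q \<le> d p q" "e p q \<le> d p (q + 1)"
  "t p q \<le> e p q" "t p q \<le> r p (q + 1)" "t p q \<le> e (p + 1) q" "t p q \<le> d p q" "t p q \<le> r p q"
  using rk_le(1,2)[OF M0] by (auto simp: rank_defs)

text \<open>Compares kernels of \<open>x\<close> at column \<open>p\<close>: the image row is a
  subobject of row \<open>q + 1\<close>.\<close>

lemma rank_row: "e p q - t p q \<le> d p (q + 1) - r p (q + 1)"
  using rk_le(3)[OF M0, of "(p, q)" "(p, q + 1)" "(p + 1, q + 1)"] by (simp add: rank_defs)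

text \<open>Compares cokernels of \<open>x\<close> at column \<open>p\<close>: the image row is a
  quotient of row \<open>q\<close>.\<close>

lemma rank_row': "e p q - t (p - 1) q \<le> d p q - r (p - 1) q"
  using rk_le(3)[OF M0, of "(p - 1, q)" "(p, q)" "(p, q + 1)"] by (simp add: rank_defs)

lemma d_eq_dim: "d p q = int (dim (space_at M (p, q)))"
  by (simp add: d_def rk_refl[OF M])

lemma d_eq_0_iff: "d p q = 0 \<longleftrightarrow> space_at M (p, q) = {0}"
  using fin_dim_space_dim_eq_0_iff[OF fdM] by (simp add: d_eq_dim)

text \<open>One pair of bounds serves both coordinates. The strict upper bound keeps row and column
  \<open>hi\<close> empty, which yields the boundary condition of the zigzag lemmas.\<close>

lemma bounds_exist: "\<exists>lo hi. lo \<le> hi \<and> (\<forall>p q. d p q \<noteq> 0 \<longrightarrow> lo \<le> p \<and> p < hi \<and> lo \<le> q \<and> q < hi)"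
proof -
  let ?F = "{i. space_at M i \<noteq> {0}}"
  let ?G = "insert 0 (fst ` ?F \<union> snd ` ?F)"
  have fin: "finite ?G" using is_rep0D(3)[OF M0] by simp
  have "Min ?G \<le> p \<and> p < Max ?G + 1 \<and> Min ?G \<le> q \<and> q < Max ?G + 1" if "d p q \<noteq> 0" for p q
  proof -
    have "(p, q) \<in> ?F" using that d_eq_0_iff by simp
    then have "p \<in> ?G" "q \<in> ?G" by force+
    then have "Min ?G \<le> p" "p \<le> Max ?G" "Min ?G \<le> q" "q \<le> Max ?G"
      using Min_le[OF fin] Max_ge[OF fin] by blast+
    then show ?thesis by simp
  qed
  moreover have "Min ?G \<le> Max ?G + 1"
    using Min_le[OF fin, of 0] Max_ge[OF fin, of 0] by simp
  ultimately show ?thesis by blast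
qed

definition "bnds = (SOME (lo, hi). lo \<le> hi \<and> (\<forall>p q. d p q \<noteq> 0 \<longrightarrow> lo \<le> p \<and> p < hi \<and> lo \<le> q \<and> q < hi))"
definition "lo = fst bnds"
definition "hi = snd bnds"

lemma bounds: "lo \<le> hi" "d p q \<noteq> 0 \<Longrightarrow> lo \<le> p \<and> p < hi \<and> lo \<le> q \<and> q < hi"
proof -
  have "case bnds of (a, b) \<Rightarrow> a \<le> b \<and> (\<forall>p q. d p q \<noteq> 0 \<longrightarrow> a \<le> p \<and> p < b \<and> a \<le> q \<and> q < b)"
    unfolding bnds_def by (rule someI_ex) (use bounds_exist in auto)
  then show "lo \<le> hi" "d p q \<noteq> 0 \<Longrightarrow> lo \<le> p \<and> p < hi \<and> lo \<le> q \<and> q < hi"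
    by (auto simp: lo_def hi_def split: prod.splits)
qed

lemma d_out: "p < lo \<or> hi \<le> p \<or> q < lo \<or> hi \<le> q \<Longrightarrow> d p q = 0"
  using bounds(2)[of p q] by linarith

lemma rank_out: "d p q = 0 \<Longrightarrow> r p q = 0" "d p q = 0 \<Longrightarrow> e p q = 0" "d p q = 0 \<Longrightarrow> t p q = 0"
  using rank_le[of p q] rank_nonneg[of p q] by linarith+

definition "\<alpha> q = (\<Sum>p\<in>{lo..hi}. d p q - r p q)"
definition "\<beta> q = (\<Sum>p\<in>{lo..hi}. e p q - t p q)"

text \<open>The terms of the definition are kernel dimensions, located at right ends of bars; the
  terms here are cokernel dimensions, located at left ends.\<close>

lemma \<alpha>_shift: "\<alpha> q = (\<Sum>p\<in>{lo..hi}. d p q - r (p - 1) q)"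
  using sum_int_shift[of "\<lambda>p. r p q" lo hi] rank_out(1) d_out by (simp add: \<alpha>_def sum_subtractf)

lemma \<beta>_shift: "\<beta> q = (\<Sum>p\<in>{lo..hi}. e p q - t (p - 1) q)"
  using sum_int_shift[of "\<lambda>p. t p q" lo hi] rank_out(3) d_out by (simp add: \<beta>_def sum_subtractf)

text \<open>Both hold termwise: the first in the count by left ends, the second in the count by
  right ends.\<close>

lemma \<beta>_le: "\<beta> q \<le> \<alpha> q" "\<beta> q \<le> \<alpha> (q + 1)"
proof -
  show "\<beta> q \<le> \<alpha> q" unfolding \<alpha>_shift \<beta>_shift by (rule sum_mono) (rule rank_row')
  show "\<beta> q \<le> \<alpha> (q + 1)" unfolding \<alpha>_def \<beta>_def by (rule sum_mono) (rule rank_row)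
qed

lemma \<beta>_hi: "\<beta> hi = 0"
  using rank_out d_out[of _ hi] by (simp add: \<beta>_def)

lemma \<alpha>_out: "q < lo \<or> hi \<le> q \<Longrightarrow> \<alpha> q = 0"
  using rank_out d_out[of _ q] by (simp add: \<alpha>_def)

text \<open>Images are graded by target, so the image of row \<open>q - 1\<close> first appears in
  row \<open>q\<close>. Emptiness of the rows \<open>lo - 1\<close> and \<open>hi\<close> permits
  the shift back.\<close>

lemma N_two_rows: "N_two s M = (\<Sum>q\<in>{lo..hi}. \<alpha> q - \<beta> q)"
proof -
  have "{i. space_at M i \<noteq> {0}} \<subseteq> {lo..hi} \<times> {lo..hi}"
    using bounds(2) d_eq_0_iff by force
  then have "N_two s M = (\<Sum>i\<in>{lo..hi} \<times> {lo..hi}. N_at s M i)"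
    using N_two_eq_sum[OF M0] by simp
  also have "\<dots> = (\<Sum>p\<in>{lo..hi}. \<Sum>q\<in>{lo..hi}. N_at s M (p, q))"
    by (simp add: sum.cartesian_product)
  also have "\<dots> = (\<Sum>q\<in>{lo..hi}. \<Sum>p\<in>{lo..hi}. N_at s M (p, q))" by (rule sum.swap)
  also have "\<dots> = (\<Sum>q\<in>{lo..hi}. \<alpha> q - \<beta> (q - 1))"
  proof (rule sum.cong[OF refl])
    fix q
    have "N_at s M (p, q) = (d p q - r (p - 1) q) - (e p (q - 1) - t (p - 1) (q - 1))" for p
      by (simp add: N_at_def rank_defs)
    then show "(\<Sum>p\<in>{lo..hi}. N_at s M (p, q)) = \<alpha> q - \<beta> (q - 1)"
      by (simp add: \<alpha>_shift \<beta>_shift sum_subtractf)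
  qed
  also have "\<dots> = (\<Sum>q\<in>{lo..hi}. \<alpha> q - \<beta> q)"
  proof -
    have "\<beta> (lo - 1) = 0" using rank_out d_out[of _ "lo - 1"] by (simp add: \<beta>_def)
    then show ?thesis using sum_int_shift[of \<beta> lo hi] \<beta>_hi by (simp add: sum_subtractf)
  qed
  finally show ?thesis .
qed

lemma d_le_\<alpha>: "d p q \<le> \<alpha> q"
proof (cases "lo \<le> p \<and> p \<le> hi")
  case True
  then show ?thesis
    unfolding \<alpha>_def
    using zigzag_le[of lo p hi "\<lambda>p. r p q" "\<lambda>p. d p q"] rank_le rank_out(1) d_out by simp
next
  case False
  then have "d p q = 0" using d_out by auto
  moreover have "d lo q \<le> \<alpha> q"
    unfolding \<alpha>_def
    using zigzag_le[of lo lo hi "\<lambda>p. r p q" "\<lambda>p. d p q"] bounds(1) rank_le rank_out(1) d_out by simp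
  ultimately show ?thesis using rank_nonneg(1)[of lo q] by simp
qed

lemma \<alpha>_le_N_two: "\<alpha> q \<le> N_two s M"
proof (cases "lo \<le> q \<and> q \<le> hi")
  case True
  then show ?thesis
    unfolding N_two_rows using zigzag_le[of lo q hi \<beta> \<alpha>] \<beta>_le \<beta>_hi by simp
next
  case False
  then have "\<alpha> q = 0" using \<alpha>_out by auto
  moreover have "\<alpha> lo \<le> N_two s M"
    unfolding N_two_rows using zigzag_le[of lo lo hi \<beta> \<alpha>] \<beta>_le \<beta>_hi bounds(1) by simp
  ultimately show ?thesis using d_le_\<alpha>[of lo lo] rank_nonneg(1)[of lo lo] by simp
qed

lemma dim_le_N_two: "int (dim (space_at M i)) \<le> N_two s M"
  using d_le_\<alpha>[of "fst i" "snd i"] \<alpha>_le_N_two[of "snd i"] by (simp add: d_eq_dim)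

lemma N_two_nonneg: "0 \<le> N_two s M"
  using dim_le_N_two by (meson of_nat_0_le_iff order_trans)

lemma N_two_eq_0_iff: "N_two s M = 0 \<longleftrightarrow> (\<forall>i. space_at M i = {0})"
proof
  assume "N_two s M = 0"
  then have "dim (space_at M i) = 0" for i using dim_le_N_two[of i] by simp
  then show "\<forall>i. space_at M i = {0}" using fin_dim_space_dim_eq_0_iff[OF fdM] by simp
next
  assume "\<forall>i. space_at M i = {0}"
  then show "N_two s M = 0" using N_two_eq_sum[OF M0, of "{}"] by simp
qed

end

section \<open>Modules with invariant one\<close>

locale bigraded_one = bigraded +
  assumes N1: "N_two s M = 1"
begin

definition "I = {i. space_at M i \<noteq> {0}}"

lemma I_iff: "(p, q) \<in> I \<longleftrightarrow> d p q \<noteq> 0"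
  by (simp add: I_def d_eq_0_iff)

lemma d_one: "(p, q) \<in> I \<Longrightarrow> d p q = 1"
  using d_le_\<alpha>[of p q] \<alpha>_le_N_two[of q] rank_nonneg(1)[of p q] N1 I_iff by force

lemma dim_one: "i \<in> I \<Longrightarrow> dim (space_at M i) = 1"
  using d_one[of "fst i" "snd i"] by (simp add: d_eq_dim)

lemma \<alpha>_pos_iff: "0 < \<alpha> q \<longleftrightarrow> (\<exists>p. (p, q) \<in> I)"
proof
  assume "0 < \<alpha> q"
  show "\<exists>p. (p, q) \<in> I"
  proof (rule ccontr)
    assume "\<not> ?thesis"
    then have "\<alpha> q = 0" using I_iff rank_out(1) by (simp add: \<alpha>_def)
    then show False using \<open>0 < \<alpha> q\<close> by simp
  qed
next
  assume "\<exists>p. (p, q) \<in> I"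
  then obtain p where "(p, q) \<in> I" by blast
  then show "0 < \<alpha> q" using d_one[of p q] d_le_\<alpha>[of p q] by simp
qed

lemma \<alpha>_one: "(p, q) \<in> I \<Longrightarrow> \<alpha> q = 1"
  using \<alpha>_pos_iff[of q] \<alpha>_le_N_two[of q] N1 by force

lemma row_range:
  assumes "0 < \<alpha> q" "0 < \<alpha> q'" "q \<le> x" "x \<le> q'"
  shows "\<alpha> x = 1 \<and> (x < q' \<longrightarrow> \<beta> x = 1)"
proof (rule zigzag_one_interval[where lo = lo and hi = hi])
  show "(\<Sum>q\<in>{lo..hi}. \<alpha> q - \<beta> q) = 1" using N_two_rows N1 by simp
  show "lo \<le> q" "q' \<le> hi" using \<alpha>_out[of q] \<alpha>_out[of q'] assms by linarith+
qed (use assms \<beta>_hi \<beta>_le in auto)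

text \<open>The argument for the set of rows, repeated horizontally with \<open>d\<close> and
  \<open>r\<close>; a row with \<open>\<alpha> q = 1\<close> has total 1.\<close>

lemma row_interval:
  assumes "(p, q) \<in> I" "(p', q) \<in> I" "p \<le> x" "x \<le> p'"
  shows "(x, q) \<in> I" "x < p' \<Longrightarrow> r x q = 1"
proof -
  have "d x q = 1 \<and> (x < p' \<longrightarrow> r x q = 1)"
  proof (rule zigzag_one_interval[where lo = lo and hi = hi])
    show "(\<Sum>p\<in>{lo..hi}. d p q - r p q) = 1" using \<alpha>_one[OF assms(1)] by (simp add: \<alpha>_def)
    show "r hi q = 0" using rank_out d_out by simp
    show "lo \<le> p" "p' \<le> hi" using bounds(2) I_iff assms by force+
  qed (use assms rank_le d_one in auto)
  then show "(x, q) \<in> I" "x < p' \<Longrightarrow> r x q = 1" by (auto simp: I_iff)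
qed

text \<open>Surjectivity is followed instead of bijectivity because it composes and has the
  cancellation law \<open>onto_cancel\<close>. Between one-dimensional spaces it implies
  injectivity, which is recovered in \<open>struct_inj\<close>.\<close>

definition "onto i j \<longleftrightarrow> struct_map M i j ` space_at M i = space_at M j"

lemma onto_rank:
  assumes "i \<le> j" "dim (space_at M j) \<le> rk s M i j"
  shows "onto i j"
  unfolding onto_def
  by (rule fin_dim_space_eq[OF fdM linear_between_subspace_image[OF R(3)[OF assms(1)] R(2)]])
    (use R(7)[OF assms(1)] assms(2) in \<open>auto simp: rk_def\<close>)

lemma rep_image_comp:
  assumes "i \<le> j" "j \<le> l"
  shows "struct_map M j l ` struct_map M i j ` space_at M i = struct_map M i l ` space_at M i"
  using R(5)[OF assms] by (force simp: image_image image_iff)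

lemma onto_trans:
  assumes "i \<le> j" "j \<le> l" "onto i j" "onto j l"
  shows "onto i l"
  using rep_image_comp[OF assms(1,2)] assms(3,4) by (simp add: onto_def)

lemma onto_refl: "onto i i"
  using R(4)[of _ i] by (force simp: onto_def image_iff)

lemma onto_cancel:
  assumes "i \<le> j" "j \<le> l" "onto i l"
  shows "onto j l"
proof -
  have "struct_map M i j ` space_at M i \<subseteq> space_at M j" using R(7)[OF assms(1)] by blast
  then have "space_at M l \<subseteq> struct_map M j l ` space_at M j"
    using rep_image_comp[OF assms(1,2)] assms(3) image_mono unfolding onto_def by metis
  moreover have "struct_map M j l ` space_at M j \<subseteq> space_at M l" using R(7)[OF assms(2)] by blast
  ultimately show ?thesis unfolding onto_def by blast
qed

lemma onto_row:
  assumes "(p, q) \<in> I" "(p', q) \<in> I" "p \<le> p'"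
  shows "onto (p, q) (p', q)"
proof -
  have "x \<le> p' \<longrightarrow> onto (p, q) (x, q)" if "p \<le> x" for x
    using that
  proof (induction x rule: int_ge_induct)
    case base
    then show ?case using onto_refl by simp
  next
    case (step x)
    show ?case
    proof
      assume x: "x + 1 \<le> p'"
      then have "r x q = 1" "(x + 1, q) \<in> I"
        using row_interval[OF assms(1,2), of x] row_interval[OF assms(1,2), of "x + 1"] step by auto
      then have "onto (x, q) (x + 1, q)"
        using dim_one[of "(x + 1, q)"] by (intro onto_rank) (auto simp: r_def)
      then show "onto (p, q) (x + 1, q)"
        using onto_trans[of "(p, q)" "(x, q)" "(x + 1, q)"] step x by simp
    qed
  qed
  then show ?thesis using assms by simp
qed

lemma onto_step: "e p q = 1 \<Longrightarrow> (p, q + 1) \<in> I \<and> onto (p, q) (p, q + 1)"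
proof -
  assume "e p q = 1"
  then have "(p, q + 1) \<in> I" using rank_le(4)[of p q] by (simp add: I_iff)
  moreover have "onto (p, q) (p, q + 1)"
    using dim_one[OF calculation] \<open>e p q = 1\<close> by (intro onto_rank) (auto simp: e_def)
  ultimately show ?thesis by blast
qed

lemma row_finite: "finite {p. (p, q) \<in> I}"
  by (rule finite_subset[of _ "{lo..hi}"]) (use bounds(2) I_iff in force)+

text \<open>\<open>\<alpha> q = \<beta> q\<close> makes the count by left ends agree in every
  column. At the leftmost point of row \<open>q\<close> the previous column contributes nothing, so
  \<open>e l q = d l q = 1\<close>: this point survives into row \<open>q + 1\<close>.\<close>

lemma left_end:
  assumes "0 < \<alpha> q" "0 < \<alpha> (q + 1)"
  obtains l where "(l, q) \<in> I" "(l, q + 1) \<in> I" "onto (l, q) (l, q + 1)"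
    "\<And>p. (p, q) \<in> I \<Longrightarrow> l \<le> p"
proof -
  let ?P = "{p. (p, q) \<in> I}"
  define l where "l = Min ?P"
  have "?P \<noteq> {}" using assms(1) \<alpha>_pos_iff by blast
  then have l: "(l, q) \<in> I" "\<And>p. (p, q) \<in> I \<Longrightarrow> l \<le> p"
    using Min_in[OF row_finite] Min_le[OF row_finite] by (auto simp: l_def)
  have "\<alpha> q = \<beta> q" using row_range[OF assms, of q] by simp
  then have "(\<Sum>p\<in>{lo..hi}. (d p q - r (p - 1) q) - (e p q - t (p - 1) q)) = 0"
    unfolding \<alpha>_shift \<beta>_shift by (simp add: sum_subtractf)
  then have "\<forall>p\<in>{lo..hi}. (d p q - r (p - 1) q) - (e p q - t (p - 1) q) = 0"
    using rank_row' by (subst (asm) sum_nonneg_eq_0_iff) auto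
  moreover have "l \<in> {lo..hi}" using bounds(2)[of l q] l(1) I_iff by simp
  ultimately have "d l q - r (l - 1) q = e l q - t (l - 1) q" by simp
  moreover have "d (l - 1) q = 0" using l(2)[of "l - 1"] I_iff by fastforce
  ultimately have "e l q = 1" using rank_out[of "l - 1" q] d_one[OF l(1)] by simp
  then show thesis using that l onto_step by blast
qed

text \<open>Dual to \<open>left_end\<close>: \<open>\<alpha> (q + 1) = \<beta> q\<close>, read in
  the count by right ends at the rightmost point of row \<open>q + 1\<close>, shows that this point
  is reached from row \<open>q\<close>.\<close>

lemma right_end:
  assumes "0 < \<alpha> q" "0 < \<alpha> (q + 1)"
  obtains l where "(l, q) \<in> I" "(l, q + 1) \<in> I" "\<And>p. (p, q + 1) \<in> I \<Longrightarrow> p \<le> l"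
proof -
  let ?P = "{p. (p, q + 1) \<in> I}"
  define l where "l = Max ?P"
  have "?P \<noteq> {}" using assms(2) \<alpha>_pos_iff by blast
  then have l: "(l, q + 1) \<in> I" "\<And>p. (p, q + 1) \<in> I \<Longrightarrow> p \<le> l"
    using Max_in[OF row_finite] Max_ge[OF row_finite] by (auto simp: l_def)
  have "\<alpha> (q + 1) = \<beta> q" using row_range[OF assms, of q] row_range[OF assms, of "q + 1"] by simp
  then have "(\<Sum>p\<in>{lo..hi}. (d p (q + 1) - r p (q + 1)) - (e p q - t p q)) = 0"
    unfolding \<alpha>_def \<beta>_def by (simp add: sum_subtractf)
  then have "\<forall>p\<in>{lo..hi}. (d p (q + 1) - r p (q + 1)) - (e p q - t p q) = 0"
    using rank_row by (subst (asm) sum_nonneg_eq_0_iff) auto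
  moreover have "l \<in> {lo..hi}" using bounds(2)[of l "q + 1"] l(1) I_iff by simp
  ultimately have "d l (q + 1) - r l (q + 1) = e l q - t l q" by simp
  moreover have "d (l + 1) (q + 1) = 0" using l(2)[of "l + 1"] I_iff by fastforce
  then have "r l (q + 1) = 0" "t l q = 0"
    using rank_le(2)[of l "q + 1"] rank_le(6)[of l q] rank_nonneg(2)[of l "q + 1"]
      rank_nonneg(4)[of l q] by linarith+
  ultimately have "e l q = 1" using d_one[OF l(1)] by simp
  then have "(l, q) \<in> I" using rank_le(3)[of l q] by (simp add: I_iff)
  then show thesis using that l by blast
qed

text \<open>Iterates \<open>left_end\<close> upwards: the left end of each row also belongs to the
  next one, so left ends can only move to the left.\<close>

lemma rows_left:
  assumes "(p, q) \<in> I" "0 < \<alpha> q'" "q \<le> q'"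
  shows "\<exists>x\<le>p. (x, q') \<in> I"
proof -
  have "y \<le> q' \<longrightarrow> (\<exists>x\<le>p. (x, y) \<in> I)" if "q \<le> y" for y
    using that
  proof (induction y rule: int_ge_induct)
    case base
    then show ?case using assms by blast
  next
    case (step y)
    show ?case
    proof
      assume y: "y + 1 \<le> q'"
      then obtain x where x: "x \<le> p" "(x, y) \<in> I" using step by auto
      have "0 < \<alpha> q" using assms(1) \<alpha>_pos_iff by blast
      then have "0 < \<alpha> y" "0 < \<alpha> (y + 1)"
        using row_range[of q q' y] row_range[of q q' "y + 1"] assms step y by auto
      then obtain l where "(l, y + 1) \<in> I" "l \<le> x" using left_end x(2) by metis
      then show "\<exists>x\<le>p. (x, y + 1) \<in> I" using x order_trans by blast
    qed
  qed
  then show ?thesis using assms by blast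
qed

text \<open>Iterates \<open>right_end\<close> downwards: right ends can only move to the right on
  the way down.\<close>

lemma rows_right:
  assumes "(p, q) \<in> I" "0 < \<alpha> q'" "q' \<le> q"
  shows "\<exists>x\<ge>p. (x, q') \<in> I"
proof -
  have "q' \<le> y \<longrightarrow> (\<exists>x\<ge>p. (x, y) \<in> I)" if "y \<le> q" for y
    using that
  proof (induction y rule: int_le_induct)
    case base
    then show ?case using assms by blast
  next
    case (step y)
    show ?case
    proof
      assume y: "q' \<le> y - 1"
      then obtain x where x: "x \<ge> p" "(x, y) \<in> I" using step by auto
      have "0 < \<alpha> q" using assms(1) \<alpha>_pos_iff by blast
      then have "0 < \<alpha> (y - 1)" "0 < \<alpha> (y - 1 + 1)"
        using row_range[of q' q y] row_range[of q' q "y - 1"] assms step y by auto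
      then obtain l where "(l, y - 1) \<in> I" "x \<le> l" using right_end x(2) by (metis diff_add_cancel)
      then show "\<exists>x\<ge>p. (x, y - 1) \<in> I" using x order_trans by blast
    qed
  qed
  then show ?thesis using assms by blast
qed

text \<open>Row \<open>y\<close> has a point left of \<open>p\<close>, reached upwards from
  \<open>(p, q)\<close>, and a point right of \<open>p'\<close>, reached downwards from
  \<open>(p', q')\<close>; as rows are intervals, \<open>x\<close> lies in between.\<close>

lemma convex:
  assumes "(p, q) \<in> I" "(p', q') \<in> I" "p \<le> x" "x \<le> p'" "q \<le> y" "y \<le> q'"
  shows "(x, y) \<in> I"
proof -
  have "0 < \<alpha> q" "0 < \<alpha> q'" using assms \<alpha>_pos_iff by blast+
  then have "0 < \<alpha> y" using row_range[of q q' y] assms by simp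
  then obtain a b where "a \<le> p" "(a, y) \<in> I" "b \<ge> p'" "(b, y) \<in> I"
    using rows_left[OF assms(1)] rows_right[OF assms(2)] assms by blast
  then show ?thesis using row_interval(1)[of a y b x] assms by simp
qed

lemma poset_convex_I: "poset_convex I"
  unfolding poset_convex_def
proof (intro ballI allI impI)
  fix x z y assume "x \<in> I" "z \<in> I" "x \<le> y" "y \<le> z"
  then show "y \<in> I"
    using convex[of "fst x" "snd x" "fst z" "snd z" "fst y" "snd y"] by (simp add: less_eq_prod_def)
qed

text \<open>A priori only the vertical map at the left end \<open>l\<close> is known to be onto. Up
  at \<open>l\<close> and then right along row \<open>q + 1\<close> is onto; this composite also
  factors through \<open>(p, q)\<close>, so cancellation leaves the vertical map at
  \<open>p\<close>.\<close>

lemma onto_up: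
  assumes "(p, q) \<in> I" "(p, q + 1) \<in> I"
  shows "onto (p, q) (p, q + 1)"
proof -
  have "0 < \<alpha> q" "0 < \<alpha> (q + 1)" using assms \<alpha>_pos_iff by blast+
  then obtain l where l: "(l, q) \<in> I" "(l, q + 1) \<in> I" "onto (l, q) (l, q + 1)" "l \<le> p"
    using left_end assms(1) by metis
  have "onto (l, q + 1) (p, q + 1)" using onto_row l assms by blast
  then have "onto (l, q) (p, q + 1)"
    using onto_trans[of "(l, q)" "(l, q + 1)" "(p, q + 1)"] l by simp
  then show ?thesis using onto_cancel[of "(l, q)" "(p, q)" "(p, q + 1)"] l by simp
qed

lemma onto_column:
  assumes "(p, q) \<in> I" "(p, q') \<in> I" "q \<le> q'"
  shows "onto (p, q) (p, q')"
proof -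
  have "x \<le> q' \<longrightarrow> onto (p, q) (p, x)" if "q \<le> x" for x
    using that
  proof (induction x rule: int_ge_induct)
    case base
    then show ?case using onto_refl by simp
  next
    case (step x)
    show ?case
    proof
      assume x: "x + 1 \<le> q'"
      then have "(p, x) \<in> I" "(p, x + 1) \<in> I" using convex[OF assms(1,2)] step by auto
      then show "onto (p, q) (p, x + 1)"
        using onto_trans[of "(p, q)" "(p, x)" "(p, x + 1)"] onto_up step x by simp
    qed
  qed
  then show ?thesis using assms by simp
qed

lemma onto_I:
  assumes "i \<in> I" "j \<in> I" "i \<le> j"
  shows "onto i j"
proof -
  obtain p q p' q' where ij: "i = (p, q)" "j = (p', q')" by fastforce
  then have le: "p \<le> p'" "q \<le> q'" using assms by auto
  \<comment> \<open>The upper left corner, which is in the support by convexity, splits the map into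
    a column part and a row part.\<close>
  then have "(p, q') \<in> I" using convex[of p q p' q' p q'] assms ij by simp
  then show ?thesis
    using onto_trans[of "(p, q)" "(p, q')" "(p', q')"] onto_column onto_row assms ij le by simp
qed

lemma struct_inj:
  assumes "i \<in> I" "j \<in> I" "i \<le> j"
  shows "inj_on (struct_map M i j) (space_at M i)"
proof (rule linear_between_inj_on[OF R(3)[OF assms(3)] R(2)])
  have "dim {u \<in> space_at M i. struct_map M i j u = 0} = 0"
  proof -
    have "dim (struct_map M i j ` space_at M i) = 1"
      using onto_I[OF assms] dim_one[OF assms(2)] unfolding onto_def by metis
    then show ?thesis using rank_nullity(1)[OF fdM R(3)[OF assms(3)]] dim_one[OF assms(1)] by linarith
  qed
  moreover have "fin_dim_space s {u \<in> space_at M i. struct_map M i j u = 0}"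
    using linear_between_subspace_vimage[OF R(3)[OF assms(3)] R(2) subspace_single_0]
    by (intro fin_dim_space_subset[OF fdM]) auto
  ultimately have "{u \<in> space_at M i. struct_map M i j u = 0} = {0}"
    using fin_dim_space_dim_eq_0_iff by blast
  then show "u = 0" if "u \<in> space_at M i" "struct_map M i j u = 0" for u
    using that by blast
qed

lemma struct_nonzero:
  assumes "i \<in> I" "j \<in> I" "i \<le> j" "v \<in> space_at M i" "v \<noteq> 0"
  shows "struct_map M i j v \<noteq> 0"
  using inj_onD[OF struct_inj[OF assms(1,2,3)] _ assms(4) R(6)] R(8)[OF assms(3)] assms(5) by metis

lemma struct_preimage:
  assumes "i \<in> I" "j \<in> I" "i \<le> j" "w \<in> space_at M j"
  shows "\<exists>v\<in>space_at M i. struct_map M i j v = w"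
  using onto_I[OF assms(1,2,3)] assms(4) unfolding onto_def by (metis imageE)

lemma I_nonempty: "I \<noteq> {}"
proof
  assume "I = {}"
  then have "N_two s M = 0" using N_two_eq_0_iff by (auto simp: I_def)
  then show False using N1 by simp
qed

text \<open>A row is a chain, and the left end of a row is joined to the point above it. Induction
  on height connects a point to all points in higher rows; symmetry does the rest.\<close>

lemma poset_connected_I: "poset_connected I"
proof -
  let ?R = "{(a, b). a \<in> I \<and> b \<in> I \<and> (a \<le> b \<or> b \<le> a)}"
  have sym: "(y, x) \<in> ?R\<^sup>*" if "(x, y) \<in> ?R\<^sup>*" for x y
  proof -
    have "(y, x) \<in> (?R\<inverse>)\<^sup>*" using that by (rule rtrancl_converseI)
    moreover have "?R\<inverse> = ?R" by auto
    ultimately show ?thesis by simp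
  qed
  have row: "((p, q), (p', q)) \<in> ?R\<^sup>*" if "(p, q) \<in> I" "(p', q) \<in> I" for p p' q
    using that by (intro r_into_rtrancl) auto
  have up: "y \<le> q' \<longrightarrow> (\<forall>x. (x, y) \<in> I \<longrightarrow> ((p, q), (x, y)) \<in> ?R\<^sup>*)"
    if "q \<le> y" and p: "(p, q) \<in> I" "0 < \<alpha> q'" for p q q' y
    using that(1)
  proof (induction y rule: int_ge_induct)
    case base
    then show ?case using row p by blast
  next
    case (step y)
    show ?case
    proof (intro impI allI)
      fix x assume y: "y + 1 \<le> q'" and x: "(x, y + 1) \<in> I"
      have "0 < \<alpha> q" "0 < \<alpha> (y + 1)" using p x \<alpha>_pos_iff by blast+
      moreover from this have "0 < \<alpha> y" using row_range[of q "y + 1" y] step by simp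
      ultimately obtain l where l: "(l, y) \<in> I" "(l, y + 1) \<in> I" using left_end by metis
      have "((p, q), (l, y)) \<in> ?R\<^sup>*" using step y l by auto
      also have "((l, y), (l, y + 1)) \<in> ?R\<^sup>*" using l by (intro r_into_rtrancl) auto
      also have "((l, y + 1), (x, y + 1)) \<in> ?R\<^sup>*" using row l x by blast
      finally show "((p, q), (x, y + 1)) \<in> ?R\<^sup>*" .
    qed
  qed
  have "(x, y) \<in> ?R\<^sup>*" if "x \<in> I" "y \<in> I" "snd x \<le> snd y" for x y
  proof -
    obtain p q p' q' where xy: "x = (p, q)" "y = (p', q')" by fastforce
    then have "0 < \<alpha> q'" using that \<alpha>_pos_iff by blast
    then show ?thesis using up[of q q' p q'] that xy by simp
  qed
  note le = this
  have "(x, y) \<in> ?R\<^sup>*" if "x \<in> I" "y \<in> I" for x y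
  proof (cases "snd x \<le> snd y")
    case True
    then show ?thesis using le that by simp
  next
    case False
    then have "(y, x) \<in> ?R\<^sup>*" using le that by simp
    then show ?thesis by (rule sym)
  qed
  then show ?thesis unfolding poset_connected_def by simp
qed

section \<open>A compatible choice of basis vectors\<close>

lemma row_family:
  assumes l: "(l, q) \<in> I" and w: "w \<in> space_at M (l, q)" "w \<noteq> 0"
  obtains v where "\<And>p. (p, q) \<in> I \<Longrightarrow> v p \<in> space_at M (p, q) \<and> v p \<noteq> 0"
    "\<And>p. (p, q) \<in> I \<Longrightarrow> l \<le> p \<Longrightarrow> v p = struct_map M (l, q) (p, q) w"
    "\<And>p p'. (p, q) \<in> I \<Longrightarrow> (p', q) \<in> I \<Longrightarrow> p \<le> p' \<Longrightarrow> struct_map M (p, q) (p', q) (v p) = v p'"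
proof -
  \<comment> \<open>The vector \<open>w\<close> at the base point is pushed to the right and lifted
    to the left; at \<open>p = l\<close> the two prescriptions agree.\<close>
  have "\<exists>v\<in>space_at M (p, q). (l \<le> p \<longrightarrow> v = struct_map M (l, q) (p, q) w) \<and>
      (p \<le> l \<longrightarrow> struct_map M (p, q) (l, q) v = w)" if p: "(p, q) \<in> I" for p
  proof (cases "p \<le> l")
    case True
    then obtain v where v: "v \<in> space_at M (p, q)" "struct_map M (p, q) (l, q) v = w"
      using struct_preimage[OF p l _ w(1)] by auto
    have "v = struct_map M (l, q) (p, q) w" if "l \<le> p"
    proof -
      have "p = l" using that True by simp
      then show ?thesis using v R(4) w by auto
    qed
    then show ?thesis using v by blast
  next
    case False
    then show ?thesis using R(7)[of "(l, q)" "(p, q)" w] w by auto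
  qed
  then obtain v where v: "\<And>p. (p, q) \<in> I \<Longrightarrow> v p \<in> space_at M (p, q)"
    "\<And>p. (p, q) \<in> I \<Longrightarrow> l \<le> p \<Longrightarrow> v p = struct_map M (l, q) (p, q) w"
    "\<And>p. (p, q) \<in> I \<Longrightarrow> p \<le> l \<Longrightarrow> struct_map M (p, q) (l, q) (v p) = w"
    by metis
  have nz: "v p \<noteq> 0" if p: "(p, q) \<in> I" for p
  proof (cases "p \<le> l")
    case True
    then show ?thesis using v(3)[OF p] w R(8)[of "(p, q)" "(l, q)"] by auto
  next
    case False
    then show ?thesis using v(2)[OF p] struct_nonzero[OF l p _ w] by simp
  qed
  have "struct_map M (p, q) (p', q) (v p) = v p'" if p: "(p, q) \<in> I" "(p', q) \<in> I" "p \<le> p'" for p p'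
  proof -
    consider "l \<le> p" | "p \<le> l" "l \<le> p'" | "p' \<le> l" by linarith
    then show ?thesis
    proof cases
      case 1
      then show ?thesis using v(2)[OF p(1)] v(2)[OF p(2)] p(3) w R(5)[of "(l, q)" "(p, q)" "(p', q)" w]
        by simp
    next
      case 2
      then show ?thesis
        using v(3)[OF p(1)] v(2)[OF p(2)] v(1)[OF p(1)] R(5)[of "(p, q)" "(l, q)" "(p', q)" "v p"]
        by simp
    next
      case 3
      \<comment> \<open>Both points are left of the base point, so the two candidates are compared
        after mapping to \<open>(l, q)\<close>, which is injective.\<close>
      let ?u = "struct_map M (p, q) (p', q) (v p)"
      have "?u \<in> space_at M (p', q)" using R(7) v(1)[OF p(1)] p(3) by simp
      moreover have "struct_map M (p', q) (l, q) ?u = struct_map M (p', q) (l, q) (v p')"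
        using R(5)[of "(p, q)" "(p', q)" "(l, q)" "v p"] v(1)[OF p(1)] v(3)[OF p(1)] v(3)[OF p(2)] p(3) 3
        by simp
      ultimately show ?thesis
        using inj_onD[OF struct_inj[OF p(2) l]] v(1)[OF p(2)] 3 by simp
    qed
  qed
  then show thesis using that v nz by blast
qed

text \<open>A basis of every one-dimensional space respected by all structure maps, which is what an
  isomorphism with a spread representation amounts to. On a general poset the scalars accumulated
  around a cycle can obstruct such a choice; here it is built row by row.\<close>

definition "coherent J b \<longleftrightarrow> (\<forall>i\<in>J. b i \<in> space_at M i \<and> b i \<noteq> 0) \<and>
  (\<forall>i\<in>J. \<forall>j\<in>J. i \<le> j \<longrightarrow> struct_map M i j (b i) = b j)"

lemma coherent_extend_row:
  assumes b: "coherent {i\<in>I. snd i \<le> q} b"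
  obtains b' where "coherent {i\<in>I. snd i \<le> q + 1} b'"
proof (cases "0 < \<alpha> (q + 1)")
  case False
  then have "{i\<in>I. snd i \<le> q + 1} = {i\<in>I. snd i \<le> q}"
    using \<alpha>_pos_iff[of "q + 1"] by (auto simp: le_less)
  then show thesis using that b by simp
next
  case new: True
  then obtain p1 where p1: "(p1, q + 1) \<in> I" using \<alpha>_pos_iff by blast
  \<comment> \<open>The base point of the new row sits above the left end of row \<open>q\<close>, if that row is non-empty;
    then every point of the new row lying above an old point is to the right of the base point.\<close>
  have "\<exists>l w. (l, q + 1) \<in> I \<and> w \<in> space_at M (l, q + 1) \<and> w \<noteq> 0 \<and>
      (\<forall>p. (p, q) \<in> I \<longrightarrow> l \<le> p \<and> (l, q) \<in> I \<and> w = struct_map M (l, q) (l, q + 1) (b (l, q)))"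
  proof (cases "0 < \<alpha> q")
    case True
    then obtain l where l: "(l, q) \<in> I" "(l, q + 1) \<in> I" "\<And>p. (p, q) \<in> I \<Longrightarrow> l \<le> p"
      using left_end new by metis
    let ?w = "struct_map M (l, q) (l, q + 1) (b (l, q))"
    have "b (l, q) \<in> space_at M (l, q)" "b (l, q) \<noteq> 0" using b l by (auto simp: coherent_def)
    then have "?w \<in> space_at M (l, q + 1)" "?w \<noteq> 0"
      using R(7) struct_nonzero[OF l(1,2)] by auto
    then show ?thesis using l by blast
  next
    case False
    obtain w where "w \<in> space_at M (p1, q + 1)" "w \<noteq> 0"
      using p1 R(6)[of "(p1, q + 1)"] by (auto simp: I_def)
    then show ?thesis using p1 False \<alpha>_pos_iff by blast
  qed
  then obtain l w where l: "(l, q + 1) \<in> I" and w: "w \<in> space_at M (l, q + 1)" "w \<noteq> 0"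
    and old: "\<And>p. (p, q) \<in> I \<Longrightarrow> l \<le> p" "\<And>p. (p, q) \<in> I \<Longrightarrow> (l, q) \<in> I"
      "\<And>p. (p, q) \<in> I \<Longrightarrow> w = struct_map M (l, q) (l, q + 1) (b (l, q))" by blast
  obtain v where v: "\<And>p. (p, q + 1) \<in> I \<Longrightarrow> v p \<in> space_at M (p, q + 1) \<and> v p \<noteq> 0"
    "\<And>p. (p, q + 1) \<in> I \<Longrightarrow> l \<le> p \<Longrightarrow> v p = struct_map M (l, q + 1) (p, q + 1) w"
    "\<And>p p'. (p, q + 1) \<in> I \<Longrightarrow> (p', q + 1) \<in> I \<Longrightarrow> p \<le> p' \<Longrightarrow>
      struct_map M (p, q + 1) (p', q + 1) (v p) = v p'"
    using row_family[OF l w] by blast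
  define b' where "b' i = (if snd i \<le> q then b i else v (fst i))" for i
  have b_mem: "b i \<in> space_at M i" "b i \<noteq> 0" if "i \<in> I" "snd i \<le> q" for i
    using b that unfolding coherent_def by blast+
  have b_map: "struct_map M i j (b i) = b j" if "i \<in> I" "snd i \<le> q" "j \<in> I" "snd j \<le> q" "i \<le> j" for i j
    using b that unfolding coherent_def by blast+
  have "coherent {i\<in>I. snd i \<le> q + 1} b'"
    unfolding coherent_def
  proof (intro conjI ballI impI)
    fix i assume i: "i \<in> {i\<in>I. snd i \<le> q + 1}"
    have "b' i \<in> space_at M i \<and> b' i \<noteq> 0"
    proof (cases "snd i \<le> q")
      case True
      then show ?thesis using i b_mem by (simp add: b'_def)
    next
      case False
      then have "i = (fst i, q + 1)" using i by (simp add: prod_eq_iff)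
      then show ?thesis using i v(1)[of "fst i"] False by (metis b'_def mem_Collect_eq)
    qed
    then show "b' i \<in> space_at M i" "b' i \<noteq> 0" by auto
  next
    fix i j assume i: "i \<in> {i\<in>I. snd i \<le> q + 1}" and j: "j \<in> {i\<in>I. snd i \<le> q + 1}" and ij: "i \<le> j"
    obtain p q1 p' q2 where pq: "i = (p, q1)" "j = (p', q2)" by fastforce
    have le: "p \<le> p'" "q1 \<le> q2" using ij pq by auto
    have I: "(p, q1) \<in> I" "(p', q2) \<in> I" using i j pq by auto
    consider "q2 \<le> q" | "q1 = q + 1" "q2 = q + 1" | "q1 \<le> q" "q2 = q + 1"
      using i j pq le by fastforce
    then show "struct_map M i j (b' i) = b' j"
    proof cases
      case 1
      then show ?thesis using b_map[of i j] i j ij pq le by (simp add: b'_def)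
    next
      case 2
      then show ?thesis using v(3)[of p p'] I le pq by (simp add: b'_def)
    next
      case 3
      \<comment> \<open>The map from an old point to the new row factors through
        \<open>(p, q)\<close>, present by convexity and to the right of \<open>(l, q)\<close>. Both
        sides are therefore images of \<open>b (l, q)\<close>.\<close>
      have pqI: "(p, q) \<in> I" using convex[OF I, of p q] le 3 by simp
      note lp = old(1)[OF pqI] and lq = old(2)[OF pqI]
      have "b (p, q) = struct_map M (p, q1) (p, q) (b (p, q1))"
        using b_map[of "(p, q1)" "(p, q)"] I pqI 3 by simp
      then have 1: "struct_map M i j (b i) = struct_map M (p, q) (p', q + 1) (b (p, q))"
        using R(5)[of "(p, q1)" "(p, q)" "(p', q + 1)" "b (p, q1)"] b_mem[of "(p, q1)"] I le 3 pq
        by simp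
      have "b (p, q) = struct_map M (l, q) (p, q) (b (l, q))"
        using b_map[of "(l, q)" "(p, q)"] pqI lq lp by simp
      then have 2: "struct_map M (p, q) (p', q + 1) (b (p, q)) = struct_map M (l, q) (p', q + 1) (b (l, q))"
        using R(5)[of "(l, q)" "(p, q)" "(p', q + 1)" "b (l, q)"] b_mem[of "(l, q)"] lq lp le by simp
      have "v p' = struct_map M (l, q + 1) (p', q + 1) w"
        using v(2)[of p'] I 3 lp le by simp
      also have "\<dots> = struct_map M (l, q) (p', q + 1) (b (l, q))"
        using R(5)[of "(l, q)" "(l, q + 1)" "(p', q + 1)" "b (l, q)"] b_mem[of "(l, q)"] lq lp le
          old(3)[OF pqI] by simp
      finally show ?thesis using 1 2 3 pq by (simp add: b'_def)
    qed
  qed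
  then show thesis by (rule that)
qed

lemma coherent_exists: "\<exists>b. coherent I b"
proof -
  have "\<exists>b. coherent {i\<in>I. snd i \<le> q} b" if "lo - 1 \<le> q" for q
    using that
  proof (induction q rule: int_ge_induct)
    case base
    have "{i\<in>I. snd i \<le> lo - 1} = {}" using bounds(2) I_iff by force
    then have "coherent {i\<in>I. snd i \<le> lo - 1} b" for b unfolding coherent_def by blast
    then show ?case by blast
  next
    case (step q)
    then obtain b where "coherent {i\<in>I. snd i \<le> q} b" by blast
    then show ?case by (rule coherent_extend_row) blast
  qed
  note this[of hi]
  moreover have "lo - 1 \<le> hi" using bounds(1) by simp
  moreover have "{i\<in>I. snd i \<le> hi} = I" using bounds(2) I_iff by force
  ultimately show ?thesis by simp
qed

lemma iso_spread_rep: "rep_iso s (*) M (spread_rep I)"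
proof -
  obtain b where coh: "coherent I b" using coherent_exists by blast
  have b: "\<And>i. i \<in> I \<Longrightarrow> b i \<in> space_at M i" "\<And>i. i \<in> I \<Longrightarrow> b i \<noteq> 0"
    "\<And>i j. i \<in> I \<Longrightarrow> j \<in> I \<Longrightarrow> i \<le> j \<Longrightarrow> struct_map M i j (b i) = b j"
    using coh unfolding coherent_def by blast+
  have out: "space_at M i = {0}" if "i \<notin> I" for i using that by (simp add: I_def)
  have ex: "\<exists>!c. v = s c (b i)" if "i \<in> I" "v \<in> space_at M i" for i v
    using dim_one_space[OF fdM dim_one[OF that(1)] b(1,2)[OF that(1)] that(2)] b(2)[OF that(1)]
    by (auto simp: scale_cancel_right)
  \<comment> \<open>The coordinate with respect to \<open>b i\<close>; outside the support both
    spaces are zero and 0 is the value.\<close>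
  define \<phi> where "\<phi> i v = (if i \<in> I then THE c. v = s c (b i) else 0)" for i v
  have \<phi>: "v = s (\<phi> i v) (b i)" if "i \<in> I" "v \<in> space_at M i" for i v
    using theI'[OF ex[OF that]] that(1) by (simp add: \<phi>_def)
  have \<phi>_eq: "\<phi> i (s c (b i)) = c" if "i \<in> I" for i c
    using \<phi>[OF that subspace_scale[OF R(2) b(1)[OF that]], of c] b(2)[OF that]
    by (simp add: scale_cancel_right)
  have hom: "rep_hom s (*) M (spread_rep I) \<phi>"
    unfolding rep_hom_def linear_between_def
  proof (intro conjI allI ballI impI)
    fix i
    show "\<phi> i ` space_at M i \<subseteq> space_at (spread_rep I) i"
      by (auto simp: spread_rep_def \<phi>_def)
    fix u v assume uv: "u \<in> space_at M i" "v \<in> space_at M i"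
    show "\<phi> i (u + v) = \<phi> i u + \<phi> i v"
    proof (cases "i \<in> I")
      case True
      then have "u + v = s (\<phi> i u + \<phi> i v) (b i)"
        using \<phi> uv by (metis scale_left_distrib)
      then show ?thesis using \<phi>_eq[OF True] by simp
    qed (simp add: \<phi>_def)
  next
    fix i c u assume u: "u \<in> space_at M i"
    show "\<phi> i (s c u) = c * \<phi> i u"
    proof (cases "i \<in> I")
      case True
      then have "s c u = s (c * \<phi> i u) (b i)" using \<phi> u by (metis scale_scale)
      then show ?thesis using \<phi>_eq[OF True] by simp
    qed (simp add: \<phi>_def)
  next
    fix i j u assume ij: "i \<le> j" and u: "u \<in> space_at M i"
    show "\<phi> j (struct_map M i j u) = struct_map (spread_rep I) i j (\<phi> i u)"
    proof (cases "i \<in> I \<and> j \<in> I")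
      case True
      then have "struct_map M i j (s (\<phi> i u) (b i)) = s (\<phi> i u) (b j)"
        using R(3)[OF ij] b ij by (simp add: linear_between_def)
      then have "struct_map M i j u = s (\<phi> i u) (b j)" using \<phi> u True by metis
      then show ?thesis using \<phi>_eq[of j] True by (simp add: spread_rep_def)
    next
      case False
      have "struct_map M i j u = 0"
      proof (cases "i \<in> I")
        case True
        then have "space_at M j = {0}" using False out by blast
        then show ?thesis using R(7)[OF ij u] by blast
      next
        case False
        then have "u = 0" using out u by blast
        then show ?thesis using R(8)[OF ij] by simp
      qed
      moreover have "\<phi> j 0 = 0" using \<phi>_eq[of j 0] by (cases "j \<in> I") (auto simp: \<phi>_def)
      ultimately show ?thesis using False by (auto simp: spread_rep_def)
    qed
  qed
  show ?thesis
  proof (rule rep_isoI[OF M hom])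
    fix i
    show "bij_betw (\<phi> i) (space_at M i) (space_at (spread_rep I) i)"
    proof (cases "i \<in> I")
      case True
      have "inj_on (\<phi> i) (space_at M i)"
      proof (rule inj_onI)
        fix u v assume uv: "u \<in> space_at M i" "v \<in> space_at M i" "\<phi> i u = \<phi> i v"
        show "u = v" using \<phi>[OF True uv(1)] \<phi>[OF True uv(2)] uv(3) by simp
      qed
      moreover have "c \<in> \<phi> i ` space_at M i" for c
        using \<phi>_eq[OF True, of c] subspace_scale[OF R(2) b(1)[OF True], of c] by (metis imageI)
      ultimately show ?thesis using True by (auto simp: bij_betw_def spread_rep_def)
    next
      case False
      then show ?thesis using out[OF False] by (simp add: bij_betw_def spread_rep_def \<phi>_def)
    qed
  qed
qed

lemma iso_to_spread: "iso_to_spread_rep s M"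
  using I_nonempty poset_connected_I poset_convex_I iso_spread_rep
  by (auto simp: iso_to_spread_rep_def spread_def)

end

section \<open>Spread representations\<close>

lemma vector_space_field: "vector_space ((*) :: 'k::field \<Rightarrow> 'k \<Rightarrow> 'k)"
  by standard (simp_all add: algebra_simps)

lemma dim_field: "vector_space.dim ((*) :: 'k::field \<Rightarrow> 'k \<Rightarrow> 'k) UNIV = 1"
  and fin_dim_space_field: "fin_dim_space ((*) :: 'k::field \<Rightarrow> 'k \<Rightarrow> 'k) UNIV"
proof -
  interpret vector_space "(*) :: 'k \<Rightarrow> 'k \<Rightarrow> 'k" by (rule vector_space_field)
  have "span {1::'k} = UNIV"
  proof -
    have "x \<in> range (\<lambda>k. k * 1)" for x :: 'k by simp
    then show ?thesis unfolding span_singleton by blast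
  qed
  then show "dim UNIV = 1" "fin_dim_space ((*) :: 'k \<Rightarrow> 'k \<Rightarrow> 'k) UNIV"
    using dim_span_eq_card_independent[of "{1}"] unfolding fin_dim_space_def
    by (auto intro: exI[of _ "{1}"])
qed

lemma spread_rep_is_rep:
  assumes "poset_convex I"
  shows "is_rep (*) (spread_rep I :: ('p::order, 'k::field) rep)"
proof -
  interpret vector_space "(*) :: 'k \<Rightarrow> 'k \<Rightarrow> 'k" by (rule vector_space_field)
  have "j \<in> I" if "i \<le> j" "j \<le> l" "i \<in> I" "l \<in> I" for i j l
    using assms that unfolding poset_convex_def by blast
  then show ?thesis
    using vector_space_field unfolding is_rep_def linear_between_def
    by (auto simp: spread_rep_def)
qed

lemma spread_rep_is_rep0:
  assumes "poset_convex I" "finite I"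
  shows "is_rep0 (*) (spread_rep I :: ('p::order, 'k::field) rep)"
proof -
  interpret vector_space "(*) :: 'k \<Rightarrow> 'k \<Rightarrow> 'k" by (rule vector_space_field)
  have "{i. space_at (spread_rep I :: ('p, 'k) rep) i \<noteq> {0}} \<subseteq> I"
    by (auto simp: spread_rep_def)
  then have "finite {i. space_at (spread_rep I :: ('p, 'k) rep) i \<noteq> {0}}"
    using assms(2) finite_subset by blast
  then show ?thesis
    using spread_rep_is_rep[OF assms(1), where 'k = 'k] fin_dim_space_field[where 'k = 'k]
      fin_dim_space_zero
    by (simp add: is_rep0_iff) (simp add: spread_rep_def)
qed

lemma spread_rep_support:
  "{i. space_at (spread_rep I :: ('p::order, 'k::field) rep) i \<noteq> {0}} = I"
proof -
  have "(1::'k) \<notin> {0}" by simp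
  then have "(UNIV :: 'k set) \<noteq> {0}" by blast
  then show ?thesis by (auto simp: spread_rep_def)
qed

lemma spread_rep_rk:
  "rk (*) (spread_rep I :: ('p::order, 'k::field) rep) i j = (if i \<in> I \<and> j \<in> I then 1 else 0)"
proof -
  interpret vector_space "(*) :: 'k \<Rightarrow> 'k \<Rightarrow> 'k" by (rule vector_space_field)
  have "struct_map (spread_rep I :: ('p, 'k) rep) i j ` space_at (spread_rep I) i
      = (if i \<in> I \<and> j \<in> I then UNIV else {0})"
    by (auto simp: spread_rep_def image_iff)
  then show ?thesis using dim_field[where 'k = 'k] by (simp add: rk_def)
qed

text \<open>A path of comparabilities from height at most \<open>q\<close> to height above
  \<open>q\<close> has a step \<open>a \<le> b\<close> that crosses. The two points of column
  \<open>fst a\<close> at heights \<open>q\<close> and \<open>q + 1\<close> lie between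
  \<open>a\<close> and \<open>b\<close>, hence in \<open>I\<close> by convexity.\<close>

lemma spread_crossing:
  fixes I :: "(int \<times> int) set"
  assumes conn: "poset_connected I" and conv: "poset_convex I"
    and xy: "x \<in> I" "y \<in> I" "snd x \<le> q" "q < snd y"
  shows "\<exists>p. (p, q) \<in> I \<and> (p, q + 1) \<in> I"
proof (rule ccontr)
  assume no: "\<not> ?thesis"
  let ?R = "{(a, b). a \<in> I \<and> b \<in> I \<and> (a \<le> b \<or> b \<le> a)}"
  have "(x, y) \<in> ?R\<^sup>*" using conn xy unfolding poset_connected_def by blast
  then have "snd y \<le> q"
  proof (induction rule: rtrancl_induct)
    case base
    then show ?case using xy by simp
  next
    case (step a b)
    then have ab: "a \<in> I" "b \<in> I" "a \<le> b \<or> b \<le> a" by auto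
    show ?case
    proof (rule ccontr)
      assume "\<not> snd b \<le> q"
      then have "snd a \<le> q" "q + 1 \<le> snd b" using step by auto
      then have "a \<le> b" using ab by (auto simp: less_eq_prod_def)
      have "(fst a, q) \<in> I"
      proof -
        have "a \<le> (fst a, q)" "(fst a, q) \<le> b"
          using \<open>a \<le> b\<close> \<open>snd a \<le> q\<close> \<open>q + 1 \<le> snd b\<close> by (auto simp: less_eq_prod_def)
        then show ?thesis using conv ab(1,2) unfolding poset_convex_def by blast
      qed
      moreover have "(fst a, q + 1) \<in> I"
      proof -
        have "a \<le> (fst a, q + 1)" "(fst a, q + 1) \<le> b"
          using \<open>a \<le> b\<close> \<open>snd a \<le> q\<close> \<open>q + 1 \<le> snd b\<close> by (auto simp: less_eq_prod_def)
        then show ?thesis using conv ab(1,2) unfolding poset_convex_def by blast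
      qed
      ultimately show False using no by blast
    qed
  qed
  then show False using xy by simp
qed

text \<open>The Euler characteristic of an interval is used three times: for each row, for the
  overlap of consecutive rows, and for the set \<open>Q\<close> of occupied rows.\<close>

lemma N_two_spread_rep:
  fixes I :: "(int \<times> int) set"
  assumes I: "spread I" "finite I"
  shows "N_two (*) (spread_rep I :: (int \<times> int, 'k::field) rep) = 1"
proof -
  have conn: "poset_connected I" and conv: "poset_convex I" and ne: "I \<noteq> {}"
    using I by (auto simp: spread_def)
  interpret bigraded "(*) :: 'k \<Rightarrow> 'k \<Rightarrow> 'k" "spread_rep I :: (int \<times> int, 'k) rep"
    by (rule bigraded.intro[OF spread_rep_is_rep0[OF conv I(2)]])
  have between: "y \<in> I" if "x \<in> I" "z \<in> I" "x \<le> y" "y \<le> z" for x y z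
    using conv that unfolding poset_convex_def by blast
  have dd: "d p q = (if (p, q) \<in> I then 1 else 0)"
    and rr: "r p q = (if (p, q) \<in> I \<and> (p + 1, q) \<in> I then 1 else 0)"
    and ee: "e p q = (if (p, q) \<in> I \<and> (p, q + 1) \<in> I then 1 else 0)"
    and tt: "t p q = (if (p, q) \<in> I \<and> (p + 1, q + 1) \<in> I then 1 else 0)" for p q
    by (simp_all add: rank_defs spread_rep_rk)
  have bd: "lo \<le> p \<and> p < hi \<and> lo \<le> q \<and> q < hi" if "(p, q) \<in> I" for p q
    using bounds(2)[of p q] that dd by simp
  define Q where "Q = snd ` I"
  have Q: "q \<in> Q \<longleftrightarrow> (\<exists>p. (p, q) \<in> I)" for q by (force simp: Q_def)
  have \<alpha>: "\<alpha> q = (if q \<in> Q then 1 else 0)" for q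
  proof -
    let ?E = "{p. (p, q) \<in> I}"
    have "\<alpha> q = (\<Sum>p\<in>{lo..hi}. (if p \<in> ?E then 1 else 0) - (if p \<in> ?E \<and> p + 1 \<in> ?E then 1 else 0))"
      by (simp add: \<alpha>_def dd rr)
    also have "\<dots> = (if ?E = {} then 0 else 1)"
    proof (rule interval_euler)
      fix p p' x assume "p \<in> ?E" "p' \<in> ?E" "p \<le> x" "x \<le> p'"
      then show "x \<in> ?E" using between[of "(p, q)" "(p', q)" "(x, q)"] by simp
    qed (use bd in auto)
    finally show ?thesis using Q by auto
  qed
  have cross: "\<exists>p. (p, q) \<in> I \<and> (p, q + 1) \<in> I" if ab: "a \<in> Q" "b \<in> Q" "a \<le> q" "q < b" for a b q
  proof -
    obtain x y where "(x, a) \<in> I" "(y, b) \<in> I" using ab Q by blast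
    then show ?thesis using spread_crossing[OF conn conv, of "(x, a)" "(y, b)" q] ab by simp
  qed
  have \<beta>: "\<beta> q = (if q \<in> Q \<and> q + 1 \<in> Q then 1 else 0)" for q
  proof -
    let ?E = "{p. (p, q) \<in> I \<and> (p, q + 1) \<in> I}"
    \<comment> \<open>By convexity the diagonal corners force the other two, so \<open>t\<close>
      counts the adjacent pairs in the overlap of the two rows.\<close>
    have "(p, q) \<in> I \<and> (p + 1, q + 1) \<in> I \<longleftrightarrow> p \<in> ?E \<and> p + 1 \<in> ?E" for p
      using between[of "(p, q)" "(p + 1, q + 1)" "(p, q + 1)"]
        between[of "(p, q)" "(p + 1, q + 1)" "(p + 1, q)"] by auto
    then have "\<beta> q = (\<Sum>p\<in>{lo..hi}. (if p \<in> ?E then 1 else 0) - (if p \<in> ?E \<and> p + 1 \<in> ?E then 1 else 0))"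
      unfolding \<beta>_def by (intro sum.cong) (simp_all add: ee tt)
    also have "\<dots> = (if ?E = {} then 0 else 1)"
    proof (rule interval_euler)
      fix p p' x assume "p \<in> ?E" "p' \<in> ?E" "p \<le> x" "x \<le> p'"
      then show "x \<in> ?E"
        using between[of "(p, q)" "(p', q)" "(x, q)"] between[of "(p, q + 1)" "(p', q + 1)" "(x, q + 1)"]
        by simp
    qed (use bd in auto)
    \<comment> \<open>Consecutive occupied rows overlap; connectedness enters here through
      \<open>cross\<close>.\<close>
    also have "?E = {} \<longleftrightarrow> \<not> (q \<in> Q \<and> q + 1 \<in> Q)"
      using cross[of q "q + 1" q] Q by fastforce
    finally show ?thesis by auto
  qed
  have "N_two (*) (spread_rep I :: (int \<times> int, 'k) rep)
      = (\<Sum>q\<in>{lo..hi}. (if q \<in> Q then 1 else 0) - (if q \<in> Q \<and> q + 1 \<in> Q then 1 else 0))"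
    unfolding N_two_rows \<alpha> \<beta> ..
  also have "\<dots> = (if Q = {} then 0 else 1)"
  proof (rule interval_euler)
    fix a b q assume q: "a \<in> Q" "b \<in> Q" "a \<le> q" "q \<le> b"
    show "q \<in> Q"
    proof (cases "q = b")
      case False
      then show ?thesis using cross[of a b q] q Q by auto
    qed (use q in simp)
  qed (use bd Q in auto)
  finally show ?thesis using ne by (simp add: Q_def)
qed

section \<open>Decompositions into indecomposables\<close>

lemma rep_iso_direct_sum_Nil:
  fixes M :: "('p::order, 'v::ab_group_add) rep"
  assumes M: "is_rep s M" and z: "\<And>i. space_at M i = {0}"
  shows "rep_iso s (pointwise_scale s) M (direct_sum [])"
proof (rule rep_isoI[OF M])
  interpret vector_space s using is_repD(1)[OF M] .
  have sp: "space_at (direct_sum [] :: ('p, nat \<Rightarrow> 'v) rep) i = {0}" for i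
    by (auto simp: direct_sum_def fun_eq_iff)
  show "rep_hom s (pointwise_scale s) M (direct_sum []) (\<lambda>_ _. 0)"
    by (auto simp: rep_hom_def linear_between_def sp pointwise_scale_def direct_sum_map fun_eq_iff)
  show "bij_betw (\<lambda>_. 0) (space_at M i) (space_at (direct_sum [] :: ('p, nat \<Rightarrow> 'v) rep) i)" for i
    using z sp by (simp add: bij_betw_def)
qed

lemma rep_iso_direct_sum_single:
  fixes M :: "('p::order, 'v::ab_group_add) rep"
  assumes M: "is_rep s M"
  shows "rep_iso s (pointwise_scale s) M (direct_sum [M])"
proof (rule rep_isoI[OF M])
  interpret vector_space s using is_repD(1)[OF M] .
  let ?h = "\<lambda>(i::'p) v (k::nat). if k = 0 then v else 0"
  show "rep_hom s (pointwise_scale s) M (direct_sum [M]) ?h"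
    using is_repD(8)[OF M]
    by (auto simp: rep_hom_def linear_between_def direct_sum_space power_space_def
        pointwise_scale_def direct_sum_map fun_eq_iff)
  show "bij_betw (?h i) (space_at M i) (space_at (direct_sum [M]) i)" for i
  proof (rule bij_betw_byWitness[where f' = "\<lambda>f. f 0"])
    show "\<forall>f\<in>space_at (direct_sum [M]) i. ?h i (f 0) = f"
      by (auto simp: direct_sum_space power_space_def fun_eq_iff)
  qed (auto simp: direct_sum_space power_space_def)
qed

text \<open>Flattens decompositions of two summands into one list; the coordinates of
  \<open>Bs\<close> are shifted by the length of \<open>As\<close>.\<close>

lemma rep_iso_direct_sum_append:
  assumes A: "is_rep s A" and B: "is_rep s B"
    and AA: "rep_iso s (pointwise_scale s) A (direct_sum As)"
    and BB: "rep_iso s (pointwise_scale s) B (direct_sum Bs)"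
  shows "rep_iso (pointwise_scale s) (pointwise_scale s) (direct_sum [A, B]) (direct_sum (As @ Bs))"
proof -
  have vs: "vector_space s" using is_repD(1)[OF A] .
  obtain \<alpha> where \<alpha>: "rep_hom s (pointwise_scale s) A (direct_sum As) \<alpha>"
    "\<And>i. bij_betw (\<alpha> i) (space_at A i) (space_at (direct_sum As) i)"
    using rep_isoE[OF AA] by blast
  obtain \<beta> where \<beta>: "rep_hom s (pointwise_scale s) B (direct_sum Bs) \<beta>"
    "\<And>i. bij_betw (\<beta> i) (space_at B i) (space_at (direct_sum Bs) i)"
    using rep_isoE[OF BB] by blast
  let ?n = "length As"
  let ?S = "direct_sum [A, B]"
  let ?T = "direct_sum (As @ Bs)"
  have S: "is_rep (pointwise_scale s) ?S"
    using A B by (intro direct_sum_is_rep[OF vs]) auto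
  have sp: "f \<in> space_at ?S i \<longleftrightarrow> f 0 \<in> space_at A i \<and> f 1 \<in> space_at B i \<and> (\<forall>k\<ge>2. f k = 0)" for f i
    by (auto simp: direct_sum_space power_space_def less_Suc_eq numeral_2_eq_2)
  have st: "struct_map ?S i j f 0 = struct_map A i j (f 0)"
    "struct_map ?S i j f (Suc 0) = struct_map B i j (f 1)" for i j f
    by (auto simp: direct_sum_map)
  define h where "h i f k = (if k < ?n then \<alpha> i (f 0) k else \<beta> i (f (1::nat)) (k - ?n))" for i f k
  have \<alpha>_out: "\<alpha> i a k = 0" if "a \<in> space_at A i" "\<not> k < ?n" for i a k
    using rep_homD(3)[OF \<alpha>(1) that(1)] that(2) by (simp add: direct_sum_space power_space_def)
  have \<beta>_out: "\<beta> i a k = 0" if "a \<in> space_at B i" "\<not> k < length Bs" for i a k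
    using rep_homD(3)[OF \<beta>(1) that(1)] that(2) by (simp add: direct_sum_space power_space_def)
  have \<alpha>_in: "\<alpha> i a k \<in> space_at (As ! k) i" if "a \<in> space_at A i" "k < ?n" for i a k
    using rep_homD(3)[OF \<alpha>(1) that(1)] that(2) by (simp add: direct_sum_space power_space_def)
  have \<beta>_in: "\<beta> i a k \<in> space_at (Bs ! k) i" if "a \<in> space_at B i" "k < length Bs" for i a k
    using rep_homD(3)[OF \<beta>(1) that(1)] that(2) by (simp add: direct_sum_space power_space_def)
  have h_mem: "h i f \<in> space_at ?T i" if f: "f \<in> space_at ?S i" for i f
    using f \<alpha>_in[of "f 0" i] \<beta>_in[of "f 1" i] \<beta>_out[of "f 1" i]
    by (auto simp: direct_sum_space[of "As @ Bs"] power_space_def h_def nth_append sp)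
  have lin: "linear_between (pointwise_scale s) (pointwise_scale s) (space_at ?S i) (space_at ?T i) (h i)" for i
    unfolding linear_between_def
  proof (intro conjI ballI allI)
    show "h i ` space_at ?S i \<subseteq> space_at ?T i" using h_mem by blast
    fix f g assume fg: "f \<in> space_at ?S i" "g \<in> space_at ?S i"
    then have "\<alpha> i (f 0 + g 0) = \<alpha> i (f 0) + \<alpha> i (g 0)" "\<beta> i (f 1 + g 1) = \<beta> i (f 1) + \<beta> i (g 1)"
      using rep_homD(1)[OF \<alpha>(1), of i] rep_homD(1)[OF \<beta>(1), of i] sp
      by (simp_all add: linear_between_def)
    then show "h i (f + g) = h i f + h i g" by (simp add: h_def fun_eq_iff)
  next
    fix c f assume f: "f \<in> space_at ?S i"
    then have "\<alpha> i (s c (f 0)) = pointwise_scale s c (\<alpha> i (f 0))"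
      "\<beta> i (s c (f 1)) = pointwise_scale s c (\<beta> i (f 1))"
      using rep_homD(1)[OF \<alpha>(1), of i] rep_homD(1)[OF \<beta>(1), of i] sp
      by (simp_all add: linear_between_def)
    then show "h i (pointwise_scale s c f) = pointwise_scale s c (h i f)"
      by (simp add: h_def fun_eq_iff pointwise_scale_def)
  qed
  have hom: "rep_hom (pointwise_scale s) (pointwise_scale s) ?S ?T h"
    unfolding rep_hom_def
  proof (intro conjI allI impI ballI)
    fix i show "linear_between (pointwise_scale s) (pointwise_scale s) (space_at ?S i) (space_at ?T i) (h i)"
      by (rule lin)
  next
    fix i j f assume ij: "i \<le> j" and f: "f \<in> space_at ?S i"
    have f01: "f 0 \<in> space_at A i" "f 1 \<in> space_at B i" using f sp by auto
    have 1: "\<alpha> j (struct_map A i j (f 0)) = struct_map (direct_sum As) i j (\<alpha> i (f 0))"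
      "\<beta> j (struct_map B i j (f 1)) = struct_map (direct_sum Bs) i j (\<beta> i (f 1))"
      using rep_homD(2)[OF \<alpha>(1) ij f01(1)] rep_homD(2)[OF \<beta>(1) ij f01(2)] .
    show "h j (struct_map ?S i j f) = struct_map ?T i j (h i f)"
    proof
      fix k
      show "h j (struct_map ?S i j f) k = struct_map ?T i j (h i f) k"
        using 1 by (simp add: h_def st direct_sum_map[of As] direct_sum_map[of Bs]
            direct_sum_map[of "As @ Bs"] nth_append) linarith
    qed
  qed
  have "bij_betw (h i) (space_at ?S i) (space_at ?T i)" for i
    unfolding bij_betw_def
  proof
    show "inj_on (h i) (space_at ?S i)"
    proof (rule inj_onI)
      fix f g assume f: "f \<in> space_at ?S i" and g: "g \<in> space_at ?S i" and eq: "h i f = h i g"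
      have "\<alpha> i (f 0) k = \<alpha> i (g 0) k" for k
        using fun_cong[OF eq, of k] f g sp \<alpha>_out by (cases "k < ?n") (auto simp: h_def)
      then have "\<alpha> i (f 0) = \<alpha> i (g 0)" by (simp add: fun_eq_iff)
      then have 0: "f 0 = g 0"
        using inj_onD[OF bij_betw_imp_inj_on[OF \<alpha>(2)]] f g sp by blast
      have "\<beta> i (f 1) k = \<beta> i (g 1) k" for k
        using fun_cong[OF eq, of "k + ?n"] by (simp add: h_def)
      then have "\<beta> i (f 1) = \<beta> i (g 1)" by (simp add: fun_eq_iff)
      then have 1: "f 1 = g 1"
        using inj_onD[OF bij_betw_imp_inj_on[OF \<beta>(2)]] f g sp by blast
      show "f = g"
      proof
        fix k :: nat
        consider "k = 0" | "k = 1" | "k \<ge> 2" by linarith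
        then show "f k = g k" using 0 1 f g sp by cases auto
      qed
    qed
    show "h i ` space_at ?S i = space_at ?T i"
    proof
      show "h i ` space_at ?S i \<subseteq> space_at ?T i" using h_mem by blast
      show "space_at ?T i \<subseteq> h i ` space_at ?S i"
      proof
        fix g assume g: "g \<in> space_at ?T i"
        have gT: "g k \<in> space_at ((As @ Bs) ! k) i" if "k < ?n + length Bs" for k
          using g that by (simp add: direct_sum_space power_space_def)
        have g0: "g k = 0" if "k \<ge> ?n + length Bs" for k
          using g that by (simp add: direct_sum_space power_space_def)
        let ?g1 = "\<lambda>k. if k < ?n then g k else 0"
        let ?g2 = "\<lambda>k. g (?n + k)"
        have "?g1 \<in> space_at (direct_sum As) i"
        proof -
          have "g k \<in> space_at (As ! k) i" if "k < ?n" for k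
            using gT[of k] that by (simp add: nth_append)
          then show ?thesis by (simp add: direct_sum_space power_space_def)
        qed
        then have "?g1 \<in> \<alpha> i ` space_at A i" unfolding bij_betw_imp_surj_on[OF \<alpha>(2)] .
        then obtain a where a: "?g1 = \<alpha> i a" "a \<in> space_at A i" by (rule imageE)
        have "?g2 k \<in> space_at (Bs ! k) i" if "k < length Bs" for k
          using gT[of "?n + k"] that by (simp add: nth_append)
        then have "?g2 \<in> space_at (direct_sum Bs) i"
          using g0 by (simp add: direct_sum_space power_space_def)
        then have "?g2 \<in> \<beta> i ` space_at B i" unfolding bij_betw_imp_surj_on[OF \<beta>(2)] .
        then obtain b where b: "?g2 = \<beta> i b" "b \<in> space_at B i" by (rule imageE)
        let ?f = "\<lambda>k::nat. if k = 0 then a else if k = 1 then b else 0"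
        have m: "?f \<in> space_at ?S i" using a b by (simp add: sp)
        have "h i ?f k = g k" for k
          using fun_cong[OF a(1), of k] fun_cong[OF b(1), of "k - ?n"] by (auto simp: h_def)
        then have eq: "h i ?f = g" by (simp add: fun_eq_iff)
        from imageI[OF m, of "h i"] show "g \<in> h i ` space_at ?S i" unfolding eq .
      qed
    qed
  qed
  then show ?thesis by (rule rep_isoI[OF S hom])
qed

text \<open>Two ambient spaces occur because summands in the ambient space of \<open>M\<close> are
  to be replaced by spread representations over the field.\<close>

lemma rep_iso_direct_sum_cong:
  assumes s: "vector_space s" and t: "vector_space t"
    and Ns: "\<And>N. N \<in> set Ns \<Longrightarrow> is_rep s N"
    and len: "length Ns = length Ks"
    and iso: "\<And>k. k < length Ns \<Longrightarrow> rep_iso s t (Ns ! k) (Ks ! k)"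
  shows "rep_iso (pointwise_scale s) (pointwise_scale t) (direct_sum Ns) (direct_sum Ks)"
proof -
  let ?n = "length Ns"
  have S: "is_rep (pointwise_scale s) (direct_sum Ns)" using direct_sum_is_rep[OF s Ns] .
  have "\<forall>k. \<exists>\<phi>. k < ?n \<longrightarrow> rep_hom s t (Ns ! k) (Ks ! k) \<phi> \<and>
      (\<forall>i. bij_betw (\<phi> i) (space_at (Ns ! k) i) (space_at (Ks ! k) i))"
    using iso rep_isoE by metis
  then obtain \<phi> where hom: "\<And>k. k < ?n \<Longrightarrow> rep_hom s t (Ns ! k) (Ks ! k) (\<phi> k)"
    and bij: "\<And>k i. k < ?n \<Longrightarrow> bij_betw (\<phi> k i) (space_at (Ns ! k) i) (space_at (Ks ! k) i)"
    by metis
  define h where "h i f k = (if k < ?n then \<phi> k i (f k) else 0)" for i f k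
  note N = direct_sum_space[of Ns] power_space_def
  note K = direct_sum_space[of Ks] power_space_def
  interpret S: vector_space s by (fact s)
  interpret T: vector_space t by (fact t)
  have h_mem: "h i f \<in> space_at (direct_sum Ks) i" if "f \<in> space_at (direct_sum Ns) i" for i f
    using that rep_homD(3)[OF hom] len by (auto simp: N K h_def)
  have "linear_between (pointwise_scale s) (pointwise_scale t)
      (space_at (direct_sum Ns) i) (space_at (direct_sum Ks) i) (h i)" for i
    unfolding linear_between_def
  proof (intro conjI ballI allI)
    show "h i ` space_at (direct_sum Ns) i \<subseteq> space_at (direct_sum Ks) i" using h_mem by blast
    fix f g assume "f \<in> space_at (direct_sum Ns) i" "g \<in> space_at (direct_sum Ns) i"
    then show "h i (f + g) = h i f + h i g"
      using rep_homD(1)[OF hom] by (simp add: h_def fun_eq_iff N linear_between_def)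
  next
    fix c f assume "f \<in> space_at (direct_sum Ns) i"
    then show "h i (pointwise_scale s c f) = pointwise_scale t c (h i f)"
      using rep_homD(1)[OF hom] by (simp add: h_def fun_eq_iff N linear_between_def pointwise_scale_def)
  qed
  moreover have "h j (struct_map (direct_sum Ns) i j f) = struct_map (direct_sum Ks) i j (h i f)"
    if "i \<le> j" "f \<in> space_at (direct_sum Ns) i" for i j f
    using rep_homD(2)[OF hom that(1)] that(2) len by (simp add: h_def fun_eq_iff N direct_sum_map)
  ultimately have "rep_hom (pointwise_scale s) (pointwise_scale t) (direct_sum Ns) (direct_sum Ks) h"
    unfolding rep_hom_def by blast
  moreover have "bij_betw (h i) (space_at (direct_sum Ns) i) (space_at (direct_sum Ks) i)" for i
    unfolding bij_betw_def
  proof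
    show "inj_on (h i) (space_at (direct_sum Ns) i)"
    proof (rule inj_onI)
      fix f g assume f: "f \<in> space_at (direct_sum Ns) i" and g: "g \<in> space_at (direct_sum Ns) i"
        and eq: "h i f = h i g"
      have "f k = g k" for k
      proof (cases "k < ?n")
        case True
        then have "\<phi> k i (f k) = \<phi> k i (g k)" using fun_cong[OF eq, of k] by (simp add: h_def)
        then show ?thesis
          using inj_onD[OF bij_betw_imp_inj_on[OF bij[OF True]]] f g True by (simp add: N)
      qed (use f g in \<open>simp add: N\<close>)
      then show "f = g" by (simp add: fun_eq_iff)
    qed
    show "h i ` space_at (direct_sum Ns) i = space_at (direct_sum Ks) i"
    proof
      show "h i ` space_at (direct_sum Ns) i \<subseteq> space_at (direct_sum Ks) i" using h_mem by blast
      show "space_at (direct_sum Ks) i \<subseteq> h i ` space_at (direct_sum Ns) i"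
      proof
        fix g assume g: "g \<in> space_at (direct_sum Ks) i"
        have "\<exists>u. k < ?n \<longrightarrow> u \<in> space_at (Ns ! k) i \<and> \<phi> k i u = g k" for k
        proof (cases "k < ?n")
          case True
          then have "g k \<in> \<phi> k i ` space_at (Ns ! k) i"
            using g len bij_betw_imp_surj_on[OF bij[OF True]] by (simp add: K)
          then show ?thesis by auto
        qed simp
        then obtain u where u: "\<And>k. k < ?n \<Longrightarrow> u k \<in> space_at (Ns ! k) i \<and> \<phi> k i (u k) = g k"
          by metis
        let ?f = "\<lambda>k. if k < ?n then u k else 0"
        have "?f \<in> space_at (direct_sum Ns) i" using u by (simp add: N)
        moreover have "h i ?f = g" using u g len by (simp add: h_def fun_eq_iff K)
        ultimately show "g \<in> h i ` space_at (direct_sum Ns) i" by (metis imageI)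
      qed
    qed
  qed
  ultimately show ?thesis by (rule rep_isoI[OF S])
qed

section \<open>Additivity, positivity and indecomposability\<close>

lemma N_two_eq_0_iff_zero:
  assumes M0: "is_rep0 s M"
  shows "N_two s M = 0 \<longleftrightarrow> rep_iso s s M zero_rep"
proof -
  interpret bigraded s M by (rule bigraded.intro[OF M0])
  show ?thesis using N_two_eq_0_iff rep_iso_zero_iff[OF M] by simp
qed

lemma N_two_pos:
  assumes M0: "is_rep0 s M" and "\<not> rep_iso s s M zero_rep"
  shows "0 < N_two s M"
proof -
  interpret bigraded s M by (rule bigraded.intro[OF M0])
  show ?thesis using N_two_eq_0_iff_zero[OF M0] N_two_nonneg assms(2) by linarith
qed

lemma N_two_pair:
  assumes M0: "is_rep0 s M" and A: "is_rep0 s A" and B: "is_rep0 s B"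
    and iso: "rep_iso s (pointwise_scale s) M (direct_sum [A, B])"
  shows "N_two s M = N_two s A + N_two s B"
proof -
  have "N_two s M = (\<Sum>k<length [A, B]. N_two s ([A, B] ! k))"
    using A B is_rep0D(1) is_repD(1)[OF is_rep0D(1)[OF M0]]
    by (intro N_two_direct_sum[OF M0 _ _ iso]) auto
  then show ?thesis by simp
qed

text \<open>The number 1 is not a sum of two positive integers.\<close>

lemma N_two_one_indecomposable:
  assumes M0: "is_rep0 s M" and N1: "N_two s M = 1"
  shows "indecomposable s M"
  unfolding indecomposable_def
proof (intro conjI allI impI)
  show "\<not> rep_iso s s M zero_rep" using N_two_eq_0_iff_zero[OF M0] N1 by simp
  fix A B assume A: "is_rep0 s A" and B: "is_rep0 s B"
    and iso: "rep_iso s (pointwise_scale s) M (direct_sum [A, B])"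
  show "rep_iso s s A zero_rep \<or> rep_iso s s B zero_rep"
    using N_two_pair[OF M0 A B iso] N1 N_two_pos[OF A] N_two_pos[OF B] by linarith
qed (rule M0)

lemma indecomposable_rep_iso:
  assumes M: "indecomposable s M" and N: "is_rep s N" and iso: "rep_iso s s M N"
  shows "indecomposable s N"
  unfolding indecomposable_def
proof (intro conjI allI impI)
  have M0: "is_rep0 s M" using M by (simp add: indecomposable_def)
  show "is_rep0 s N" using rep_iso_is_rep0[OF M0 N iso] .
  show "\<not> rep_iso s s N zero_rep"
    using M rep_iso_trans[OF iso, of s zero_rep] by (auto simp: indecomposable_def)
  fix A B assume AB: "is_rep0 s A" "is_rep0 s B" "rep_iso s (pointwise_scale s) N (direct_sum [A, B])"
  then show "rep_iso s s A zero_rep \<or> rep_iso s s B zero_rep"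
    using M rep_iso_trans[OF iso AB(3)] by (simp add: indecomposable_def)
qed

section \<open>Existence and uniqueness of the number of summands\<close>

definition indecomposable_decomposition ::
  "('k::field \<Rightarrow> 'v::ab_group_add \<Rightarrow> 'v) \<Rightarrow> ('p::order, 'v) rep \<Rightarrow> ('p, 'v) rep list \<Rightarrow> bool"
  where "indecomposable_decomposition s M Ns \<longleftrightarrow> (\<forall>N\<in>set Ns. indecomposable s N) \<and>
    rep_iso s (pointwise_scale s) M (direct_sum Ns)"

text \<open>\<open>indecomposable\<close> only tests summands with the same ambient space. As
  \<open>Ns\<close> may have another one, the hypothesis concerns copies of its members inside
  \<open>M\<close>, where the exchange argument takes place.\<close>

lemma decomposition_length_unique:
  assumes M0: "is_rep0 s M"
    and t: "vector_space t" and Ns: "\<And>N. N \<in> set Ns \<Longrightarrow> is_rep t N"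
    and isoN: "rep_iso s (pointwise_scale t) M (direct_sum Ns)"
    and indN: "\<And>N U. N \<in> set Ns \<Longrightarrow> subrep s M U \<Longrightarrow> rep_iso s t (sub_rep M U) N \<Longrightarrow>
      indecomposable s (sub_rep M U)"
    and Ks: "indecomposable_decomposition s M Ks"
  shows "length Ns = length Ks"
proof -
  interpret L: subgroup_lattice "subrep_lattice s M" "subrep_len s M"
    by (rule subrep_subgroup_lattice[OF M0])
  note s = is_repD(1)[OF is_rep0D(1)[OF M0]]
  have Ks': "\<And>K. K \<in> set Ks \<Longrightarrow> is_rep s K" "rep_iso s (pointwise_scale s) M (direct_sum Ks)"
    "\<And>K. K \<in> set Ks \<Longrightarrow> indecomposable s K"
    using Ks is_rep0D(1) by (auto simp: indecomposable_decomposition_def indecomposable_def)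
  obtain Us where Us: "length Us = length Ns"
    "\<And>k. k < length Ns \<Longrightarrow> subrep s M (Us ! k) \<and> rep_iso s t (sub_rep M (Us ! k)) (Ns ! k)"
    "L.idsum (sections (space_at M)) (map sections Us)"
    using direct_sum_internal[OF M0 t Ns isoN] by blast
  obtain Vs where Vs: "length Vs = length Ks"
    "\<And>k. k < length Ks \<Longrightarrow> subrep s M (Vs ! k) \<and> rep_iso s s (sub_rep M (Vs ! k)) (Ks ! k)"
    "L.idsum (sections (space_at M)) (map sections Vs)"
    using direct_sum_internal[OF M0 s Ks'(1,2)] by blast
  have "L.L_indec X" if "X \<in> set (map sections Us)" for X
  proof -
    obtain k where k: "k < length Ns" "X = sections (Us ! k)"
      using \<open>X \<in> set (map sections Us)\<close> Us(1) by (auto simp: in_set_conv_nth)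
    have "Ns ! k \<in> set Ns" using k(1) by simp
    then have "indecomposable s (sub_rep M (Us ! k))" using indN Us(2)[OF k(1)] by blast
    then show ?thesis using indecomposable_L_indec[OF M0] Us(2)[OF k(1)] k(2) by blast
  qed
  moreover have "L.L_indec X" if "X \<in> set (map sections Vs)" for X
  proof -
    obtain k where k: "k < length Ks" "X = sections (Vs ! k)"
      using \<open>X \<in> set (map sections Vs)\<close> Vs(1) by (auto simp: in_set_conv_nth)
    have sub: "subrep s M (Vs ! k)" and iso: "rep_iso s s (sub_rep M (Vs ! k)) (Ks ! k)"
      using Vs(2)[OF k(1)] by auto
    have "indecomposable s (Ks ! k)" using Ks'(3) k(1) by simp
    then have "indecomposable s (sub_rep M (Vs ! k))"
      by (rule indecomposable_rep_iso[OF _ sub_rep_is_rep[OF is_rep0D(1)[OF M0] sub] rep_iso_sym[OF iso]])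
    then show ?thesis using indecomposable_L_indec[OF M0 sub] k(2) by simp
  qed
  ultimately have "length (map sections Us) = length (map sections Vs)"
    using L.krull_schmidt_length[OF Us(3) _ Vs(3)] by blast
  then show ?thesis using Us(1) Vs(1) by simp
qed

lemma N_dec_eq_length:
  assumes M0: "is_rep0 s M" and Ks: "indecomposable_decomposition s M Ks"
  shows "N_dec s M = length Ks"
proof -
  note s = is_repD(1)[OF is_rep0D(1)[OF M0]]
  have "length Ns = length Ks" if Ns: "indecomposable_decomposition s M Ns" for Ns
  proof (rule decomposition_length_unique[OF M0 s _ _ _ Ks])
    show "is_rep s N" if "N \<in> set Ns" for N
      using Ns that is_rep0D(1) by (auto simp: indecomposable_decomposition_def indecomposable_def)
    show "rep_iso s (pointwise_scale s) M (direct_sum Ns)"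
      using Ns by (simp add: indecomposable_decomposition_def)
    fix N U assume N: "N \<in> set Ns" and U: "subrep s M U" and iso: "rep_iso s s (sub_rep M U) N"
    have "indecomposable s N" using N Ns by (simp add: indecomposable_decomposition_def)
    then show "indecomposable s (sub_rep M U)"
      by (rule indecomposable_rep_iso[OF _ sub_rep_is_rep[OF is_rep0D(1)[OF M0] U] rep_iso_sym[OF iso]])
  qed
  note unique = this
  have "(THE n. \<exists>Ns. length Ns = n \<and> indecomposable_decomposition s M Ns) = length Ks"
  proof (rule the_equality)
    show "\<exists>Ns. length Ns = length Ks \<and> indecomposable_decomposition s M Ns" using Ks by blast
  qed (use unique in blast)
  then show ?thesis unfolding N_dec_def indecomposable_decomposition_def .
qed

text \<open>The invariant is the termination measure: it is additive, and positive on nonzero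
  modules, so both parts of a proper splitting have a smaller value.\<close>

lemma indecomposable_decomposition_exists:
  fixes M :: "(int \<times> int, 'v::ab_group_add) rep"
  assumes "is_rep0 s M"
  shows "\<exists>Ns. indecomposable_decomposition s M Ns"
  using assms
proof (induction "nat (N_two s M)" arbitrary: M rule: less_induct)
  case less
  note M0 = less.prems and M = is_rep0D(1)[OF less.prems]
  consider "rep_iso s s M zero_rep" | "indecomposable s M"
    | A B where "is_rep0 s A" "is_rep0 s B" "rep_iso s (pointwise_scale s) M (direct_sum [A, B])"
      "\<not> rep_iso s s A zero_rep" "\<not> rep_iso s s B zero_rep"
    using M0 unfolding indecomposable_def by blast
  then show ?case
  proof cases
    case 1
    then have "indecomposable_decomposition s M []"
      using rep_iso_direct_sum_Nil[OF M] unfolding rep_iso_zero_iff[OF M]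
      by (simp only: indecomposable_decomposition_def) simp
    then show ?thesis ..
  next
    case 2
    then have "indecomposable_decomposition s M [M]"
      using rep_iso_direct_sum_single[OF M] by (simp add: indecomposable_decomposition_def)
    then show ?thesis ..
  next
    case 3
    have "nat (N_two s A) < nat (N_two s M)" "nat (N_two s B) < nat (N_two s M)"
      using N_two_pair[OF M0 3(1,2,3)] N_two_pos[OF 3(1,4)] N_two_pos[OF 3(2,5)] by auto
    then obtain As Bs where AB: "indecomposable_decomposition s A As" "indecomposable_decomposition s B Bs"
      using less.hyps 3(1,2) by blast
    then have "rep_iso s (pointwise_scale s) A (direct_sum As)" "rep_iso s (pointwise_scale s) B (direct_sum Bs)"
      by (auto simp: indecomposable_decomposition_def)
    from rep_iso_trans[OF 3(3) rep_iso_direct_sum_append[OF is_rep0D(1)[OF 3(1)] is_rep0D(1)[OF 3(2)] this]]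
    have "indecomposable_decomposition s M (As @ Bs)"
      using AB by (auto simp: indecomposable_decomposition_def)
    then show ?thesis ..
  qed
qed

lemma N_two_one_iff_spread:
  fixes s :: "'k::field \<Rightarrow> 'v::ab_group_add \<Rightarrow> 'v" and M :: "(int \<times> int, 'v) rep"
  assumes M0: "is_rep0 s M"
  shows "N_two s M = 1 \<longleftrightarrow> iso_to_spread_rep s M"
proof
  assume "N_two s M = 1"
  then interpret bigraded_one s M
    using M0 by (simp add: bigraded_one_def bigraded_def bigraded_one_axioms_def)
  show "iso_to_spread_rep s M" by (rule iso_to_spread)
next
  assume "iso_to_spread_rep s M"
  then obtain I where I: "spread I" and iso: "rep_iso s (*) M (spread_rep I)"
    by (auto simp: iso_to_spread_rep_def)
  have R: "is_rep (*) (spread_rep I :: (int \<times> int, 'k) rep)"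
    by (rule spread_rep_is_rep) (use I in \<open>simp add: spread_def\<close>)
  \<comment> \<open>Spreads may be infinite; this one is the support of a representation isomorphic
    to \<open>M\<close>.\<close>
  have "finite I"
    using is_rep0D(3)[OF rep_iso_is_rep0[OF M0 R iso]] spread_rep_support[of I, where 'k = 'k] by simp
  then show "N_two s M = 1"
    using N_two_rep_iso[OF M0 R iso] N_two_spread_rep[OF I, where 'k = 'k] by simp
qed

text \<open>Every copy of a summand inside \<open>M\<close> has invariant 1 and is therefore
  indecomposable. The spread decomposition thus counts \<open>N_dec\<close>, and additivity gives
  the invariant the same value.\<close>

lemma spread_decomposition_N_two:
  fixes s :: "'k::field \<Rightarrow> 'v::ab_group_add \<Rightarrow> 'v" and M :: "(int \<times> int, 'v) rep"
  assumes M0: "is_rep0 s M" and Is: "\<forall>I\<in>set Is. spread I"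
    and iso: "rep_iso s (pointwise_scale (*)) M (direct_sum (map spread_rep Is))"
  shows "N_two s M = int (length Is)" and "N_dec s M = length Is"
proof -
  let ?Ns = "map spread_rep Is :: (int \<times> int, 'k) rep list"
  note s = is_repD(1)[OF is_rep0D(1)[OF M0]]
  have rep: "is_rep (*) N" if "N \<in> set ?Ns" for N
    using Is that spread_rep_is_rep by (auto simp: spread_def)
  have one: "N_two (*) N = 1" if N: "N \<in> set ?Ns" for N
  proof -
    obtain I where I: "I \<in> set Is" "N = spread_rep I" using N by auto
    have "finite I"
      using is_rep0D(3)[OF direct_sum_summand_is_rep0(1)[OF M0 rep vector_space_field iso N]]
        spread_rep_support[of I, where 'k = 'k] I(2) by simp
    then show ?thesis using N_two_spread_rep[of I, where 'k = 'k] Is I by simp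
  qed
  have "N_two s M = (\<Sum>k<length ?Ns. N_two (*) (?Ns ! k))"
    by (rule N_two_direct_sum[OF M0 rep vector_space_field iso])
  also have "\<dots> = (\<Sum>k<length ?Ns. 1)"
    by (rule sum.cong) (use one in auto)
  finally show "N_two s M = int (length Is)" by simp
  obtain Ks where Ks: "indecomposable_decomposition s M Ks"
    using indecomposable_decomposition_exists[OF M0] by blast
  have "length ?Ns = length Ks"
  proof (rule decomposition_length_unique[OF M0 vector_space_field rep iso _ Ks])
    fix N U assume N: "N \<in> set ?Ns" and U: "subrep s M U" and isoN: "rep_iso s (*) (sub_rep M U) N"
    have U0: "is_rep0 s (sub_rep M U)" using sub_rep_is_rep0[OF M0 U] .
    show "indecomposable s (sub_rep M U)"
      using N_two_rep_iso[OF U0 rep[OF N] isoN] one[OF N] by (intro N_two_one_indecomposable[OF U0]) simp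
  qed
  then show "N_dec s M = length Is" using N_dec_eq_length[OF M0 Ks] by simp
qed

text \<open>Every indecomposable summand contributes at least 1 to the invariant. Equality forces
  each contribution to be exactly 1, and a summand with invariant 1 is a spread.\<close>

lemma N_dec_le_N_two:
  assumes M0: "is_rep0 s M"
  shows "int (N_dec s M) \<le> N_two s M"
    and "N_two s M = int (N_dec s M) \<Longrightarrow> spread_decomposable s M"
proof -
  note s = is_repD(1)[OF is_rep0D(1)[OF M0]]
  obtain Ks where Ks: "indecomposable_decomposition s M Ks"
    using indecomposable_decomposition_exists[OF M0] by blast
  then have iso: "rep_iso s (pointwise_scale s) M (direct_sum Ks)"
    and K: "\<And>K. K \<in> set Ks \<Longrightarrow> is_rep0 s K" "\<And>K. K \<in> set Ks \<Longrightarrow> \<not> rep_iso s s K zero_rep"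
    by (auto simp: indecomposable_decomposition_def indecomposable_def)
  have pos: "1 \<le> N_two s (Ks ! k)" if "k < length Ks" for k
    using N_two_pos[OF K(1,2)] that by (simp add: int_one_le_iff_zero_less)
  have dec: "N_dec s M = length Ks" by (rule N_dec_eq_length[OF M0 Ks])
  have sum: "N_two s M = (\<Sum>k<length Ks. N_two s (Ks ! k))"
    by (rule N_two_direct_sum[OF M0 is_rep0D(1)[OF K(1)] s iso])
  have "int (length Ks) = (\<Sum>k<length Ks. 1)" by simp
  also have "\<dots> \<le> N_two s M" unfolding sum by (rule sum_mono) (use pos in simp)
  finally show "int (N_dec s M) \<le> N_two s M" by (simp add: dec)
  assume "N_two s M = int (N_dec s M)"
  then have "(\<Sum>k<length Ks. N_two s (Ks ! k) - 1) = 0" by (simp add: sum dec sum_subtractf)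
  then have "\<forall>k<length Ks. N_two s (Ks ! k) - 1 = 0"
    using pos by (subst (asm) sum_nonneg_eq_0_iff) (auto simp: int_one_le_iff_zero_less)
  then have "iso_to_spread_rep s (Ks ! k)" if "k < length Ks" for k
    using N_two_one_iff_spread[OF K(1)[OF nth_mem[OF that]]] that by simp
  then have "\<forall>k. \<exists>I. k < length Ks \<longrightarrow> spread I \<and> rep_iso s (*) (Ks ! k) (spread_rep I)"
    by (auto simp: iso_to_spread_rep_def)
  then obtain I where I: "\<And>k. k < length Ks \<Longrightarrow> spread (I k)"
    "\<And>k. k < length Ks \<Longrightarrow> rep_iso s (*) (Ks ! k) (spread_rep (I k))" by metis
  let ?Is = "map I [0..<length Ks]"
  have "rep_iso (pointwise_scale s) (pointwise_scale (*)) (direct_sum Ks) (direct_sum (map spread_rep ?Is))"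
    by (rule rep_iso_direct_sum_cong[OF s vector_space_field is_rep0D(1)[OF K(1)]]) (use I(2) in auto)
  then have "rep_iso s (pointwise_scale (*)) M (direct_sum (map spread_rep ?Is))"
    by (rule rep_iso_trans[OF iso])
  moreover have "\<forall>J\<in>set ?Is. spread J" using I(1) by auto
  ultimately show "spread_decomposable s M" unfolding spread_decomposable_def by blast
qed

theorem corollaryC:
  fixes s :: "'k::field \<Rightarrow> 'v::ab_group_add \<Rightarrow> 'v"
    and M :: "(int \<times> int, 'v) rep"
  assumes "is_rep0 s M"
  shows "(\<forall>i. N_two s M \<ge> int (vector_space.dim s (space_at M i)))
    \<and> (N_two s M = 0 \<longleftrightarrow> rep_iso s s M zero_rep)
    \<and> (N_two s M = 1 \<longleftrightarrow> iso_to_spread_rep s M)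
    \<and> (N_two s M \<ge> int (N_dec s M)
       \<and> (N_two s M = int (N_dec s M) \<longleftrightarrow> spread_decomposable s M))"
proof (intro conjI allI)
  interpret bigraded s M by (rule bigraded.intro[OF assms])
  show "int (vector_space.dim s (space_at M i)) \<le> N_two s M" for i by (rule dim_le_N_two)
  show "N_two s M = 0 \<longleftrightarrow> rep_iso s s M zero_rep" by (rule N_two_eq_0_iff_zero[OF assms])
  show "N_two s M = 1 \<longleftrightarrow> iso_to_spread_rep s M" by (rule N_two_one_iff_spread[OF assms])
  show "int (N_dec s M) \<le> N_two s M" by (rule N_dec_le_N_two[OF assms])
  show "N_two s M = int (N_dec s M) \<longleftrightarrow> spread_decomposable s M"
  proof
    assume "spread_decomposable s M"
    then obtain Is where "\<forall>I\<in>set Is. spread I"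
      "rep_iso s (pointwise_scale (*)) M (direct_sum (map spread_rep Is))"
      unfolding spread_decomposable_def by blast
    from spread_decomposition_N_two[OF assms this] show "N_two s M = int (N_dec s M)" by simp
  qed (rule N_dec_le_N_two(2)[OF assms])
qed

end
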